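(* There exist almost complex structures on the Kodaira-Thurston manifold $\mathrm{KT}^4$ such that $h^{0,1}$ varies with different choices of almost Kähler metrics. That is, there exist (smooth) almost complex structures $J$ on $\mathrm{KT}^4$ for which there are two almost Kähler metrics $g_1, g_2$ compatible with the same $J$ satisfying $h^{0,1}(J,g_1)\neq h^{0,1}(J,g_2)$.
   Context: Kodaira-Thurston manifold: let $G$ be $\mathbb{R}^4$ with the group operation $(t_0,x_0,y_0,z_0)\circ(t,x,y,z)=(t+t_0,\ x+x_0,\ y+y_0,\ z+z_0+x_0y)$, and let $\Gamma=\mathbb{Z}^4\subset G$, a discrete subgroup acting on $G$ by left multiplication. Then $\mathrm{KT}^4=\Gamma\backslash G$, a compact smooth $4$-manifold. Let $(M,J)$ be a compact almost complex manifold of real dimension $2n$ ($J$ not assumed integrable). $J$ induces the decomposition $T^*M\otimes\mathbb{C}=(T^*M)^{1,0}\oplus(T^*M)^{0,1}$ and hence a decomposition of smooth complex differential forms into $(p,q)$-forms. The operator $\bar\partial$ (respectively $\partial$) is the component of the exterior derivative $d$ taking $(p,q)$-forms to $(p,q+1)$-forms (respectively $(p+1,q)$-forms). A Hermitian metric on $(M,J)$ is a Riemannian metric $g$ with $g(JX,JY)=g(X,Y)$ for all $X,Y$; its associated $2$-form is $\omega(X,Y)=g(JX,Y)$. The metric is called almost Kähler (compatible with $J$) if $d\omega=0$. Given a Hermitian metric, the ($\mathbb{C}$-linear) Hodge star $*$ is defined by $\alpha\wedge *\bar\beta=g(\alpha,\beta)\,\mathrm{vol}$, where $g(\cdot,\cdot)$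 here denotes the induced Hermitian inner product on complex forms and $\mathrm{vol}$ is the volume form of $g$ (with the orientation given by $J$). Set $\bar\partial^*=-*\partial*$ and $\Delta_{\bar\partial}=\bar\partial\bar\partial^*+\bar\partial^*\bar\partial$. Define $\mathcal{H}^{p,q}$ to be the kernel of $\Delta_{\bar\partial}$ on smooth $(p,q)$-forms, and $h^{p,q}=h^{p,q}(J,g)=\dim_{\mathbb{C}}\mathcal{H}^{p,q}$ (finite since $\Delta_{\bar\partial}$ is elliptic and $M$ is compact). *)

theory Defs
  imports "HOL-Analysis.Analysis" "HOL-Library.Function_Algebras" "HOL-Library.Extended_Nat"
begin

text \<open>
  The projection from G to the quotient of G by \<open>\<Gamma>\<close> is a covering whose deck transformations are
  the left translations by \<open>\<Gamma>\<close>.  Smooth tensor fields on the Kodaira-Thurston manifold are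
  therefore given as smooth tensor fields on G = \<open>\<real>\<^sup>4\<close> that are invariant under these translations.
  The coordinates (t,x,y,z) are the components 1,2,3,4.
\<close>

type_synonym vec4 = "real ^ 4"

definition kt_mult :: "vec4 \<Rightarrow> vec4 \<Rightarrow> vec4" where
  "kt_mult a b = (\<chi> i. b $ i + a $ i + (if i = 4 then a $ 2 * b $ 3 else 0))"

definition kt_lattice :: "vec4 set" where
  "kt_lattice = {a. \<forall>i. a $ i \<in> \<int>}"

definition kt_push :: "vec4 \<Rightarrow> vec4 \<Rightarrow> vec4 \<Rightarrow> vec4" where
  "kt_push a x = frechet_derivative (kt_mult a) (at x)"

primrec C_k :: "nat \<Rightarrow> ('a::euclidean_space \<Rightarrow> 'b::real_normed_vector) \<Rightarrow> bool" where
  "C_k 0 f \<longleftrightarrow> continuous_on UNIV f"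
| "C_k (Suc n) f \<longleftrightarrow> (\<forall>x. f differentiable (at x)) \<and>
     (\<forall>v. C_k n (\<lambda>x. frechet_derivative f (at x) v))"

definition smooth :: "('a::euclidean_space \<Rightarrow> 'b::real_normed_vector) \<Rightarrow> bool" where
  "smooth f \<longleftrightarrow> (\<forall>n. C_k n f)"


section \<open>Complex exterior algebra of a tangent space\<close>

text \<open>
  A covector of degree k is a function on lists of tangent vectors vanishing on all lists whose
  length is not k, so that all degrees live in one type and a covector is determined by its values
  on k-tuples.
\<close>

type_synonym covec = "vec4 list \<Rightarrow> complex"

definition alternating :: "nat \<Rightarrow> covec \<Rightarrow> bool" where
  "alternating k \<phi> \<longleftrightarrow>
     (\<forall>vs. length vs \<noteq> k \<longrightarrow> \<phi> vs = 0) \<and>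
     (\<forall>vs i. length vs = k \<longrightarrow> i < k \<longrightarrow> linear (\<lambda>v. \<phi> (vs[i := v]))) \<and>
     (\<forall>vs i j. length vs = k \<longrightarrow> i < j \<longrightarrow> j < k \<longrightarrow> vs ! i = vs ! j \<longrightarrow> \<phi> vs = 0)"

definition conj_covec :: "covec \<Rightarrow> covec" where
  "conj_covec \<phi> = (\<lambda>vs. cnj (\<phi> vs))"

definition scale_covec :: "complex \<Rightarrow> covec \<Rightarrow> covec" where
  "scale_covec c \<phi> = (\<lambda>vs. c * \<phi> vs)"

interpretation covec: vector_space scale_covec
  by unfold_locales (auto simp: scale_covec_def fun_eq_iff algebra_simps)

text \<open>
  The wedge product in its shuffle form: S is the set of positions of the arguments of the first
  factor, and the sign is that of the shuffle moving these positions to the front.  Thus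
  the wedge of 1-covectors is the determinant of their values, without factorials.
\<close>

definition shuffle_sign :: "nat \<Rightarrow> nat set \<Rightarrow> complex" where
  "shuffle_sign n S = (-1) ^ card {(i, j). i \<in> S \<and> j \<in> {..<n} - S \<and> j < i}"

definition wedge :: "covec \<Rightarrow> covec \<Rightarrow> covec" where
  "wedge \<phi> \<psi> = (\<lambda>vs. \<Sum>S\<in>Pow {..<length vs}.
     shuffle_sign (length vs) S * \<phi> (nths vs S) * \<psi> (nths vs (- S)))"

definition unit_covec :: covec where
  "unit_covec = (\<lambda>vs. if vs = [] then 1 else 0)"

definition wedge_list :: "covec list \<Rightarrow> covec" where
  "wedge_list \<phi>s = foldr wedge \<phi>s unit_covec"


subsection \<open>Bidegrees with respect to a linear complex structure\<close>

definition covec10 :: "(vec4 \<Rightarrow> vec4) \<Rightarrow> covec set" where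
  "covec10 J = {\<phi>. alternating 1 \<phi> \<and> (\<forall>v. \<phi> [J v] = \<i> * \<phi> [v])}"

definition covec01 :: "(vec4 \<Rightarrow> vec4) \<Rightarrow> covec set" where
  "covec01 J = {\<phi>. alternating 1 \<phi> \<and> (\<forall>v. \<phi> [J v] = - \<i> * \<phi> [v])}"

definition covec_pq :: "(vec4 \<Rightarrow> vec4) \<Rightarrow> nat \<Rightarrow> nat \<Rightarrow> covec set" where
  "covec_pq J p q = covec.span {wedge_list (\<alpha>s @ \<beta>s) | \<alpha>s \<beta>s.
     length \<alpha>s = p \<and> set \<alpha>s \<subseteq> covec10 J \<and> length \<beta>s = q \<and> set \<beta>s \<subseteq> covec01 J}"

text \<open>The (p,q) component of a covector of degree p + q.\<close>

definition pq_part :: "(vec4 \<Rightarrow> vec4) \<Rightarrow> nat \<Rightarrow> nat \<Rightarrow> covec \<Rightarrow> covec" where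
  "pq_part J p q \<phi> = (THE \<psi>. \<exists>c. (\<forall>r\<le>p + q. c r \<in> covec_pq J r (p + q - r)) \<and>
     \<phi> = (\<Sum>r\<le>p + q. c r) \<and> \<psi> = c p)"


subsection \<open>Inner product, volume and Hodge star\<close>

definition gram :: "(vec4 \<Rightarrow> vec4 \<Rightarrow> real) \<Rightarrow> real ^ 4 ^ 4" where
  "gram g = (\<chi> i j. g (axis i 1) (axis j 1))"

text \<open>
  The Hermitian inner product induced on covectors of degree k: contraction of all indices with
  the inverse of the metric, normalised by 1/k! so that the wedge products, with increasing indices,
  of a g-orthonormal coframe are orthonormal.
\<close>

definition covec_inner :: "(vec4 \<Rightarrow> vec4 \<Rightarrow> real) \<Rightarrow> nat \<Rightarrow> covec \<Rightarrow> covec \<Rightarrow> complex" where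
  "covec_inner g k \<phi> \<psi> = 1 / fact k *
     (\<Sum>I | length I = k. \<Sum>L | length L = k.
        complex_of_real (\<Prod>m<k. matrix_inv (gram g) $ (I ! m) $ (L ! m)) *
        \<phi> (map (\<lambda>i. axis i 1) I) * cnj (\<psi> (map (\<lambda>i. axis i 1) L)))"

text \<open>In the orientation given by J, the bases of the form (u, J u, w, J w) are positive.\<close>

definition orientation_sign :: "(vec4 \<Rightarrow> vec4) \<Rightarrow> real" where
  "orientation_sign J =
     (if \<exists>u w. det (vector [u, J u, w, J w] :: real ^ 4 ^ 4) > 0 then 1 else - 1)"

definition vol :: "(vec4 \<Rightarrow> vec4) \<Rightarrow> (vec4 \<Rightarrow> vec4 \<Rightarrow> real) \<Rightarrow> covec" where
  "vol J g = (\<lambda>vs. if length vs = 4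
     then complex_of_real (orientation_sign J * sqrt (det (gram g)) * det (vector vs :: real ^ 4 ^ 4))
     else 0)"

text \<open>
  The defining property \<open>\<alpha> \<and> *\<beta>\<^sup>- = g(\<alpha>, \<beta>) vol\<close> is applied with \<open>\<beta>\<close> the conjugate of the argument.
\<close>

definition hodge_covec ::
    "(vec4 \<Rightarrow> vec4) \<Rightarrow> (vec4 \<Rightarrow> vec4 \<Rightarrow> real) \<Rightarrow> nat \<Rightarrow> covec \<Rightarrow> covec" where
  "hodge_covec J g k \<phi> =
     (if k \<le> 4
      then THE \<eta>. alternating (4 - k) \<eta> \<and>
        (\<forall>\<alpha>. alternating k \<alpha> \<longrightarrow>
           wedge \<alpha> \<eta> = scale_covec (covec_inner g k \<alpha> (conj_covec \<phi>)) (vol J g))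
      else 0)"


section \<open>Tensor fields on the Kodaira-Thurston manifold\<close>

type_synonym endo_field = "vec4 \<Rightarrow> vec4 \<Rightarrow> vec4"
type_synonym bilin_field = "vec4 \<Rightarrow> vec4 \<Rightarrow> vec4 \<Rightarrow> real"
type_synonym form = "vec4 \<Rightarrow> covec"

definition almost_complex_structure :: "endo_field \<Rightarrow> bool" where
  "almost_complex_structure J \<longleftrightarrow>
     (\<forall>x. linear (J x) \<and> (\<forall>v. J x (J x v) = - v)) \<and>
     (\<forall>v. smooth (\<lambda>x. J x v)) \<and>
     (\<forall>a\<in>kt_lattice. \<forall>x v. J (kt_mult a x) (kt_push a x v) = kt_push a x (J x v))"

definition riemannian_metric :: "bilin_field \<Rightarrow> bool" where
  "riemannian_metric g \<longleftrightarrow>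
     (\<forall>x. bilinear (g x) \<and> (\<forall>v w. g x v w = g x w v) \<and> (\<forall>v. v \<noteq> 0 \<longrightarrow> g x v v > 0)) \<and>
     (\<forall>v w. smooth (\<lambda>x. g x v w)) \<and>
     (\<forall>a\<in>kt_lattice. \<forall>x v w. g (kt_mult a x) (kt_push a x v) (kt_push a x w) = g x v w)"

definition hermitian_metric :: "endo_field \<Rightarrow> bilin_field \<Rightarrow> bool" where
  "hermitian_metric J g \<longleftrightarrow>
     riemannian_metric g \<and> (\<forall>x v w. g x (J x v) (J x w) = g x v w)"

definition kt_form :: "nat \<Rightarrow> form \<Rightarrow> bool" where
  "kt_form k \<alpha> \<longleftrightarrow>
     (\<forall>x. alternating k (\<alpha> x)) \<and>
     (\<forall>vs. smooth (\<lambda>x. \<alpha> x vs)) \<and>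
     (\<forall>a\<in>kt_lattice. \<forall>x vs. \<alpha> (kt_mult a x) (map (kt_push a x) vs) = \<alpha> x vs)"

definition kt_form_pq :: "endo_field \<Rightarrow> nat \<Rightarrow> nat \<Rightarrow> form \<Rightarrow> bool" where
  "kt_form_pq J p q \<alpha> \<longleftrightarrow> kt_form (p + q) \<alpha> \<and> (\<forall>x. \<alpha> x \<in> covec_pq (J x) p q)"

definition scale_form :: "complex \<Rightarrow> form \<Rightarrow> form" where
  "scale_form c \<alpha> = (\<lambda>x. scale_covec c (\<alpha> x))"

interpretation form: vector_space scale_form
  by unfold_locales (auto simp: scale_form_def scale_covec_def fun_eq_iff algebra_simps)


section \<open>Differential operators\<close>

text \<open>
  The exterior derivative, by the invariant formula applied to constant vector fields (whose
  brackets vanish); normalised compatibly with the wedge product above.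
\<close>

definition ext_d :: "form \<Rightarrow> form" where
  "ext_d \<alpha> = (\<lambda>x vs. \<Sum>i<length vs.
     (-1) ^ i * frechet_derivative (\<lambda>y. \<alpha> y (take i vs @ drop (Suc i) vs)) (at x) (vs ! i))"

text \<open>
  On forms of degree k, the operators \<open>\<partial>\<close> and its conjugate are defined by linear extension from the
  forms of type (p,k-p), \<open>p \<le> k\<close>.
\<close>

definition del :: "endo_field \<Rightarrow> nat \<Rightarrow> form \<Rightarrow> form" where
  "del J k \<alpha> = (\<lambda>x. \<Sum>p\<le>k.
     pq_part (J x) (p + 1) (k - p) (ext_d (\<lambda>y. pq_part (J y) p (k - p) (\<alpha> y)) x))"

definition delbar :: "endo_field \<Rightarrow> nat \<Rightarrow> form \<Rightarrow> form" where
  "delbar J k \<alpha> = (\<lambda>x. \<Sum>p\<le>k.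
     pq_part (J x) p (k - p + 1) (ext_d (\<lambda>y. pq_part (J y) p (k - p) (\<alpha> y)) x))"

definition hodge :: "endo_field \<Rightarrow> bilin_field \<Rightarrow> nat \<Rightarrow> form \<Rightarrow> form" where
  "hodge J g k \<alpha> = (\<lambda>x. hodge_covec (J x) (g x) k (\<alpha> x))"

definition delbar_star :: "endo_field \<Rightarrow> bilin_field \<Rightarrow> nat \<Rightarrow> form \<Rightarrow> form" where
  "delbar_star J g k \<alpha> = - hodge J g (5 - k) (del J (4 - k) (hodge J g k \<alpha>))"

text \<open>In degree 0 the first summand vanishes, since \<open>hodge J g 5\<close> is zero.\<close>

definition laplacian :: "endo_field \<Rightarrow> bilin_field \<Rightarrow> nat \<Rightarrow> form \<Rightarrow> form" where
  "laplacian J g k \<alpha> =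
     delbar J (k - 1) (delbar_star J g k \<alpha>) + delbar_star J g (k + 1) (delbar J k \<alpha>)"

definition harmonic_forms :: "endo_field \<Rightarrow> bilin_field \<Rightarrow> nat \<Rightarrow> nat \<Rightarrow> form set" where
  "harmonic_forms J g p q = {\<alpha>. kt_form_pq J p q \<alpha> \<and> laplacian J g (p + q) \<alpha> = 0}"

text \<open>
  The library's dimension of an infinite-dimensional space is 0; the value \<open>\<infinity>\<close> separates that
  case, which does not occur here by ellipticity.
\<close>

definition hodge_number :: "endo_field \<Rightarrow> bilin_field \<Rightarrow> nat \<Rightarrow> nat \<Rightarrow> enat" where
  "hodge_number J g p q =
     (if \<exists>B. finite B \<and> harmonic_forms J g p q \<subseteq> form.span B
      then enat (form.dim (harmonic_forms J g p q)) else \<infinity>)"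


section \<open>Almost Kaehler metrics\<close>

definition fundamental_form :: "endo_field \<Rightarrow> bilin_field \<Rightarrow> form" where
  "fundamental_form J g = (\<lambda>x vs. if length vs = 2
     then complex_of_real (g x (J x (vs ! 0)) (vs ! 1)) else 0)"

definition almost_kaehler :: "endo_field \<Rightarrow> bilin_field \<Rightarrow> bool" where
  "almost_kaehler J g \<longleftrightarrow> hermitian_metric J g \<and> ext_d (fundamental_form J g) = 0"

end

theory Submission
  imports Defs
begin

text \<open>
  Fix \<open>\<beta> = 8 \<pi>\<close> and let \<open>J\<close> be the left-invariant almost complex structure whose (1,0)-forms are spanned
  by \<open>dt + \<i> dx\<close> and \<open>dy + \<i> \<beta> (dz - x dy)\<close>.  The metrics
  \<open>dt\<^sup>2 + dx\<^sup>2 + r\<^sup>2 (dy\<^sup>2 + \<beta>\<^sup>2 (dz - x dy)\<^sup>2)\<close>, \<open>r > 0\<close>, are all almost Kaehler, their fundamental forms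
  having constant coefficients.  A (0,1)-form is harmonic iff its two coefficient functions satisfy a
  first order system depending on \<open>r\<close>.  On functions of \<open>x, y\<close> of frequency \<open>(l, m)\<close> the system
  has a nontrivial solution iff \<open>r\<^sup>2 l (l + 2) + m\<^sup>2 = 0\<close>; for \<open>r = 1\<close> the three frequencies
  \<open>(0, 0)\<close>, \<open>(-1, 1)\<close>, \<open>(-1, -1)\<close> give three independent harmonic forms.

  For small \<open>r\<close> there are at most two.  Integrating by parts, a solution first does not depend on \<open>t\<close>;
  the system is then a Dirac type equation, whose energy identity bounds the \<open>z\<close>-derivative of a
  solution by a small multiple of the solution itself.  Applied to the \<open>z\<close>-derivative of a solution,
  this contradicts the Poincare inequality unless that derivative vanishes.  The same argument
  removes the dependence on \<open>y\<close>, and the remaining ordinary differential equation in \<open>x\<close> has a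
  two-dimensional space of solutions.
\<close>

text \<open>Pairing \<open>dy\<close> with \<open>dz - x dy\<close> in J is what makes the family of
  metrics possible: the wedge product of these two forms is that of \<open>dy\<close> and
  \<open>dz\<close>, so rescaling their plane by \<open>r\<^sup>2\<close> leaves the fundamental
  form closed. On the other hand \<open>dz - x dy\<close> itself is not closed, and its differential
  puts a zeroth order term \<open>\<beta>/4\<close> into the system. On functions of frequency l in
  x this term replaces one of the two factors l in the determinant by
  \<open>l + \<beta>/(4 \<pi>)\<close>. The value \<open>8 \<pi>\<close> makes the shift equal to 2,
  so the product l (l + 2) is negative at the integer -1, and r = 1 balances it against m = 1 and m
  = -1. Fourier modes give only the lower bound. The upper bound must exclude every smooth solution,
  and functions that depend on z are not periodic in x: the lattice translation in x shears z by y.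
  They have no plain Fourier series in x, y and z. The energy estimates avoid any expansion; they
  rest on the frame fields being skew-adjoint, on the z-field being central, and on Poincare
  inequalities along circles.\<close>

section \<open>The wedge product evaluated by peeling off arguments\<close>

lemma wedge_Nil: "wedge \<phi> \<psi> [] = \<phi> [] * \<psi> []"
  by (simp add: wedge_def shuffle_sign_def)

lemma nths_Cons_Suc_image: "nths (v # vs) (Suc ` S) = nths vs S"
  by (simp add: nths_Cons inj_image_mem_iff)

lemma nths_Cons_insert_0: "nths (v # vs) (insert 0 (Suc ` S)) = v # nths vs S"
  by (simp add: nths_Cons image_iff)

lemma nths_Cons_Compl_Suc_image: "nths (v # vs) (- (Suc ` S)) = v # nths vs (- S)"
  by (simp add: nths_Cons inj_image_mem_iff Compl_eq)

lemma nths_Cons_Compl_insert_0: "nths (v # vs) (- insert 0 (Suc ` S)) = nths vs (- S)"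
  by (simp add: nths_Cons inj_image_mem_iff Compl_eq)

lemma length_nths_subset: "S \<subseteq> {..<length vs} \<Longrightarrow> length (nths vs S) = card S"
  by (simp add: length_nths) (metis (no_types, lifting) Collect_mem_eq Collect_cong lessThan_iff subsetD)

lemma inj_on_map_prod_Suc: "inj_on (map_prod Suc Suc) A"
  by (auto simp: inj_on_def)

lemma shuffle_sign_insert_0:
  "shuffle_sign (Suc n) (insert 0 (Suc ` S)) = shuffle_sign n S"
proof -
  have "{(i, j). i \<in> insert 0 (Suc ` S) \<and> j \<in> {..<Suc n} - insert 0 (Suc ` S) \<and> j < i}
      = map_prod Suc Suc ` {(i, j). i \<in> S \<and> j \<in> {..<n} - S \<and> j < i}"
    (is "?L = ?R")
  proof (rule set_eqI)
    fix p :: "nat \<times> nat"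
    obtain i j where p: "p = (i, j)"
      by (cases p)
    show "p \<in> ?L \<longleftrightarrow> p \<in> ?R"
      unfolding p by (cases i; cases j) (auto simp: image_iff)
  qed
  then show ?thesis
    by (simp add: shuffle_sign_def card_image inj_on_map_prod_Suc)
qed

lemma shuffle_sign_Suc_image:
  assumes "finite S"
  shows "shuffle_sign (Suc n) (Suc ` S) = (-1) ^ card S * shuffle_sign n S"
proof -
  let ?A = "{(i, j). i \<in> S \<and> j \<in> {..<n} - S \<and> j < i}"
  have "{(i, j). i \<in> Suc ` S \<and> j \<in> {..<Suc n} - Suc ` S \<and> j < i}
      = (\<lambda>i. (Suc i, 0)) ` S \<union> map_prod Suc Suc ` ?A"
    (is "?L = ?R")
  proof (rule set_eqI)
    fix p :: "nat \<times> nat"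
    obtain i j where p: "p = (i, j)"
      by (cases p)
    show "p \<in> ?L \<longleftrightarrow> p \<in> ?R"
      unfolding p by (cases i; cases j) (auto simp: image_iff)
  qed
  moreover have "?A \<subseteq> S \<times> {..<n}"
    by auto
  then have "finite ?A"
    using assms finite_subset by fastforce
  ultimately show ?thesis
    using assms
    by (subst shuffle_sign_def)
      (simp, subst card_Un_disjoint, auto simp: shuffle_sign_def card_image inj_on_map_prod_Suc inj_on_def power_add)
qed

text \<open>
  The subsets of positions containing the first one give the first summand; in the second, moving
  the first argument past those of \<open>\<phi>\<close> produces the sign.
\<close>

lemma wedge_Cons:
  "wedge \<phi> \<psi> (v # vs) =
     wedge (\<lambda>us. \<phi> (v # us)) \<psi> vs + wedge (\<lambda>us. (-1) ^ length us * \<phi> us) (\<lambda>us. \<psi> (v # us)) vs"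
proof -
  let ?n = "length vs"
  let ?t = "\<lambda>S. shuffle_sign (Suc ?n) S * \<phi> (nths (v # vs) S) * \<psi> (nths (v # vs) (- S))"
  have P: "Pow {..<Suc ?n} = (\<lambda>S. insert 0 (Suc ` S)) ` Pow {..<?n} \<union> (`) Suc ` Pow {..<?n}"
    by (simp add: lessThan_Suc_eq_insert_0 Pow_insert image_Pow_surj[symmetric] image_image Un_commute)
  have "wedge \<phi> \<psi> (v # vs) = (\<Sum>S\<in>Pow {..<Suc ?n}. ?t S)"
    by (simp add: wedge_def)
  also have "\<dots> = (\<Sum>S\<in>(\<lambda>S. insert 0 (Suc ` S)) ` Pow {..<?n}. ?t S) + (\<Sum>S\<in>(`) Suc ` Pow {..<?n}. ?t S)"
    unfolding P by (rule sum.union_disjoint) auto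
  also have "(\<Sum>S\<in>(\<lambda>S. insert 0 (Suc ` S)) ` Pow {..<?n}. ?t S) = (\<Sum>S\<in>Pow {..<?n}. ?t (insert 0 (Suc ` S)))"
    by (rule sum.reindex_cong[OF _ refl refl]) (auto simp: inj_on_def dest: insert_ident[THEN iffD1, rotated 2])
  also have "\<dots> = wedge (\<lambda>us. \<phi> (v # us)) \<psi> vs"
    by (simp add: wedge_def shuffle_sign_insert_0 nths_Cons_insert_0 nths_Cons_Compl_insert_0)
  also have "(\<Sum>S\<in>(`) Suc ` Pow {..<?n}. ?t S) = (\<Sum>S\<in>Pow {..<?n}. ?t (Suc ` S))"
    by (rule sum.reindex_cong[OF _ refl refl]) (auto simp: inj_on_def inj_image_eq_iff)
  also have "\<dots> = wedge (\<lambda>us. (-1) ^ length us * \<phi> us) (\<lambda>us. \<psi> (v # us)) vs"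
    unfolding wedge_def
    by (intro sum.cong refl)
      (auto simp: shuffle_sign_Suc_image nths_Cons_Suc_image nths_Cons_Compl_Suc_image
         length_nths_subset finite_subset)
  finally show ?thesis .
qed

lemma wedge_map: "wedge \<phi> \<psi> (map R vs) = wedge (\<lambda>us. \<phi> (map R us)) (\<lambda>us. \<psi> (map R us)) vs"
  by (simp add: wedge_def nths_map)

lemma wedge_scale:
  "wedge (\<lambda>us. a * \<phi> us) (\<lambda>us. b * \<psi> us) vs = a * b * wedge \<phi> \<psi> vs"
  by (simp add: wedge_def sum_distrib_left mult_ac)

lemma wedge_0_left [simp]: "wedge (\<lambda>us. 0) \<psi> vs = 0"
  and wedge_0_right [simp]: "wedge \<phi> (\<lambda>us. 0) vs = 0"
  by (simp_all add: wedge_def)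

lemma wedge_eq_0:
  assumes "\<And>us. length us \<noteq> k \<Longrightarrow> \<phi> us = 0" "\<And>us. length us \<noteq> l \<Longrightarrow> \<psi> us = 0"
    and "length vs \<noteq> k + l"
  shows "wedge \<phi> \<psi> vs = 0"
proof -
  have "\<phi> (nths vs S) * \<psi> (nths vs (- S)) = 0" if S: "S \<subseteq> {..<length vs}" for S
  proof -
    have "length (nths vs S) = card S"
      by (rule length_nths_subset[OF S])
    moreover have "length (nths vs (- S)) = card ({..<length vs} - S)"
      unfolding length_nths by (rule arg_cong[of _ _ card]) auto
    ultimately have "length (nths vs S) + length (nths vs (- S)) = length vs"
      using S by (simp add: card_Diff_subset finite_subset card_mono[of "{..<length vs}", simplified])
    with assms show ?thesis
      by (metis mult_eq_0_iff)
  qed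
  then show ?thesis
    by (auto simp: wedge_def mult.assoc intro!: sum.neutral)
qed

lemma wedge_list_simps [simp]:
  "wedge_list [] = unit_covec" "wedge_list (\<phi> # \<phi>s) = wedge \<phi> (wedge_list \<phi>s)"
  by (simp_all add: wedge_list_def)

text \<open>Meant for \<open>R = a + b J\<close>: 1-covectors of type (1,0) and (0,1) are
  eigenvectors of the pullback by \<open>R\<close>, and pullback is multiplicative on wedge
  products.\<close>

lemma wedge_list_map_eigen:
  assumes "list_all2 (\<lambda>\<phi> c. \<forall>us. \<phi> (map R us) = c * \<phi> us) \<phi>s cs"
  shows "wedge_list \<phi>s (map R vs) = prod_list cs * wedge_list \<phi>s vs"
  using assms
proof (induction arbitrary: vs)
  case Nil
  then show ?case by (simp add: unit_covec_def)
next
  case (Cons \<phi> c \<phi>s cs)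
  then show ?case by (simp add: wedge_map wedge_scale)
qed


section \<open>The bidegree decomposition\<close>

lemma alternating_linear:
  "alternating k \<phi> \<Longrightarrow> length vs = k \<Longrightarrow> i < k \<Longrightarrow> linear (\<lambda>v. \<phi> (vs[i := v]))"
  by (simp add: alternating_def)

lemma alternating_1_linear: "alternating 1 \<phi> \<Longrightarrow> linear (\<lambda>v. \<phi> [v])"
  using alternating_linear[of 1 \<phi> "[0]" 0] by simp

lemma alternating_eq_0: "alternating k \<phi> \<Longrightarrow> length vs \<noteq> k \<Longrightarrow> \<phi> vs = 0"
  by (simp add: alternating_def)

lemma alternating_1_eigen:
  fixes c :: complex
  assumes "alternating 1 \<phi>" "\<And>v. \<phi> [J v] = c * \<phi> [v]"
  shows "\<phi> (map (\<lambda>v. a *\<^sub>R v + b *\<^sub>R J v) us) = (of_real a + c * of_real b) * \<phi> us"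
proof (cases "length us = 1")
  case True
  then obtain v where us: "us = [v]"
    by (metis One_nat_def length_0_conv length_Suc_conv)
  interpret linear "\<lambda>v. \<phi> [v]"
    by (rule alternating_1_linear[OF assms(1)])
  show ?thesis
    unfolding us list.map add scale assms(2) by (simp add: scaleR_conv_of_real algebra_simps)
qed (simp add: alternating_eq_0[OF assms(1)])

text \<open>
  Acting with \<open>a + b J\<close> on all arguments multiplies a covector of type (p,q) by
  \<open>\<mu>\<^sup>p\<close> times the \<open>q\<close>-th power of the conjugate of \<open>\<mu> = a + \<i> b\<close>.
  As \<open>\<mu>\<close> varies, this separates the bidegrees.
\<close>

lemma covec_pq_map:
  assumes "\<phi> \<in> covec_pq J p q"
  shows "\<phi> (map (\<lambda>v. a *\<^sub>R v + b *\<^sub>R J v) vs) = Complex a b ^ p * Complex a (- b) ^ q * \<phi> vs"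
  using assms unfolding covec_pq_def
proof (induction arbitrary: vs rule: covec.span_induct_alt)
  case base
  then show ?case by simp
next
  case (step c x y)
  from step(1) obtain \<alpha>s \<beta>s where x: "x = wedge_list (\<alpha>s @ \<beta>s)"
    and \<alpha>s: "length \<alpha>s = p" "set \<alpha>s \<subseteq> covec10 J" and \<beta>s: "length \<beta>s = q" "set \<beta>s \<subseteq> covec01 J"
    by blast
  let ?R = "\<lambda>v. a *\<^sub>R v + b *\<^sub>R J v"
  have C: "Complex a b = of_real a + \<i> * of_real b" "Complex a (- b) = of_real a + - \<i> * of_real b"
    by (simp_all add: complex_eq_iff)
  have "list_all2 (\<lambda>\<phi> c. \<forall>us. \<phi> (map ?R us) = c * \<phi> us) (\<alpha>s @ \<beta>s)
      (replicate p (Complex a b) @ replicate q (Complex a (- b)))"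
    using \<alpha>s \<beta>s unfolding C
    by (intro list_all2_appendI list_all2_all_nthI allI)
      (simp_all only: nth_replicate length_replicate,
        auto simp only: covec10_def covec01_def subset_iff mem_Collect_eq intro!: alternating_1_eigen nth_mem)
  from wedge_list_map_eigen[OF this, of vs] show ?case
    by (simp add: x step.IH scale_covec_def algebra_simps)
qed

text \<open>Pull the vanishing sum back by \<open>1 + s J\<close> and divide by the k-th power of
  the conjugate of \<open>1 + \<i> s\<close>. What remains is a polynomial in the quotient of
  \<open>1 + \<i> s\<close> by its conjugate, with coefficients \<open>c r vs\<close>. It vanishes
  for all real s, hence at infinitely many points.\<close>

lemma covec_pq_sum_unique:
  assumes c: "\<And>r. r \<le> k \<Longrightarrow> c r \<in> covec_pq J r (k - r)" and 0: "(\<Sum>r\<le>k. c r) = 0" and r: "r \<le> k"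
  shows "c r = 0"
proof
  fix vs
  let ?z = "\<lambda>s. Complex 1 s / Complex 1 (- s)"
  have "(\<Sum>r\<le>k. c r vs * ?z s ^ r) = 0" for s
  proof -
    have nz: "Complex 1 (- s) \<noteq> 0"
      by (simp add: complex_eq_iff)
    have "0 = (\<Sum>r\<le>k. c r) (map (\<lambda>v. 1 *\<^sub>R v + s *\<^sub>R J v) vs)"
      by (simp only: 0) simp
    also have "\<dots> = (\<Sum>r\<le>k. c r (map (\<lambda>v. 1 *\<^sub>R v + s *\<^sub>R J v) vs))"
      by (induction k) (simp_all)
    also have "\<dots> = (\<Sum>r\<le>k. Complex 1 (- s) ^ k * (c r vs * ?z s ^ r))"
    proof (intro sum.cong refl)
      fix r assume "r \<in> {..k}"
      then have "r \<le> k" by simp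
      have "Complex 1 (- s) ^ k = Complex 1 (- s) ^ r * Complex 1 (- s) ^ (k - r)"
        using \<open>r \<le> k\<close> by (simp flip: power_add)
      then show "c r (map (\<lambda>v. 1 *\<^sub>R v + s *\<^sub>R J v) vs) = Complex 1 (- s) ^ k * (c r vs * ?z s ^ r)"
        using nz by (simp only: covec_pq_map[OF c[OF \<open>r \<le> k\<close>]]) (simp add: power_divide field_simps)
    qed
    finally show ?thesis
      using nz by (simp flip: sum_distrib_left)
  qed
  then have "range ?z \<subseteq> {z. (\<Sum>r\<le>k. c r vs * z ^ r) = 0}"
    by auto
  moreover have "inj ?z"
  proof (rule injI)
    fix s t assume eq: "?z s = ?z t"
    have "Complex 1 (- s) \<noteq> 0" "Complex 1 (- t) \<noteq> 0"
      by (simp_all add: complex_eq_iff)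
    with eq have "Complex 1 s * Complex 1 (- t) = Complex 1 t * Complex 1 (- s)"
      using frac_eq_eq by blast
    then show "s = t"
      by (simp add: complex_eq_iff)
  qed
  then have "infinite (range ?z)"
    using infinite_UNIV_char_0 finite_imageD by blast
  ultimately have "infinite {z. (\<Sum>r\<le>k. c r vs * z ^ r) = 0}"
    using finite_subset by blast
  with polyfun_finite_roots[where c = "\<lambda>r. c r vs" and n = k] r show "c r vs = 0 vs"
    by auto
qed

text \<open>Directness of the sum makes the definite description usable: from here on a component is
  computed by exhibiting any decomposition into bidegrees.\<close>

lemma pq_part_sum:
  assumes c: "\<And>r. r \<le> p + q \<Longrightarrow> c r \<in> covec_pq J r (p + q - r)"
  shows "pq_part J p q (\<Sum>r\<le>p + q. c r) = c p"
  unfolding pq_part_def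
proof (rule the_equality)
  show "\<exists>d. (\<forall>r\<le>p + q. d r \<in> covec_pq J r (p + q - r)) \<and> sum c {..p + q} = sum d {..p + q} \<and> c p = d p"
    using c by auto
next
  fix \<psi>
  assume "\<exists>d. (\<forall>r\<le>p + q. d r \<in> covec_pq J r (p + q - r)) \<and> sum c {..p + q} = sum d {..p + q} \<and> \<psi> = d p"
  then obtain d where d: "\<And>r. r \<le> p + q \<Longrightarrow> d r \<in> covec_pq J r (p + q - r)"
    "sum c {..p + q} = sum d {..p + q}" "\<psi> = d p"
    by auto
  have "d p - c p = 0"
    using c d by (intro covec_pq_sum_unique[of "p + q" "\<lambda>r. d r - c r" J])
      (auto simp: covec_pq_def sum_subtractf intro: covec.span_diff)
  then show "\<psi> = c p"
    using d(3) by simp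
qed

lemma covec_pq_0: "0 \<in> covec_pq J p q"
  by (simp add: covec_pq_def covec.span_zero)

lemma covec_pq_add: "\<phi> \<in> covec_pq J p q \<Longrightarrow> \<psi> \<in> covec_pq J p q \<Longrightarrow> \<phi> + \<psi> \<in> covec_pq J p q"
  by (simp add: covec_pq_def covec.span_add)

lemma covec_pq_scale: "\<phi> \<in> covec_pq J p q \<Longrightarrow> scale_covec c \<phi> \<in> covec_pq J p q"
  by (simp add: covec_pq_def covec.span_scale)

lemma covec_pq_uminus: "\<phi> \<in> covec_pq J p q \<Longrightarrow> - \<phi> \<in> covec_pq J p q"
  by (simp add: covec_pq_def covec.span_neg)

lemma covec_pq_wedge_list:
  "length \<alpha>s = p \<Longrightarrow> set \<alpha>s \<subseteq> covec10 J \<Longrightarrow> length \<beta>s = q \<Longrightarrow> set \<beta>s \<subseteq> covec01 J \<Longrightarrow>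
    wedge_list (\<alpha>s @ \<beta>s) \<in> covec_pq J p q"
  unfolding covec_pq_def by (rule covec.span_base) blast

lemma pq_part_of_type:
  assumes "\<phi> \<in> covec_pq J p' q'" "p' + q' = p + q"
  shows "pq_part J p q \<phi> = (if p = p' then \<phi> else 0)"
proof -
  have "p' \<le> p + q" "q' = p + q - p'"
    using assms(2) by simp_all
  then have "(\<Sum>r\<le>p + q. if r = p' then \<phi> else 0) = \<phi>"
    by simp
  with pq_part_sum[of p q "\<lambda>r. if r = p' then \<phi> else 0" J] show ?thesis
    using assms \<open>q' = p + q - p'\<close> by (auto simp: covec_pq_0)
qed

lemma pq_part_0 [simp]: "pq_part J p q 0 = 0"
  using pq_part_of_type[OF covec_pq_0, of p q p q J] by simp


section \<open>Alternating covectors\<close>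

text \<open>Stated by splitting the argument list and without fixing a degree, so that the property
  passes to \<open>\<lambda>us. \<phi> (v # us)\<close>. These are the functions that
  \<open>wedge_Cons\<close> produces, which makes inductions on the argument list possible. The same
  holds for \<open>adjacent_zero\<close>.\<close>

definition multilinear :: "covec \<Rightarrow> bool" where
  "multilinear \<phi> \<longleftrightarrow> (\<forall>xs ys. linear (\<lambda>v. \<phi> (xs @ v # ys)))"

definition adjacent_zero :: "covec \<Rightarrow> bool" where
  "adjacent_zero \<phi> \<longleftrightarrow> (\<forall>xs v ys. \<phi> (xs @ v # v # ys) = 0)"

lemma multilinear_add:
  "multilinear \<phi> \<Longrightarrow> \<phi> (xs @ (a + b) # ys) = \<phi> (xs @ a # ys) + \<phi> (xs @ b # ys)"
  using linear_add[of "\<lambda>v. \<phi> (xs @ v # ys)" a b] by (simp add: multilinear_def)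

lemma adjacent_zero_swap:
  assumes "multilinear \<phi>" "adjacent_zero \<phi>"
  shows "\<phi> (xs @ u # v # ys) = - \<phi> (xs @ v # u # ys)"
proof -
  have add1: "\<phi> (xs @ (a + b) # zs) = \<phi> (xs @ a # zs) + \<phi> (xs @ b # zs)" for a b zs
    by (rule multilinear_add[OF assms(1)])
  have add2: "\<phi> (xs @ c # (a + b) # ys) = \<phi> (xs @ c # a # ys) + \<phi> (xs @ c # b # ys)" for a b c
    using multilinear_add[OF assms(1), of "xs @ [c]"] by simp
  have z: "\<phi> (xs @ a # a # ys) = 0" for a
    using assms(2) by (simp add: adjacent_zero_def)
  have "0 = \<phi> (xs @ (u + v) # (u + v) # ys)"
    by (simp only: z)
  also have "\<dots> = \<phi> (xs @ u # v # ys) + \<phi> (xs @ v # u # ys)"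
    by (simp only: add1 add2) (simp add: z)
  finally show ?thesis
    by (simp add: add_eq_0_iff)
qed

lemma adjacent_zero_repeated:
  assumes "multilinear \<phi>" "adjacent_zero \<phi>"
  shows "\<phi> (xs @ u # ys @ u # zs) = 0"
proof (induction ys arbitrary: xs)
  case Nil
  then show ?case using assms(2) by (simp add: adjacent_zero_def)
next
  case (Cons y ys)
  have "\<phi> (xs @ u # y # (ys @ u # zs)) = - \<phi> (xs @ y # u # (ys @ u # zs))"
    by (rule adjacent_zero_swap[OF assms])
  also have "\<dots> = 0"
    using Cons.IH[of "xs @ [y]"] by simp
  finally show ?case by simp
qed

text \<open>Vanishing on adjacent repetitions is enough: with multilinearity it yields a sign change
  under adjacent swaps, and such swaps bring two equal arguments next to each other.\<close>

lemma alternating_iff: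
  "alternating k \<phi> \<longleftrightarrow> (\<forall>vs. length vs \<noteq> k \<longrightarrow> \<phi> vs = 0) \<and> multilinear \<phi> \<and> adjacent_zero \<phi>"
proof
  assume A: "alternating k \<phi>"
  have "linear (\<lambda>v. \<phi> (xs @ v # ys))" for xs ys
  proof (cases "length (xs @ 0 # ys) = k")
    case True
    from alternating_linear[OF A this, of "length xs"] True show ?thesis
      by simp
  next
    case False
    then have "\<phi> (xs @ v # ys) = 0" for v
      using alternating_eq_0[OF A, of "xs @ v # ys"] by simp
    then show ?thesis
      by (simp add: linear_iff)
  qed
  moreover have "\<phi> (xs @ v # v # ys) = 0" for xs v ys
  proof (cases "length (xs @ v # v # ys) = k")
    case True
    moreover have "(xs @ v # v # ys) ! length xs = (xs @ v # v # ys) ! Suc (length xs)"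
      by (simp add: nth_append)
    ultimately show ?thesis
      using A[unfolded alternating_def, THEN conjunct2, THEN conjunct2, rule_format,
          of "xs @ v # v # ys" "length xs" "Suc (length xs)"] by auto
  qed (rule alternating_eq_0[OF A])
  ultimately show "(\<forall>vs. length vs \<noteq> k \<longrightarrow> \<phi> vs = 0) \<and> multilinear \<phi> \<and> adjacent_zero \<phi>"
    using A by (simp add: multilinear_def adjacent_zero_def alternating_eq_0)
next
  assume A: "(\<forall>vs. length vs \<noteq> k \<longrightarrow> \<phi> vs = 0) \<and> multilinear \<phi> \<and> adjacent_zero \<phi>"
  show "alternating k \<phi>"
    unfolding alternating_def
  proof (intro conjI allI impI)
    fix vs :: "vec4 list" and i assume "length vs = k" "i < k"
    then show "linear (\<lambda>v. \<phi> (vs[i := v]))"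
      using A by (simp add: upd_conv_take_nth_drop multilinear_def)
  next
    fix vs :: "vec4 list" and i j assume vs: "length vs = k" "i < j" "j < k" "vs ! i = vs ! j"
    have "drop (Suc i) vs = take (j - Suc i) (drop (Suc i) vs) @ vs ! j # drop (Suc j) vs"
      using vs id_take_nth_drop[of "j - Suc i" "drop (Suc i) vs"] by simp
    with vs have "vs = take i vs @ vs ! i # take (j - Suc i) (drop (Suc i) vs) @ vs ! i # drop (Suc j) vs"
      using id_take_nth_drop[of i vs] by simp
    then show "\<phi> vs = 0"
      using A adjacent_zero_repeated by metis
  qed (use A in auto)
qed

definition functional :: "(vec4 \<Rightarrow> complex) \<Rightarrow> covec" where
  "functional l = (\<lambda>vs. case vs of [v] \<Rightarrow> l v | _ \<Rightarrow> 0)"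

lemma functional_simps [simp]:
  "functional l [] = 0" "functional l [v] = l v" "functional l (u # v # vs) = 0"
  by (simp_all add: functional_def)

lemma functional_eq_0: "length vs \<noteq> 1 \<Longrightarrow> functional l vs = 0"
  by (auto simp: functional_def split: list.split)

lemma alternating_functional:
  assumes "linear l"
  shows "alternating 1 (functional l)"
proof -
  have "linear (\<lambda>v. functional l (xs @ v # ys))" for xs ys
    using assms by (cases xs; cases ys; cases "tl xs") (simp_all add: linear_iff functional_def)
  moreover have "functional l (xs @ v # v # ys) = 0" for xs v ys
    by (cases xs; cases "tl xs") (simp_all add: functional_def)
  ultimately show ?thesis
    using functional_eq_0[of _ l] by (simp add: alternating_iff multilinear_def adjacent_zero_def)
qed

lemma alternating_real_functional:
  assumes "linear (l :: vec4 \<Rightarrow> real)"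
  shows "alternating 1 (functional (\<lambda>v. complex_of_real (l v)))"
  using assms by (intro alternating_functional) (simp add: linear_iff complex_eq_iff)

lemma multilinear_Cons:
  assumes "multilinear \<phi>"
  shows "multilinear (\<lambda>us. \<phi> (v # us))"
  using assms[unfolded multilinear_def, rule_format, of "v # _"] by (simp add: multilinear_def)

lemma adjacent_zero_Cons:
  assumes "adjacent_zero \<phi>"
  shows "adjacent_zero (\<lambda>us. \<phi> (v # us))"
  using assms[unfolded adjacent_zero_def, rule_format, of "v # _"] by (simp add: adjacent_zero_def)

lemma linear_mult_left: "linear f \<Longrightarrow> linear (\<lambda>v. c * f v :: complex)"
  by (simp add: linear_iff algebra_simps)

lemma linear_mult_right: "linear f \<Longrightarrow> linear (\<lambda>v. f v * c :: complex)"
  by (simp add: linear_iff algebra_simps)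

lemma multilinear_sign: "multilinear \<phi> \<Longrightarrow> multilinear (\<lambda>us. (-1) ^ length us * \<phi> us)"
  unfolding multilinear_def length_append list.size by (intro allI linear_mult_left) blast

lemma adjacent_zero_sign: "adjacent_zero \<phi> \<Longrightarrow> adjacent_zero (\<lambda>us. (-1) ^ length us * \<phi> us)"
  by (simp add: adjacent_zero_def)

lemma multilinear_wedge:
  assumes "multilinear \<phi>" "multilinear \<psi>"
  shows "multilinear (wedge \<phi> \<psi>)"
  unfolding multilinear_def
proof (intro allI)
  fix xs ys
  show "linear (\<lambda>v. wedge \<phi> \<psi> (xs @ v # ys))"
    using assms
  proof (induction xs arbitrary: \<phi> \<psi>)
    case Nil
    have "linear (\<lambda>v. \<phi> (v # us))" "linear (\<lambda>v. \<psi> (v # us))" for us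
      using Nil[unfolded multilinear_def, THEN spec, of "[]"] by simp_all
    then show ?case
      unfolding append_Nil wedge_Cons unfolding wedge_def
      by (auto intro!: linear_compose_add linear_compose_sum linear_mult_left linear_mult_right)
  next
    case (Cons x xs)
    then show ?case
      by (auto simp: wedge_Cons intro!: linear_compose_add Cons.IH multilinear_Cons multilinear_sign)
  qed
qed

lemma wedge_uminus_left: "wedge (\<lambda>us. - \<phi> us) \<psi> vs = - wedge \<phi> \<psi> vs"
  by (simp add: wedge_def sum_negf)

text \<open>Peeling off both copies of v leaves two mixed terms, one copy going to each factor. They
  differ in the order of peeling, hence in one sign, and cancel.\<close>

lemma adjacent_zero_wedge:
  assumes "adjacent_zero \<phi>" "adjacent_zero \<psi>"
  shows "adjacent_zero (wedge \<phi> \<psi>)"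
  unfolding adjacent_zero_def
proof (intro allI)
  fix xs v ys
  show "wedge \<phi> \<psi> (xs @ v # v # ys) = 0"
    using assms
  proof (induction xs arbitrary: \<phi> \<psi>)
    case Nil
    have "\<phi> (v # v # us) = 0" "\<psi> (v # v # us) = 0" for us
      using Nil[unfolded adjacent_zero_def, THEN spec, of "[]"] by simp_all
    then show ?case
      by (simp add: wedge_Cons wedge_uminus_left)
  next
    case (Cons x xs)
    then show ?case
      by (simp add: wedge_Cons Cons.IH adjacent_zero_Cons adjacent_zero_sign)
  qed
qed

lemma alternating_wedge:
  assumes "alternating k \<phi>" "alternating l \<psi>"
  shows "alternating (k + l) (wedge \<phi> \<psi>)"
  using assms unfolding alternating_iff
  by (auto intro: multilinear_wedge adjacent_zero_wedge wedge_eq_0)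

lemma alternating_unit_covec: "alternating 0 unit_covec"
  by (simp add: alternating_def unit_covec_def)

lemma alternating_wedge_list:
  "\<forall>\<phi>\<in>set \<phi>s. alternating 1 \<phi> \<Longrightarrow> alternating (length \<phi>s) (wedge_list \<phi>s)"
proof (induction \<phi>s)
  case (Cons \<phi> \<phi>s)
  then show ?case
    using alternating_wedge[of 1 \<phi> "length \<phi>s" "wedge_list \<phi>s"] by simp
qed (simp add: alternating_unit_covec)

lemma alternating_add: "alternating k \<phi> \<Longrightarrow> alternating k \<psi> \<Longrightarrow> alternating k (\<phi> + \<psi>)"
  by (simp add: alternating_def linear_compose_add)

lemma alternating_diff: "alternating k \<phi> \<Longrightarrow> alternating k \<psi> \<Longrightarrow> alternating k (\<phi> - \<psi>)"
  by (simp add: alternating_def linear_compose_sub)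

lemma alternating_scale: "alternating k \<phi> \<Longrightarrow> alternating k (scale_covec c \<phi>)"
  by (simp add: alternating_def scale_covec_def linear_mult_left)

lemma alternating_swap:
  "alternating k \<phi> \<Longrightarrow> \<phi> (xs @ u # v # ys) = - \<phi> (xs @ v # u # ys)"
  by (rule adjacent_zero_swap) (simp_all add: alternating_iff)

lemma alternating_repeat: "alternating k \<phi> \<Longrightarrow> \<phi> (xs @ v # v # ys) = 0"
  by (simp add: alternating_iff adjacent_zero_def)

lemma sum_swap3:
  "(\<Sum>i\<in>A. \<Sum>j\<in>B. \<Sum>k\<in>C. f i j k) = (\<Sum>j\<in>B. \<Sum>k\<in>C. \<Sum>i\<in>A. f i j k)"
  by (subst sum.swap) (intro sum.cong refl sum.swap)

lemma sum_lists_Suc: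
  fixes f :: "'i::finite list \<Rightarrow> 'b::comm_monoid_add"
  shows "(\<Sum>I | length I = Suc k. f I) = (\<Sum>i\<in>UNIV. \<Sum>I | length I = k. f (i # I))"
proof -
  have "{I. length I = Suc k} = (\<lambda>(i, I). i # I) ` (UNIV \<times> {I :: 'i list. length I = k})"
    by (auto simp: length_Suc_conv image_iff)
  moreover have "inj_on (\<lambda>(i, I). i # I) (UNIV \<times> {I :: 'i list. length I = k})"
    by (auto simp: inj_on_def)
  ultimately show ?thesis
    by (simp add: sum.reindex sum.cartesian_product split_def)
qed


section \<open>The Hodge star in an orthonormal frame\<close>

text \<open>The star is a definite description built from a matrix inverse, a determinant and an
  orientation. These assumptions are the interface through which it is evaluated:
  \<open>inverse_gram\<close> expresses orthonormality of \<open>E\<close> in the form that the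
  contraction in \<open>covec_inner\<close> consumes, and \<open>vol_frame\<close> adds positive
  orientation.\<close>

locale orthonormal_frame =
  fixes g :: "vec4 \<Rightarrow> vec4 \<Rightarrow> real" and J :: "vec4 \<Rightarrow> vec4"
    and c :: "4 \<Rightarrow> vec4 \<Rightarrow> real" and E :: "4 \<Rightarrow> vec4"
  assumes linear_c: "linear (c i)"
    and c_E: "c i (E j) = (if i = j then 1 else 0)"
    and expand_frame: "v = (\<Sum>i\<in>UNIV. c i v *\<^sub>R E i)"
    and inverse_gram: "matrix_inv (gram g) $ i $ j = (\<Sum>a\<in>UNIV. E a $ i * E a $ j)"
    and alternating_vol: "alternating 4 (vol J g)"
    and vol_frame: "vol J g [E 1, E 2, E 3, E 4] = 1"
begin

lemma multilinear_expand:
  assumes "multilinear \<phi>"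
  shows "\<phi> (xs @ v # ys) = (\<Sum>i\<in>UNIV. complex_of_real (c i v) * \<phi> (xs @ E i # ys))"
proof -
  interpret linear "\<lambda>v. \<phi> (xs @ v # ys)"
    using assms by (simp add: multilinear_def)
  have "\<phi> (xs @ v # ys) = \<phi> (xs @ (\<Sum>i\<in>UNIV. c i v *\<^sub>R E i) # ys)"
    by (subst expand_frame[of v]) (rule refl)
  also have "\<dots> = (\<Sum>i\<in>UNIV. complex_of_real (c i v) * \<phi> (xs @ E i # ys))"
    unfolding sum scale by (simp only: scaleR_conv_of_real)
  finally show ?thesis .
qed

lemma multilinear_eq_0:
  assumes "multilinear \<phi>" "\<And>I. length I = k \<Longrightarrow> \<phi> (map E I) = 0" "length vs = k"
  shows "\<phi> vs = 0"
  using assms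
proof (induction vs arbitrary: \<phi> k)
  case (Cons v vs)
  have "\<phi> (E i # vs) = 0" for i
    using Cons.prems(3) Cons.prems(2)[of "i # _"]
    by (intro Cons.IH[of "\<lambda>us. \<phi> (E i # us)" "length vs"] multilinear_Cons[OF Cons.prems(1)]) auto
  then show ?case
    using multilinear_expand[OF Cons.prems(1), of "[]" v vs] by simp
qed (force)

lemma alternating_1_eq_0:
  assumes \<phi>: "alternating 1 \<phi>" and "\<phi> [E 1] = 0" "\<phi> [E 2] = 0" "\<phi> [E 3] = 0" "\<phi> [E 4] = 0"
  shows "\<phi> = 0"
proof
  fix vs
  have "\<phi> [E i] = 0" for i
    using assms exhaust_4[of i] by auto
  then have "\<phi> (map E I) = 0" if "length I = 1" for I
    using that by (auto simp: length_Suc_conv)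
  then show "\<phi> vs = 0 vs"
    using multilinear_eq_0[of \<phi> 1 vs] \<phi> by (auto simp: alternating_iff)
qed

lemma alternating_2_eq_0:
  assumes \<phi>: "alternating 2 \<phi>"
    and "\<phi> [E 1, E 2] = 0" "\<phi> [E 1, E 3] = 0" "\<phi> [E 1, E 4] = 0"
      "\<phi> [E 2, E 3] = 0" "\<phi> [E 2, E 4] = 0" "\<phi> [E 3, E 4] = 0"
  shows "\<phi> = 0"
proof
  fix vs
  have s: "\<phi> [u, v] = 0 \<longleftrightarrow> \<phi> [v, u] = 0" and r: "\<phi> [u, u] = 0" for u v
    using alternating_swap[OF \<phi>, of "[]" u v "[]"] alternating_repeat[OF \<phi>, of "[]" u "[]"] by auto
  have "\<forall>i j. \<phi> [E i, E j] = 0"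
    unfolding forall_4 using assms(2-) by (simp add: r) (simp add: s)
  then have "\<phi> (map E I) = 0" if "length I = 2" for I
    using that by (auto simp: length_Suc_conv numeral_eq_Suc)
  then show "\<phi> vs = 0 vs"
    using multilinear_eq_0[of \<phi> 2 vs] \<phi> by (auto simp: alternating_iff)
qed

lemma alternating_3_eq_0:
  assumes \<phi>: "alternating 3 \<phi>"
    and "\<phi> [E 1, E 2, E 3] = 0" "\<phi> [E 1, E 2, E 4] = 0" "\<phi> [E 1, E 3, E 4] = 0" "\<phi> [E 2, E 3, E 4] = 0"
  shows "\<phi> = 0"
proof
  fix vs
  have s: "\<phi> [u, v, w] = 0 \<longleftrightarrow> \<phi> [v, u, w] = 0" "\<phi> [u, v, w] = 0 \<longleftrightarrow> \<phi> [u, w, v] = 0"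
    and r: "\<phi> [u, u, w] = 0" "\<phi> [w, u, u] = 0" for u v w
    using alternating_swap[OF \<phi>, of "[]" u v "[w]"] alternating_repeat[OF \<phi>, of "[]" u "[w]"]
      alternating_swap[OF \<phi>, of "[u]" v w "[]"] alternating_repeat[OF \<phi>, of "[w]" u "[]"] by auto
  have "\<forall>i j k. \<phi> [E i, E j, E k] = 0"
    unfolding forall_4 using assms(2-) by (simp only: r s simp_thms)
  then have "\<phi> (map E I) = 0" if "length I = 3" for I
    using that by (auto simp: length_Suc_conv numeral_eq_Suc)
  then show "\<phi> vs = 0 vs"
    using multilinear_eq_0[of \<phi> 3 vs] \<phi> by (auto simp: alternating_iff)
qed

lemma alternating_4_eq_0:
  assumes \<phi>: "alternating 4 \<phi>" and "\<phi> [E 1, E 2, E 3, E 4] = 0"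
  shows "\<phi> = 0"
proof
  fix vs
  have s: "\<phi> [u, v, w, x] = 0 \<longleftrightarrow> \<phi> [v, u, w, x] = 0" "\<phi> [u, v, w, x] = 0 \<longleftrightarrow> \<phi> [u, w, v, x] = 0"
      "\<phi> [u, v, w, x] = 0 \<longleftrightarrow> \<phi> [u, v, x, w] = 0"
    and r: "\<phi> [u, u, w, x] = 0" "\<phi> [w, u, u, x] = 0" "\<phi> [w, x, u, u] = 0" for u v w x
    using alternating_swap[OF \<phi>, of "[]" u v "[w, x]"] alternating_repeat[OF \<phi>, of "[]" u "[w, x]"]
      alternating_swap[OF \<phi>, of "[u]" v w "[x]"] alternating_repeat[OF \<phi>, of "[w]" u "[x]"]
      alternating_swap[OF \<phi>, of "[u, v]" w x "[]"] alternating_repeat[OF \<phi>, of "[w, x]" u "[]"] by auto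
  have "\<forall>i j k l. \<phi> [E i, E j, E k, E l] = 0"
    unfolding forall_4 using assms(2) by (simp only: r s simp_thms)
  then have "\<phi> (map E I) = 0" if "length I = 4" for I
    using that by (auto simp: length_Suc_conv numeral_eq_Suc)
  then show "\<phi> vs = 0 vs"
    using multilinear_eq_0[of \<phi> 4 vs] \<phi> by (auto simp: alternating_iff)
qed

text \<open>Each factor of the contraction is a sum over a of products of components of
  \<open>E a\<close>. Inserting this one slot at a time, the sums over coordinate vectors reassemble
  to values of the covectors on the frame.\<close>

lemma covec_inner_frame:
  assumes "multilinear \<alpha>" "multilinear \<beta>"
  shows "covec_inner g k \<alpha> \<beta> = 1 / fact k * (\<Sum>I | length I = k. \<alpha> (map E I) * cnj (\<beta> (map E I)))"
proof -
  let ?e = "\<lambda>i. axis i 1 :: vec4"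
  let ?G = "matrix_inv (gram g)"
  have expand_axis: "\<phi> (E a # us) = (\<Sum>i\<in>UNIV. complex_of_real (E a $ i) * \<phi> (?e i # us))"
    if "multilinear \<phi>" for \<phi> a us
  proof -
    interpret linear "\<lambda>v. \<phi> (v # us)"
      using that[unfolded multilinear_def, rule_format, of "[]" us] by simp
    have "\<phi> (E a # us) = \<phi> ((\<Sum>i\<in>UNIV. E a $ i *\<^sub>R ?e i) # us)"
      using basis_expansion[of "E a"] by (simp add: scalar_mult_eq_scaleR)
    then show ?thesis
      unfolding sum scale by (simp only: scaleR_conv_of_real)
  qed
  have "(\<Sum>I | length I = k. \<Sum>L | length L = k.
        complex_of_real (\<Prod>m<k. ?G $ (I ! m) $ (L ! m)) * \<alpha> (map ?e I) * cnj (\<beta> (map ?e L)))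
      = (\<Sum>I | length I = k. \<alpha> (map E I) * cnj (\<beta> (map E I)))"
    using assms
  proof (induction k arbitrary: \<alpha> \<beta>)
    case 0
    then show ?case by simp
  next
    case (Suc k)
    let ?T = "\<lambda>i l. \<Sum>I | length I = k. \<alpha> (?e i # map E I) * cnj (\<beta> (?e l # map E I))"
    have "(\<Sum>I | length I = Suc k. \<Sum>L | length L = Suc k.
        complex_of_real (\<Prod>m<Suc k. ?G $ (I ! m) $ (L ! m)) * \<alpha> (map ?e I) * cnj (\<beta> (map ?e L)))
      = (\<Sum>i\<in>UNIV. \<Sum>I | length I = k. \<Sum>l\<in>UNIV. \<Sum>L | length L = k. complex_of_real (?G $ i $ l) *
         (complex_of_real (\<Prod>m<k. ?G $ (I ! m) $ (L ! m)) * \<alpha> (?e i # map ?e I) * cnj (\<beta> (?e l # map ?e L))))"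
      by (simp only: sum_lists_Suc prod.lessThan_Suc_shift nth_Cons_0 nth_Cons_Suc list.map of_real_mult mult_ac)
    also have "\<dots> = (\<Sum>i\<in>UNIV. \<Sum>l\<in>UNIV. \<Sum>I | length I = k. \<Sum>L | length L = k. complex_of_real (?G $ i $ l) *
         (complex_of_real (\<Prod>m<k. ?G $ (I ! m) $ (L ! m)) * \<alpha> (?e i # map ?e I) * cnj (\<beta> (?e l # map ?e L))))"
      by (intro sum.cong refl sum.swap)
    also have "\<dots> = (\<Sum>i\<in>UNIV. \<Sum>l\<in>UNIV. complex_of_real (?G $ i $ l) * ?T i l)"
      by (simp only: sum_distrib_left[symmetric]
          Suc.IH[OF multilinear_Cons[OF Suc.prems(1)] multilinear_Cons[OF Suc.prems(2)]])
    also have "\<dots> = (\<Sum>i\<in>UNIV. \<Sum>l\<in>UNIV. \<Sum>a\<in>UNIV. \<Sum>I | length I = k.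
        complex_of_real (E a $ i) * \<alpha> (?e i # map E I) * (complex_of_real (E a $ l) * cnj (\<beta> (?e l # map E I))))"
      by (simp add: inverse_gram sum_distrib_left sum_distrib_right mult_ac) (subst sum.swap, rule refl)?
    also have "\<dots> = (\<Sum>a\<in>UNIV. \<Sum>I | length I = k. \<Sum>i\<in>UNIV. \<Sum>l\<in>UNIV.
        complex_of_real (E a $ i) * \<alpha> (?e i # map E I) * (complex_of_real (E a $ l) * cnj (\<beta> (?e l # map E I))))"
      by (rule trans[OF sum.cong[OF refl sum_swap3] sum_swap3])
    also have "\<dots> = (\<Sum>I | length I = Suc k. \<alpha> (map E I) * cnj (\<beta> (map E I)))"
      unfolding sum_lists_Suc list.map expand_axis[OF Suc.prems(1)] expand_axis[OF Suc.prems(2)]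
      by (simp add: sum_product)
    finally show ?case .
  qed
  then show ?thesis
    unfolding covec_inner_def by (rule arg_cong)
qed

abbreviation coframe :: "4 \<Rightarrow> covec" where
  "coframe i \<equiv> functional (\<lambda>v. complex_of_real (c i v))"

lemma alternating_coframe: "alternating 1 (coframe i)"
  by (rule alternating_real_functional[OF linear_c])

lemma covec_inner_1:
  assumes "alternating 1 \<alpha>" "alternating 1 \<beta>"
  shows "covec_inner g 1 \<alpha> \<beta> = (\<Sum>i\<in>UNIV. \<alpha> [E i] * cnj (\<beta> [E i]))"
  using assms by (simp add: covec_inner_frame alternating_iff sum_lists_Suc)

lemma covec_inner_2:
  assumes "alternating 2 \<alpha>" "alternating 2 \<beta>"
  shows "covec_inner g 2 \<alpha> \<beta> =
    \<alpha> [E 1, E 2] * cnj (\<beta> [E 1, E 2]) + \<alpha> [E 1, E 3] * cnj (\<beta> [E 1, E 3]) +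
    \<alpha> [E 1, E 4] * cnj (\<beta> [E 1, E 4]) + \<alpha> [E 2, E 3] * cnj (\<beta> [E 2, E 3]) +
    \<alpha> [E 2, E 4] * cnj (\<beta> [E 2, E 4]) + \<alpha> [E 3, E 4] * cnj (\<beta> [E 3, E 4])"
proof -
  define P where "P u v = \<alpha> [u, v] * cnj (\<beta> [u, v])" for u v
  have s: "P u v = P v u" and r: "P u u = 0" for u v
    using alternating_swap[OF assms(1), of "[]" u v "[]"] alternating_swap[OF assms(2), of "[]" u v "[]"]
      alternating_repeat[OF assms(1), of "[]" u "[]"] by (simp_all add: P_def)
  have "covec_inner g 2 \<alpha> \<beta> = 1 / 2 * (\<Sum>i\<in>UNIV. \<Sum>j\<in>UNIV. P (E i) (E j))"
    using assms unfolding numeral_2_eq_2 by (simp add: covec_inner_frame alternating_iff sum_lists_Suc P_def)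
  also have "\<dots> = P (E 1) (E 2) + P (E 1) (E 3) + P (E 1) (E 4) + P (E 2) (E 3) + P (E 2) (E 4) + P (E 3) (E 4)"
    by (simp add: sum_4 r s[of "E 2" "E 1"] s[of "E 3" "E 1"] s[of "E 4" "E 1"] s[of "E 3" "E 2"]
        s[of "E 4" "E 2"] s[of "E 4" "E 3"])
  finally show ?thesis
    by (simp add: P_def)
qed

lemma covec_inner_3:
  assumes "alternating 3 \<alpha>" "alternating 3 \<beta>"
  shows "covec_inner g 3 \<alpha> \<beta> =
    \<alpha> [E 1, E 2, E 3] * cnj (\<beta> [E 1, E 2, E 3]) + \<alpha> [E 1, E 2, E 4] * cnj (\<beta> [E 1, E 2, E 4]) +
    \<alpha> [E 1, E 3, E 4] * cnj (\<beta> [E 1, E 3, E 4]) + \<alpha> [E 2, E 3, E 4] * cnj (\<beta> [E 2, E 3, E 4])"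
proof -
  define P where "P i j k = \<alpha> [E i, E j, E k] * cnj (\<beta> [E i, E j, E k])" for i j k
  have s: "P i j k = P j i k" "P i j k = P i k j" and r: "P i i k = 0" "P i k k = 0" for i j k
    using alternating_swap[OF assms(1), of "[]" "E i" "E j" "[E k]"] alternating_swap[OF assms(2), of "[]" "E i" "E j" "[E k]"]
      alternating_swap[OF assms(1), of "[E i]" "E j" "E k" "[]"] alternating_swap[OF assms(2), of "[E i]" "E j" "E k" "[]"]
      alternating_repeat[OF assms(1), of "[]" "E i" "[E k]"] alternating_repeat[OF assms(1), of "[E i]" "E k" "[]"]
    by (simp_all add: P_def)
  have "covec_inner g 3 \<alpha> \<beta> = 1 / 6 * (\<Sum>i\<in>UNIV. \<Sum>j\<in>UNIV. \<Sum>k\<in>UNIV. P i j k)"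
    using assms unfolding numeral_3_eq_3
    by (simp add: covec_inner_frame alternating_iff sum_lists_Suc P_def fact_numeral)
  also have "\<dots> = P 1 2 3 + P 1 2 4 + P 1 3 4 + P 2 3 4"
    unfolding sum_4 by (simp only: r s) simp
  finally show ?thesis
    by (simp add: P_def)
qed

lemma covec_inner_4:
  assumes "alternating 4 \<alpha>" "alternating 4 \<beta>"
  shows "covec_inner g 4 \<alpha> \<beta> = \<alpha> [E 1, E 2, E 3, E 4] * cnj (\<beta> [E 1, E 2, E 3, E 4])"
proof -
  define P where "P i j k l = \<alpha> [E i, E j, E k, E l] * cnj (\<beta> [E i, E j, E k, E l])" for i j k l
  have s: "P i j k l = P j i k l" "P i j k l = P i k j l" "P i j k l = P i j l k"
    and r: "P i i k l = 0" "P i k k l = 0" "P i k l l = 0" for i j k l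
    using alternating_swap[OF assms(1), of "[]" "E i" "E j" "[E k, E l]"] alternating_swap[OF assms(2), of "[]" "E i" "E j" "[E k, E l]"]
      alternating_swap[OF assms(1), of "[E i]" "E j" "E k" "[E l]"] alternating_swap[OF assms(2), of "[E i]" "E j" "E k" "[E l]"]
      alternating_swap[OF assms(1), of "[E i, E j]" "E k" "E l" "[]"] alternating_swap[OF assms(2), of "[E i, E j]" "E k" "E l" "[]"]
      alternating_repeat[OF assms(1), of "[]" "E i" "[E k, E l]"] alternating_repeat[OF assms(1), of "[E i]" "E k" "[E l]"]
      alternating_repeat[OF assms(1), of "[E i, E k]" "E l" "[]"]
    by (simp_all add: P_def)
  have "(\<Sum>I | length I = 4. \<alpha> (map E I) * cnj (\<beta> (map E I))) =
      (\<Sum>i\<in>UNIV. \<Sum>j\<in>UNIV. \<Sum>k\<in>UNIV. \<Sum>l\<in>UNIV. P i j k l)"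
    by (simp add: numeral_eq_Suc sum_lists_Suc P_def)
  then have "covec_inner g 4 \<alpha> \<beta> = 1 / 24 * (\<Sum>i\<in>UNIV. \<Sum>j\<in>UNIV. \<Sum>k\<in>UNIV. \<Sum>l\<in>UNIV. P i j k l)"
    using assms by (simp add: covec_inner_frame alternating_iff fact_numeral)
  also have "\<dots> = P 1 2 3 4"
    unfolding sum_4 by (simp only: r s) simp
  finally show ?thesis
    by (simp add: P_def)
qed

lemma alternating_conj: "alternating k \<phi> \<Longrightarrow> alternating k (conj_covec \<phi>)"
  by (simp add: alternating_def conj_covec_def linear_iff)

lemma wedge_eq_scale_vol:
  assumes "alternating k \<alpha>" "alternating l \<eta>" "k + l = 4"
  shows "wedge \<alpha> \<eta> = scale_covec a (vol J g) \<longleftrightarrow> wedge \<alpha> \<eta> [E 1, E 2, E 3, E 4] = a"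
proof
  assume *: "wedge \<alpha> \<eta> [E 1, E 2, E 3, E 4] = a"
  have "wedge \<alpha> \<eta> - scale_covec a (vol J g) = 0"
    using * assms alternating_vol alternating_wedge[OF assms(1,2)]
    by (intro alternating_4_eq_0 alternating_diff alternating_scale) (simp_all add: scale_covec_def vol_frame)
  then show "wedge \<alpha> \<eta> = scale_covec a (vol J g)"
    by simp
qed (simp add: scale_covec_def vol_frame)

text \<open>Top-degree covectors form a line, so the defining identity of the star is one number for
  each \<alpha>. The hypothesis \<open>uniq\<close> is the nondegeneracy of the wedge pairing, which
  is later tested on products of the coframe.\<close>

lemma hodge_covecI:
  assumes k: "k \<le> 4" and \<eta>: "alternating (4 - k) \<eta>"
    and ex: "\<And>\<alpha>. alternating k \<alpha> \<Longrightarrow>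
      wedge \<alpha> \<eta> [E 1, E 2, E 3, E 4] = covec_inner g k \<alpha> (conj_covec \<phi>)"
    and uniq: "\<And>\<delta>. alternating (4 - k) \<delta> \<Longrightarrow>
      (\<And>\<alpha>. alternating k \<alpha> \<Longrightarrow> wedge \<alpha> \<delta> [E 1, E 2, E 3, E 4] = 0) \<Longrightarrow> \<delta> = 0"
  shows "hodge_covec J g k \<phi> = \<eta>"
proof -
  have "(THE \<eta>. alternating (4 - k) \<eta> \<and> (\<forall>\<alpha>. alternating k \<alpha> \<longrightarrow>
      wedge \<alpha> \<eta> = scale_covec (covec_inner g k \<alpha> (conj_covec \<phi>)) (vol J g))) = \<eta>"
  proof (rule the_equality)
    show "alternating (4 - k) \<eta> \<and> (\<forall>\<alpha>. alternating k \<alpha> \<longrightarrow>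
        wedge \<alpha> \<eta> = scale_covec (covec_inner g k \<alpha> (conj_covec \<phi>)) (vol J g))"
      using \<eta> ex k by (simp add: wedge_eq_scale_vol)
  next
    fix \<eta>'
    assume A: "alternating (4 - k) \<eta>' \<and> (\<forall>\<alpha>. alternating k \<alpha> \<longrightarrow>
        wedge \<alpha> \<eta>' = scale_covec (covec_inner g k \<alpha> (conj_covec \<phi>)) (vol J g))"
    have "\<eta>' - \<eta> = 0"
    proof (rule uniq)
      fix \<alpha> assume \<alpha>: "alternating k \<alpha>"
      have "wedge \<alpha> (\<eta>' - \<eta>) vs = wedge \<alpha> \<eta>' vs - wedge \<alpha> \<eta> vs" for vs
        by (simp add: wedge_def algebra_simps sum_subtractf)
      then show "wedge \<alpha> (\<eta>' - \<eta>) [E 1, E 2, E 3, E 4] = 0"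
        using A \<alpha> ex[OF \<alpha>] by (simp add: scale_covec_def vol_frame)
    qed (use A \<eta> in \<open>simp add: alternating_diff\<close>)
    then show "\<eta>' = \<eta>"
      by simp
  qed
  then show ?thesis
    using k by (simp add: hodge_covec_def)
qed

lemma wedge_4:
  "wedge \<alpha> \<eta> [u, v, w, x] =
     \<alpha> [] * \<eta> [u, v, w, x]
   + \<alpha> [u] * \<eta> [v, w, x] - \<alpha> [v] * \<eta> [u, w, x] + \<alpha> [w] * \<eta> [u, v, x] - \<alpha> [x] * \<eta> [u, v, w]
   + \<alpha> [u, v] * \<eta> [w, x] - \<alpha> [u, w] * \<eta> [v, x] + \<alpha> [u, x] * \<eta> [v, w]
   + \<alpha> [v, w] * \<eta> [u, x] - \<alpha> [v, x] * \<eta> [u, w] + \<alpha> [w, x] * \<eta> [u, v]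
   + \<alpha> [u, v, w] * \<eta> [x] - \<alpha> [u, v, x] * \<eta> [w] + \<alpha> [u, w, x] * \<eta> [v] - \<alpha> [v, w, x] * \<eta> [u]
   + \<alpha> [u, v, w, x] * \<eta> []"
  by (simp add: wedge_Cons wedge_Nil)

lemma alternating_coframe_list: "alternating (length is) (wedge_list (map coframe is))"
proof -
  have "\<forall>\<phi>\<in>set (map coframe is). alternating 1 \<phi>"
    using alternating_coframe by auto
  from alternating_wedge_list[OF this] show ?thesis
    by (simp only: length_map)
qed

text \<open>The signs are those of the shuffles in \<open>wedge_4\<close>. No conjugate appears,
  because the one in the definition of the star and the one in the Hermitian inner product undo each
  other.\<close>

lemma hodge_covec_1:
  assumes "alternating 1 \<phi>" "alternating 3 \<eta>"
    and "\<eta> [E 2, E 3, E 4] = \<phi> [E 1]" "\<eta> [E 1, E 3, E 4] = - \<phi> [E 2]"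
      "\<eta> [E 1, E 2, E 4] = \<phi> [E 3]" "\<eta> [E 1, E 2, E 3] = - \<phi> [E 4]"
  shows "hodge_covec J g 1 \<phi> = \<eta>"
proof (rule hodge_covecI)
  fix \<alpha> assume \<alpha>: "alternating 1 \<alpha>"
  show "wedge \<alpha> \<eta> [E 1, E 2, E 3, E 4] = covec_inner g 1 \<alpha> (conj_covec \<phi>)"
    unfolding covec_inner_1[OF \<alpha> alternating_conj[OF assms(1)]]
    using assms(3-) by (simp add: wedge_4 alternating_eq_0[OF \<alpha>] alternating_eq_0[OF assms(2)] sum_4 conj_covec_def)
next
  fix \<delta> assume \<delta>: "alternating (4 - 1) \<delta>"
    and z: "\<And>\<alpha>. alternating 1 \<alpha> \<Longrightarrow> wedge \<alpha> \<delta> [E 1, E 2, E 3, E 4] = 0"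
  show "\<delta> = 0"
    using \<delta> z[OF alternating_coframe[of 1]] z[OF alternating_coframe[of 2]]
      z[OF alternating_coframe[of 3]] z[OF alternating_coframe[of 4]]
    by (intro alternating_3_eq_0) (simp_all add: wedge_4 c_E)
qed (use assms in simp_all)

lemma hodge_covec_2:
  assumes "alternating 2 \<phi>" "alternating 2 \<eta>"
    and "\<eta> [E 3, E 4] = \<phi> [E 1, E 2]" "\<eta> [E 2, E 4] = - \<phi> [E 1, E 3]" "\<eta> [E 2, E 3] = \<phi> [E 1, E 4]"
      "\<eta> [E 1, E 4] = \<phi> [E 2, E 3]" "\<eta> [E 1, E 3] = - \<phi> [E 2, E 4]" "\<eta> [E 1, E 2] = \<phi> [E 3, E 4]"
  shows "hodge_covec J g 2 \<phi> = \<eta>"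
proof (rule hodge_covecI)
  fix \<alpha> assume \<alpha>: "alternating 2 \<alpha>"
  show "wedge \<alpha> \<eta> [E 1, E 2, E 3, E 4] = covec_inner g 2 \<alpha> (conj_covec \<phi>)"
    unfolding covec_inner_2[OF \<alpha> alternating_conj[OF assms(1)]]
    using assms(3-) by (simp add: wedge_4 alternating_eq_0[OF \<alpha>] alternating_eq_0[OF assms(2)] conj_covec_def)
next
  fix \<delta> assume \<delta>: "alternating (4 - 2) \<delta>"
    and z: "\<And>\<alpha>. alternating 2 \<alpha> \<Longrightarrow> wedge \<alpha> \<delta> [E 1, E 2, E 3, E 4] = 0"
  have zz: "wedge (wedge_list (map coframe [i, j])) \<delta> [E 1, E 2, E 3, E 4] = 0" for i j
    using alternating_coframe_list[of "[i, j]"] by (intro z) (simp add: numeral_2_eq_2)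
  show "\<delta> = 0"
    using \<delta> zz[of 1 2] zz[of 1 3] zz[of 1 4] zz[of 2 3] zz[of 2 4] zz[of 3 4]
    by (intro alternating_2_eq_0) (simp_all add: wedge_4 wedge_Cons wedge_Nil unit_covec_def c_E)
qed (use assms in simp_all)

lemma hodge_covec_3:
  assumes "alternating 3 \<phi>" "alternating 1 \<eta>"
    and "\<eta> [E 4] = \<phi> [E 1, E 2, E 3]" "\<eta> [E 3] = - \<phi> [E 1, E 2, E 4]"
      "\<eta> [E 2] = \<phi> [E 1, E 3, E 4]" "\<eta> [E 1] = - \<phi> [E 2, E 3, E 4]"
  shows "hodge_covec J g 3 \<phi> = \<eta>"
proof (rule hodge_covecI)
  fix \<alpha> assume \<alpha>: "alternating 3 \<alpha>"
  show "wedge \<alpha> \<eta> [E 1, E 2, E 3, E 4] = covec_inner g 3 \<alpha> (conj_covec \<phi>)"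
    unfolding covec_inner_3[OF \<alpha> alternating_conj[OF assms(1)]]
    using assms(3-) by (simp add: wedge_4 alternating_eq_0[OF \<alpha>] alternating_eq_0[OF assms(2)] conj_covec_def)
next
  fix \<delta> assume \<delta>: "alternating (4 - 3) \<delta>"
    and z: "\<And>\<alpha>. alternating 3 \<alpha> \<Longrightarrow> wedge \<alpha> \<delta> [E 1, E 2, E 3, E 4] = 0"
  have zz: "wedge (wedge_list (map coframe [i, j, k])) \<delta> [E 1, E 2, E 3, E 4] = 0" for i j k
    using alternating_coframe_list[of "[i, j, k]"] by (intro z) (simp add: numeral_3_eq_3)
  show "\<delta> = 0"
    using \<delta> zz[of 1 2 3] zz[of 1 2 4] zz[of 1 3 4] zz[of 2 3 4]
    by (intro alternating_1_eq_0) (simp_all add: wedge_4 wedge_Cons wedge_Nil unit_covec_def c_E)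
qed (use assms in simp_all)

lemma hodge_covec_4:
  assumes "alternating 4 \<phi>"
  shows "hodge_covec J g 4 \<phi> = scale_covec (\<phi> [E 1, E 2, E 3, E 4]) unit_covec"
proof (rule hodge_covecI)
  show u: "alternating (4 - 4) (scale_covec (\<phi> [E 1, E 2, E 3, E 4]) unit_covec)"
    by (simp add: alternating_scale alternating_unit_covec)
  fix \<alpha> assume \<alpha>: "alternating 4 \<alpha>"
  show "wedge \<alpha> (scale_covec (\<phi> [E 1, E 2, E 3, E 4]) unit_covec) [E 1, E 2, E 3, E 4] =
      covec_inner g 4 \<alpha> (conj_covec \<phi>)"
    unfolding covec_inner_4[OF \<alpha> alternating_conj[OF assms(1)]]
    by (simp add: wedge_4 conj_covec_def scale_covec_def unit_covec_def)
next
  fix \<delta> assume \<delta>: "alternating (4 - 4) \<delta>"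
    and z: "\<And>\<alpha>. alternating 4 \<alpha> \<Longrightarrow> wedge \<alpha> \<delta> [E 1, E 2, E 3, E 4] = 0"
  have \<delta>0: "\<delta> vs = 0" if "vs \<noteq> []" for vs
    using \<delta> that by (simp add: alternating_eq_0)
  have "\<delta> [] = 0"
    using z[OF alternating_vol] by (simp add: wedge_4 vol_frame \<delta>0)
  then show "\<delta> = 0"
    using \<delta>0 by (metis ext zero_fun_apply)
qed simp

end


section \<open>Smooth functions\<close>

lemma C_k_SucI:
  assumes "\<And>x. (f has_derivative f' x) (at x)" "\<And>v. C_k n (\<lambda>x. f' x v)"
  shows "C_k (Suc n) f"
proof -
  have "frechet_derivative f (at x) = f' x" for x
    using frechet_derivative_at[OF assms(1)[of x]] by simp
  then show ?thesis
    using assms by (auto simp: differentiable_def)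
qed

lemma C_k_derivative:
  assumes "C_k (Suc n) f"
  shows "(f has_derivative frechet_derivative f (at x)) (at x)"
  using assms by (simp flip: frechet_derivative_works)

lemma C_k_pred: "C_k (Suc n) f \<Longrightarrow> C_k n f"
proof (induction n arbitrary: f)
  case 0
  then show ?case
    by (auto simp: continuous_on_eq_continuous_at intro: differentiable_imp_continuous_within)
next
  case (Suc n)
  from Suc.prems have *: "\<forall>x. f differentiable (at x)" "\<forall>v. C_k (Suc n) (\<lambda>x. frechet_derivative f (at x) v)"
    unfolding C_k.simps(2)[of "Suc n"] by blast+
  show ?case
    by (subst C_k.simps(2)) (use * Suc.IH in blast)
qed

lemma C_k_const: "C_k n (\<lambda>x. c)"
proof (induction n arbitrary: c)
  case (Suc n)
  then show ?case by (intro C_k_SucI[where f' = "\<lambda>_ _. 0"]) auto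
qed simp

lemma C_k_add: "C_k n f \<Longrightarrow> C_k n g \<Longrightarrow> C_k n (\<lambda>x. f x + g x)"
proof (induction n arbitrary: f g)
  case (Suc n)
  show ?case
  proof (rule C_k_SucI)
    show "((\<lambda>x. f x + g x) has_derivative
        (\<lambda>v. frechet_derivative f (at x) v + frechet_derivative g (at x) v)) (at x)" for x
      by (intro has_derivative_add C_k_derivative[OF Suc.prems(1)] C_k_derivative[OF Suc.prems(2)])
  qed (use Suc in auto)
qed (auto intro: continuous_intros)

lemma C_k_bilinear:
  assumes "bounded_bilinear p"
  shows "C_k n f \<Longrightarrow> C_k n g \<Longrightarrow> C_k n (\<lambda>x. p (f x) (g x))"
proof (induction n arbitrary: f g)
  case 0
  then show ?case
    using bounded_bilinear.continuous_on[OF assms] by auto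
next
  case (Suc n)
  show ?case
  proof (rule C_k_SucI)
    show "((\<lambda>x. p (f x) (g x)) has_derivative
        (\<lambda>v. p (f x) (frechet_derivative g (at x) v) + p (frechet_derivative f (at x) v) (g x))) (at x)" for x
      by (intro bounded_bilinear.FDERIV[OF assms] C_k_derivative[OF Suc.prems(1)] C_k_derivative[OF Suc.prems(2)])
    show "C_k n (\<lambda>x. p (f x) (frechet_derivative g (at x) v) + p (frechet_derivative f (at x) v) (g x))" for v
      using Suc.prems by (intro C_k_add Suc.IH C_k_pred[OF Suc.prems(1)] C_k_pred[OF Suc.prems(2)]) auto
  qed
qed

lemma C_k_bounded_linear:
  assumes "bounded_linear h"
  shows "C_k n f \<Longrightarrow> C_k n (\<lambda>x. h (f x))"
proof (induction n arbitrary: f)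
  case 0
  then show ?case
    using bounded_linear.continuous_on[OF assms] by auto
next
  case (Suc n)
  show ?case
  proof (rule C_k_SucI)
    show "((\<lambda>x. h (f x)) has_derivative (\<lambda>v. h (frechet_derivative f (at x) v))) (at x)" for x
      by (intro bounded_linear.has_derivative[OF assms] C_k_derivative[OF Suc.prems(1)])
  qed (use Suc in auto)
qed

lemma smooth_const: "smooth (\<lambda>x. c)"
  by (simp add: smooth_def C_k_const)

lemma smooth_add: "smooth f \<Longrightarrow> smooth g \<Longrightarrow> smooth (\<lambda>x. f x + g x)"
  by (simp add: smooth_def C_k_add)

lemma smooth_bounded_linear: "bounded_linear h \<Longrightarrow> smooth f \<Longrightarrow> smooth (\<lambda>x. h (f x))"
  by (simp add: smooth_def C_k_bounded_linear)

lemma smooth_mult: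
  fixes f g :: "'a::euclidean_space \<Rightarrow> 'b::real_normed_algebra"
  shows "smooth f \<Longrightarrow> smooth g \<Longrightarrow> smooth (\<lambda>x. f x * g x)"
  by (simp add: smooth_def C_k_bilinear[OF bounded_bilinear_mult])

lemma smooth_scaleR: "smooth f \<Longrightarrow> smooth g \<Longrightarrow> smooth (\<lambda>x. f x *\<^sub>R g x)"
  by (simp add: smooth_def C_k_bilinear[OF bounded_bilinear_scaleR])

lemma smooth_derivative: "smooth f \<Longrightarrow> smooth (\<lambda>x. frechet_derivative f (at x) v)"
  unfolding smooth_def by (metis C_k.simps(2))

lemma smooth_has_derivative: "smooth f \<Longrightarrow> (f has_derivative frechet_derivative f (at x)) (at x)"
  unfolding smooth_def using C_k_derivative by blast

lemma smooth_continuous: "smooth f \<Longrightarrow> continuous_on S f"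
  unfolding smooth_def by (metis C_k.simps(1) continuous_on_subset subset_UNIV)

lemma smooth_linear:
  assumes "bounded_linear f"
  shows "smooth f"
  unfolding smooth_def
proof
  fix n
  show "C_k n f"
  proof (cases n)
    case 0
    then show ?thesis
      using bounded_linear.continuous_on[OF assms continuous_on_id] by simp
  next
    case (Suc m)
    show ?thesis
      unfolding Suc
      by (rule C_k_SucI[OF bounded_linear_imp_has_derivative[OF assms] C_k_const])
  qed
qed

lemma smooth_nth: "smooth (\<lambda>x :: real ^ 'n. x $ i)"
  by (rule smooth_linear) (rule bounded_linear_vec_nth)

text \<open>The induction runs over all multiples \<open>c * exp (L x)\<close>, a class closed under
  directional derivatives, which merely multiply c by \<open>L v\<close>.\<close>

lemma smooth_exp_linear:
  fixes L :: "'a::euclidean_space \<Rightarrow> complex"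
  assumes "bounded_linear L"
  shows "smooth (\<lambda>x. exp (L x))"
proof -
  have d: "((\<lambda>x. c * exp (L x)) has_derivative (\<lambda>v. c * L v * exp (L x))) (at x)" for c x
    using has_derivative_mult_right[OF has_derivative_compose[OF
          bounded_linear_imp_has_derivative[OF assms] DERIV_exp[unfolded has_field_derivative_def]], of c]
    by (simp add: mult_ac)
  have "C_k n (\<lambda>x. c * exp (L x))" for n c
  proof (induction n arbitrary: c)
    case 0
    have "continuous_on UNIV L"
      using bounded_linear.continuous_on[OF assms continuous_on_id] .
    then show ?case by (auto intro: continuous_intros)
  next
    case (Suc n)
    show ?case by (rule C_k_SucI[OF d Suc])
  qed
  from this[of _ 1] show ?thesis
    by (simp add: smooth_def)
qed

lemma smooth_has_vector_derivative_line:
  fixes f :: "'a::euclidean_space \<Rightarrow> 'b::real_normed_vector"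
  assumes "smooth f"
  shows "((\<lambda>s. f (y + s *\<^sub>R u)) has_vector_derivative frechet_derivative f (at (y + s *\<^sub>R u)) u) (at s)"
proof -
  have "((\<lambda>s. y + s *\<^sub>R u) has_derivative (\<lambda>s. s *\<^sub>R u)) (at s)"
    by (auto intro!: derivative_eq_intros)
  from diff_chain_at[OF this smooth_has_derivative[OF assms(1)]]
  show ?thesis
    by (simp add: o_def has_vector_derivative_def linear_scale[OF has_derivative_linear[OF smooth_has_derivative[OF assms]]])
qed

lemma integral_directional_derivative:
  fixes f :: "'a::euclidean_space \<Rightarrow> 'b::banach"
  assumes "smooth f" "0 \<le> a"
  shows "integral {0..a} (\<lambda>s. frechet_derivative f (at (y + s *\<^sub>R u)) u) = f (y + a *\<^sub>R u) - f y"
  using integral_unique[OF fundamental_theorem_of_calculus[OF assms(2)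
        has_vector_derivative_at_within[OF smooth_has_vector_derivative_line[OF assms(1)]]]] by simp

text \<open>The indefinite integral is constant, yet its one-sided derivative at 0 is
  \<open>k 0\<close>.\<close>

lemma integral_eq_0_imp_at_0:
  fixes k :: "real \<Rightarrow> 'b::banach"
  assumes "continuous_on {0..1} k" "\<And>a. 0 \<le> a \<Longrightarrow> a \<le> 1 \<Longrightarrow> integral {0..a} k = 0"
  shows "k 0 = 0"
proof -
  have "((\<lambda>u. integral {0..u} k) has_vector_derivative k 0) (at 0 within {0..1})"
    by (rule integral_has_vector_derivative[OF assms(1)]) simp
  then have "((\<lambda>u. 0) has_vector_derivative k 0) (at 0 within {0..1})"
    by (rule has_vector_derivative_transform[rotated 2]) (use assms(2) in auto)
  moreover have "((\<lambda>u. 0) has_vector_derivative (0 :: 'b)) (at 0 within {0..1::real})"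
    by simp
  ultimately show ?thesis
    by (rule vector_derivative_unique_within[rotated]) (auto simp: at_within_Icc_at_right)
qed

lemma continuous_param_integral:
  fixes G :: "'a::topological_space \<Rightarrow> real \<Rightarrow> 'b::banach"
  assumes "continuous_on UNIV (\<lambda>(p, s). G p s)"
  shows "continuous_on UNIV (\<lambda>p. integral {a..b} (G p))"
  using integral_continuous_on_param[of UNIV a b G] continuous_on_subset[OF assms] by auto

lemma integral_swap:
  fixes G :: "real \<Rightarrow> real \<Rightarrow> 'b::banach"
  assumes "continuous_on UNIV (\<lambda>(s, t). G s t)"
  shows "integral {a..b} (\<lambda>s. integral {c..d} (\<lambda>t. G s t)) = integral {c..d} (\<lambda>t. integral {a..b} (\<lambda>s. G s t))"
  using integral_swap_continuous[of a c b d G] continuous_on_subset[OF assms] by auto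

text \<open>
  Both second derivatives have the same integral over every small parallelogram based at the point.
\<close>

lemma symmetric_second_derivative:
  fixes f :: "'a::euclidean_space \<Rightarrow> 'b::banach"
  assumes f: "smooth f"
  shows "frechet_derivative (\<lambda>y. frechet_derivative f (at y) u) (at x) v =
    frechet_derivative (\<lambda>y. frechet_derivative f (at y) v) (at x) u"
proof -
  define D where "D w y = frechet_derivative f (at y) w" for w y
  define D2 where "D2 w w' y = frechet_derivative (D w) (at y) w'" for w w' y
  have sD: "smooth (D w)" and sD2: "smooth (D2 w w')" for w w'
    unfolding D_def D2_def by (intro smooth_derivative f)+
  have rect: "integral {0..a} (\<lambda>s. integral {0..b} (\<lambda>t. D2 w w' (x + s *\<^sub>R w + t *\<^sub>R w'))) =
      f (x + a *\<^sub>R w + b *\<^sub>R w') - f (x + b *\<^sub>R w') - (f (x + a *\<^sub>R w) - f x)"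
    if "0 \<le> a" "0 \<le> b" for a b w w'
  proof -
    have cont: "continuous_on {0..a} (\<lambda>s. D w (p + s *\<^sub>R w))" for p
      by (rule continuous_on_compose2[OF smooth_continuous[OF sD]]) (auto intro!: continuous_intros)
    have "integral {0..a} (\<lambda>s. integral {0..b} (\<lambda>t. D2 w w' (x + s *\<^sub>R w + t *\<^sub>R w')))
        = integral {0..a} (\<lambda>s. D w (x + b *\<^sub>R w' + s *\<^sub>R w) - D w (x + s *\<^sub>R w))"
      unfolding D2_def integral_directional_derivative[OF sD that(2)] by (simp add: algebra_simps)
    also have "\<dots> = integral {0..a} (\<lambda>s. D w (x + b *\<^sub>R w' + s *\<^sub>R w)) - integral {0..a} (\<lambda>s. D w (x + s *\<^sub>R w))"
      by (intro integral_diff integrable_continuous_real cont)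
    also have "\<dots> = f (x + b *\<^sub>R w' + a *\<^sub>R w) - f (x + b *\<^sub>R w') - (f (x + a *\<^sub>R w) - f x)"
      unfolding D_def integral_directional_derivative[OF f that(1)] ..
    finally show ?thesis
      by (simp add: algebra_simps)
  qed
  define K where "K s t = D2 u v (x + s *\<^sub>R u + t *\<^sub>R v) - D2 v u (x + s *\<^sub>R u + t *\<^sub>R v)" for s t
  have c: "continuous_on S (\<lambda>(s, t). D2 w w' (x + s *\<^sub>R u + t *\<^sub>R v))" for w w' S
    unfolding split_def
    by (rule continuous_on_compose2[OF smooth_continuous[OF sD2]]) (auto intro!: continuous_intros)
  have cK: "continuous_on UNIV (\<lambda>(s, t). K s t)"
    unfolding K_def split_def by (intro continuous_on_diff c[unfolded split_def])
  have ct: "continuous_on S (\<lambda>t. D2 w w' (x + s *\<^sub>R u + t *\<^sub>R v))" for w w' s S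
    by (rule continuous_on_compose2[OF smooth_continuous[OF sD2]]) (auto intro!: continuous_intros)
  \<comment> \<open>Shrinking the side along u removes the outer integral; shrinking the side along
    v afterwards removes the inner one.\<close>
  have "integral {0..b} (K 0) = 0" if b: "0 \<le> b" for b
  proof (rule integral_eq_0_imp_at_0[where k = "\<lambda>s. integral {0..b} (K s)"])
    show "continuous_on {0..1} (\<lambda>s. integral {0..b} (K s))"
      using continuous_param_integral[OF cK] continuous_on_subset by blast
    fix a :: real assume a: "0 \<le> a"
    have cs: "continuous_on {0..a} (\<lambda>s. integral {0..b} (\<lambda>t. D2 w w' (x + s *\<^sub>R u + t *\<^sub>R v)))" for w w'
      using continuous_param_integral[OF c] continuous_on_subset by blast
    have "integral {0..a} (\<lambda>s. integral {0..b} (K s)) =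
      integral {0..a} (\<lambda>s. integral {0..b} (\<lambda>t. D2 u v (x + s *\<^sub>R u + t *\<^sub>R v)) -
        integral {0..b} (\<lambda>t. D2 v u (x + s *\<^sub>R u + t *\<^sub>R v)))"
      unfolding K_def by (subst integral_diff) (auto intro!: integrable_continuous_real ct)
    also have "\<dots> = integral {0..a} (\<lambda>s. integral {0..b} (\<lambda>t. D2 u v (x + s *\<^sub>R u + t *\<^sub>R v))) -
      integral {0..a} (\<lambda>s. integral {0..b} (\<lambda>t. D2 v u (x + s *\<^sub>R u + t *\<^sub>R v)))"
      by (intro integral_diff integrable_continuous_real cs)
    also have "integral {0..a} (\<lambda>s. integral {0..b} (\<lambda>t. D2 v u (x + s *\<^sub>R u + t *\<^sub>R v))) =
      integral {0..b} (\<lambda>t. integral {0..a} (\<lambda>s. D2 v u (x + t *\<^sub>R v + s *\<^sub>R u)))"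
      by (subst integral_swap[OF c]) (simp add: algebra_simps)
    also have "\<dots> = integral {0..a} (\<lambda>s. integral {0..b} (\<lambda>t. D2 u v (x + s *\<^sub>R u + t *\<^sub>R v)))"
      by (simp only: rect[OF a b, of u v] rect[OF b a, of v u]) (simp add: algebra_simps)
    finally show "integral {0..a} (\<lambda>s. integral {0..b} (K s)) = 0"
      by simp
  qed
  moreover have "continuous_on {0..1} (K 0)"
    unfolding K_def by (intro continuous_on_diff ct)
  ultimately have "K 0 0 = 0"
    by (intro integral_eq_0_imp_at_0[where k = "K 0"]) auto
  then show ?thesis
    by (simp add: K_def D2_def D_def[abs_def])
qed


section \<open>Invariant functions and their integral\<close>

text \<open>The left-invariant vector fields \<open>\<partial>\<^sub>t, \<partial>\<^sub>x, \<partial>\<^sub>y + x \<partial>\<^sub>z, \<partial>\<^sub>z\<close>.\<close>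

definition kt_frame :: "vec4 \<Rightarrow> 4 \<Rightarrow> vec4" where
  "kt_frame x i = axis i 1 + (if i = 3 then x $ 2 *\<^sub>R axis 4 1 else 0)"

definition fld :: "4 \<Rightarrow> (vec4 \<Rightarrow> complex) \<Rightarrow> vec4 \<Rightarrow> complex" where
  "fld i f x = frechet_derivative f (at x) (kt_frame x i)"

definition kt_fun :: "(vec4 \<Rightarrow> complex) \<Rightarrow> bool" where
  "kt_fun f \<longleftrightarrow> smooth f \<and> (\<forall>a\<in>kt_lattice. \<forall>x. f (kt_mult a x) = f x)"

lemma kt_frame_simps:
  "kt_frame x 1 = axis 1 1" "kt_frame x 2 = axis 2 1" "kt_frame x 3 = axis 3 1 + x $ 2 *\<^sub>R axis 4 1"
  "kt_frame x 4 = axis 4 1"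
  by (simp_all add: kt_frame_def)

lemma smooth_linear_derivative: "smooth f \<Longrightarrow> linear (frechet_derivative f (at x))"
  using smooth_has_derivative has_derivative_linear by blast

lemma frame_expansion:
  "v = v $ 1 *\<^sub>R kt_frame x 1 + v $ 2 *\<^sub>R kt_frame x 2 + v $ 3 *\<^sub>R kt_frame x 3 + (v $ 4 - x $ 2 * v $ 3) *\<^sub>R kt_frame x 4"
  by (simp add: vec_eq_iff forall_4 kt_frame_simps axis_def)

lemma derivative_eq_fld:
  assumes "smooth f"
  shows "frechet_derivative f (at x) v = complex_of_real (v $ 1) * fld 1 f x + complex_of_real (v $ 2) * fld 2 f x +
    complex_of_real (v $ 3) * fld 3 f x + complex_of_real (v $ 4 - x $ 2 * v $ 3) * fld 4 f x"
proof -
  interpret linear "frechet_derivative f (at x)"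
    by (rule smooth_linear_derivative[OF assms])
  show ?thesis
    by (subst frame_expansion[of v x]) (simp only: add scale fld_def, simp only: scaleR_conv_of_real)
qed

lemma fld_eq:
  assumes "smooth f"
  shows "fld i f = (\<lambda>x. frechet_derivative f (at x) (axis i 1) +
    (if i = 3 then complex_of_real (x $ 2) * frechet_derivative f (at x) (axis 4 1) else 0))"
proof
  fix x
  interpret linear "frechet_derivative f (at x)"
    by (rule smooth_linear_derivative[OF assms])
  show "fld i f x = frechet_derivative f (at x) (axis i 1) +
    (if i = 3 then complex_of_real (x $ 2) * frechet_derivative f (at x) (axis 4 1) else 0)"
    by (simp add: fld_def kt_frame_def add scale) (simp add: scaleR_conv_of_real)
qed

lemma smooth_of_real_nth: "smooth (\<lambda>x :: vec4. complex_of_real (x $ i))"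
  by (rule smooth_bounded_linear[OF bounded_linear_of_real smooth_nth])

lemma smooth_fld: "smooth f \<Longrightarrow> smooth (fld i f)"
  by (cases "i = 3") (auto simp: fld_eq intro!: smooth_add smooth_mult smooth_derivative smooth_of_real_nth)

lemma fld_has_derivative: "(f has_derivative f') (at x) \<Longrightarrow> fld i f x = f' (kt_frame x i)"
  unfolding fld_def using frechet_derivative_at by metis

lemma fld_add: "smooth f \<Longrightarrow> smooth g \<Longrightarrow> fld i (\<lambda>x. f x + g x) = (\<lambda>x. fld i f x + fld i g x)"
  by (rule ext, subst fld_has_derivative[OF has_derivative_add[OF smooth_has_derivative smooth_has_derivative]])
    (simp_all add: fld_def)

lemma fld_cmult: "smooth f \<Longrightarrow> fld i (\<lambda>x. c * f x) = (\<lambda>x. c * fld i f x)"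
  by (rule ext, subst fld_has_derivative[OF has_derivative_mult_right[OF smooth_has_derivative]])
    (simp_all add: fld_def)

lemma fld_mult: "smooth f \<Longrightarrow> smooth g \<Longrightarrow> fld i (\<lambda>x. f x * g x) = (\<lambda>x. f x * fld i g x + fld i f x * g x)"
  by (rule ext, subst fld_has_derivative[OF has_derivative_mult[OF smooth_has_derivative smooth_has_derivative]])
    (simp_all add: fld_def)

lemma fld_cnj: "smooth f \<Longrightarrow> fld i (\<lambda>x. cnj (f x)) = (\<lambda>x. cnj (fld i f x))"
  by (rule ext, subst fld_has_derivative[OF bounded_linear.has_derivative[OF bounded_linear_cnj smooth_has_derivative]])
    (simp_all add: fld_def)

lemma fld_const: "fld i (\<lambda>x. c) = (\<lambda>x. 0)"
  by (rule ext, subst fld_has_derivative[OF has_derivative_const]) simp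

text \<open>The last term differentiates the coefficient \<open>x $ 2\<close> of the third frame
  field. It is the origin of the only nonzero bracket of the frame, that of the second and third
  fields, which is the fourth.\<close>

lemma derivative_fld:
  assumes f: "smooth f"
  shows "frechet_derivative (fld i f) (at x) v =
    frechet_derivative (\<lambda>y. frechet_derivative f (at y) v) (at x) (kt_frame x i) +
    (if i = 3 then complex_of_real (v $ 2) * fld 4 f x else 0)"
proof -
  define A where "A w y = frechet_derivative f (at y) w" for w y
  have sA: "smooth (A w)" for w
    unfolding A_def by (rule smooth_derivative[OF f])
  have sym: "frechet_derivative (A w) (at x) u = frechet_derivative (A u) (at x) w" for u w
    unfolding A_def by (rule symmetric_second_derivative[OF f])
  have nth: "((\<lambda>y :: vec4. complex_of_real (y $ 2)) has_derivative (\<lambda>v. complex_of_real (v $ 2))) (at x)"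
    by (intro bounded_linear_imp_has_derivative bounded_linear_compose[OF bounded_linear_of_real bounded_linear_vec_nth])
  have eq: "fld i f = (\<lambda>y. A (axis i 1) y + (if i = 3 then complex_of_real (y $ 2) * A (axis 4 1) y else 0))"
    unfolding A_def by (rule fld_eq[OF f])
  have 1: "(fld i f has_derivative (\<lambda>v. frechet_derivative (A (axis i 1)) (at x) v +
      (if i = 3 then complex_of_real (x $ 2) * frechet_derivative (A (axis 4 1)) (at x) v +
        complex_of_real (v $ 2) * A (axis 4 1) x else 0))) (at x)"
    unfolding eq using smooth_has_derivative[OF sA] nth
    by (cases "i = 3") (auto intro!: has_derivative_add has_derivative_mult)
  interpret linear "frechet_derivative (A v) (at x)"
    by (rule smooth_linear_derivative[OF sA])
  have "frechet_derivative (A v) (at x) (kt_frame x i) = frechet_derivative (A v) (at x) (axis i 1) +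
      (if i = 3 then complex_of_real (x $ 2) * frechet_derivative (A v) (at x) (axis 4 1) else 0)"
    by (simp add: kt_frame_def add scale) (simp add: scaleR_conv_of_real)
  then show ?thesis
    unfolding frechet_derivative_at[OF 1, symmetric]
    by (simp add: sym[of _ v] A_def[symmetric] fld_def kt_frame_simps)
qed

lemma fld_commute:
  assumes "smooth f" "i \<noteq> 2 \<or> j \<noteq> 3" "i \<noteq> 3 \<or> j \<noteq> 2"
  shows "fld i (fld j f) = fld j (fld i f)"
proof
  fix x
  have sA: "smooth (\<lambda>y. frechet_derivative f (at y) w)" for w
    by (rule smooth_derivative[OF assms(1)])
  have z: "kt_frame x k $ 2 = (if k = 2 then 1 else 0)" for k
    using exhaust_4[of k] by (auto simp: kt_frame_simps axis_def)
  have "fld i (fld j f) x = frechet_derivative (\<lambda>y. frechet_derivative f (at y) (kt_frame x i)) (at x) (kt_frame x j)"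
    using assms(2) unfolding fld_def[of i "fld j f"] derivative_fld[OF assms(1)] by (auto simp: z)
  also have "\<dots> = frechet_derivative (\<lambda>y. frechet_derivative f (at y) (kt_frame x j)) (at x) (kt_frame x i)"
    by (rule symmetric_second_derivative[OF assms(1)])
  also have "\<dots> = fld j (fld i f) x"
    using assms(3) unfolding fld_def[of j "fld i f"] derivative_fld[OF assms(1)] by (auto simp: z)
  finally show "fld i (fld j f) x = fld j (fld i f) x" .
qed

lemma fld_2_3:
  assumes "smooth f"
  shows "fld 2 (fld 3 f) x = fld 3 (fld 2 f) x + fld 4 f x"
proof -
  have "fld 2 (fld 3 f) x = frechet_derivative (\<lambda>y. frechet_derivative f (at y) (kt_frame x 2)) (at x) (kt_frame x 3) + fld 4 f x"
    unfolding fld_def[of 2 "fld 3 f"] derivative_fld[OF assms(1)] by (simp add: kt_frame_simps axis_def)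
  also have "frechet_derivative (\<lambda>y. frechet_derivative f (at y) (kt_frame x 2)) (at x) (kt_frame x 3) =
     frechet_derivative (\<lambda>y. frechet_derivative f (at y) (kt_frame x 3)) (at x) (kt_frame x 2)"
    by (rule symmetric_second_derivative[OF assms(1)])
  also have "\<dots> = fld 3 (fld 2 f) x"
    unfolding fld_def[of 3 "fld 2 f"] derivative_fld[OF assms(1)] by simp
  finally show ?thesis .
qed

lemma kt_mult_has_derivative:
  "(kt_mult a has_derivative (\<lambda>v. v + (a $ 2 * v $ 3) *\<^sub>R axis 4 1)) (at x)"
proof -
  have eq: "kt_mult a = (\<lambda>b. a + (b + (a $ 2 * b $ 3) *\<^sub>R axis 4 1))"
    by (auto simp: kt_mult_def vec_eq_iff axis_def)
  have "((\<lambda>b :: vec4. a $ 2 * b $ 3) has_derivative (\<lambda>v. a $ 2 * v $ 3)) (at x)"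
    by (intro bounded_linear_imp_has_derivative bounded_linear_mult_const bounded_linear_const_mult bounded_linear_vec_nth)
  then show ?thesis
    unfolding eq
    by (auto intro!: derivative_eq_intros bounded_linear_imp_has_derivative[OF bounded_linear_vec_nth])
qed

lemma kt_push_eq: "kt_push a x v = v + (a $ 2 * v $ 3) *\<^sub>R axis 4 1"
  unfolding kt_push_def frechet_derivative_at[OF kt_mult_has_derivative, symmetric] ..

lemma kt_mult_nth:
  "kt_mult a b $ 1 = b $ 1 + a $ 1" "kt_mult a b $ 2 = b $ 2 + a $ 2" "kt_mult a b $ 3 = b $ 3 + a $ 3"
  "kt_mult a b $ 4 = b $ 4 + a $ 4 + a $ 2 * b $ 3"
  by (simp_all add: kt_mult_def)

lemma kt_push_frame: "kt_push a x (kt_frame x i) = kt_frame (kt_mult a x) i"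
  using exhaust_4[of i]
  by (auto simp: kt_push_eq kt_frame_simps vec_eq_iff axis_def kt_mult_nth)

lemma kt_fun_smooth: "kt_fun f \<Longrightarrow> smooth f"
  by (simp add: kt_fun_def)

lemma kt_fun_fld:
  assumes "kt_fun f"
  shows "kt_fun (fld i f)"
  unfolding kt_fun_def
proof (intro conjI ballI allI)
  have f: "smooth f" and inv: "\<And>a x. a \<in> kt_lattice \<Longrightarrow> f (kt_mult a x) = f x"
    using assms by (auto simp: kt_fun_def)
  show "smooth (fld i f)"
    by (rule smooth_fld[OF f])
  fix a x assume a: "a \<in> kt_lattice"
  have "f = f \<circ> kt_mult a"
    using inv[OF a] by auto
  moreover have "(f \<circ> kt_mult a has_derivative (\<lambda>v. frechet_derivative f (at (kt_mult a x)) (kt_push a x v))) (at x)"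
    using diff_chain_at[OF kt_mult_has_derivative smooth_has_derivative[OF f]]
    by (simp add: o_def kt_push_eq)
  ultimately have "(f has_derivative (\<lambda>v. frechet_derivative f (at (kt_mult a x)) (kt_push a x v))) (at x)"
    by simp
  from fld_has_derivative[OF this] show "fld i f (kt_mult a x) = fld i f x"
    by (simp add: kt_push_frame fld_def)
qed

lemma kt_fun_add: "kt_fun f \<Longrightarrow> kt_fun g \<Longrightarrow> kt_fun (\<lambda>x. f x + g x)"
  by (simp add: kt_fun_def smooth_add)

lemma kt_fun_const: "kt_fun (\<lambda>x. c)"
  by (simp add: kt_fun_def smooth_const)

lemma kt_fun_mult: "kt_fun f \<Longrightarrow> kt_fun g \<Longrightarrow> kt_fun (\<lambda>x. f x * g x)"
  by (simp add: kt_fun_def smooth_mult)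

lemma kt_fun_cnj: "kt_fun f \<Longrightarrow> kt_fun (\<lambda>x. cnj (f x))"
  by (simp add: kt_fun_def smooth_bounded_linear[OF bounded_linear_cnj])

section \<open>Integration over the fundamental cube\<close>

definition pt :: "real \<times> real \<times> real \<times> real \<Rightarrow> vec4" where
  "pt = (\<lambda>(t, x, y, z). t *\<^sub>R axis 1 1 + x *\<^sub>R axis 2 1 + y *\<^sub>R axis 3 1 + z *\<^sub>R axis 4 1)"

text \<open>The unit cube is a fundamental domain of the lattice, and left translations preserve
  Lebesgue measure. For invariant functions this is therefore, up to a constant factor, the integral
  over the quotient against the volume form of any of the metrics used.\<close>

definition kt_integral :: "(vec4 \<Rightarrow> 'b::banach) \<Rightarrow> 'b" where
  "kt_integral F = integral (cbox (0, 0, 0, 0) (1, 1, 1, 1)) (\<lambda>p. F (pt p))"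

lemma pt_nth [simp]:
  "pt (t, x, y, z) $ 1 = t" "pt (t, x, y, z) $ 2 = x" "pt (t, x, y, z) $ 3 = y" "pt (t, x, y, z) $ 4 = z"
  by (simp_all add: pt_def axis_def)

lemma pt_surj: "p = pt (p $ 1, p $ 2, p $ 3, p $ 4)"
  by (simp add: vec_eq_iff forall_4)

lemma continuous_on_pt: "continuous_on S pt"
  unfolding pt_def split_def by (intro continuous_intros)

lemma continuous_on_pt_compose:
  assumes "continuous_on UNIV F" "continuous_on S h"
  shows "continuous_on S (\<lambda>p. F (pt (h p)))"
  using continuous_on_compose2[OF assms(1) continuous_on_compose2[OF continuous_on_pt[of UNIV] assms(2)]] by simp

lemma kt_integrable: "continuous_on UNIV F \<Longrightarrow> (\<lambda>p. F (pt p)) integrable_on cbox a b"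
  for F :: "vec4 \<Rightarrow> 'b::banach"
  by (intro integrable_continuous continuous_on_pt_compose) auto

lemma kt_integral_add:
  "continuous_on UNIV F \<Longrightarrow> continuous_on UNIV G \<Longrightarrow>
    kt_integral (\<lambda>x. F x + G x) = kt_integral F + kt_integral G"
  unfolding kt_integral_def by (intro integral_add kt_integrable)

lemma kt_integral_linear:
  "bounded_linear h \<Longrightarrow> continuous_on UNIV F \<Longrightarrow> kt_integral (\<lambda>x. h (F x)) = h (kt_integral F)"
  unfolding kt_integral_def using integral_linear[OF kt_integrable] by (simp add: o_def)

text \<open>Several orders of integration are recorded so that each of t, x, y and z is innermost
  once and can be integrated by the fundamental theorem of calculus.\<close>

lemma kt_integral_prod:
  assumes "continuous_on UNIV F"
  shows "kt_integral F = integral {0..1} (\<lambda>t. integral (cbox (0, 0, 0) (1, 1, 1)) (\<lambda>w. F (pt (t, w))))" (is ?P1)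
    "kt_integral F = integral (cbox (0, 0, 0) (1, 1, 1)) (\<lambda>w. integral {0..1} (\<lambda>t. F (pt (t, w))))" (is ?P2)
    "kt_integral F = integral {0..1} (\<lambda>t. integral (cbox (0, 0) (1, 1)) (\<lambda>w. integral {0..1} (\<lambda>x. F (pt (t, x, w)))))" (is ?P3)
    "kt_integral F = integral {0..1} (\<lambda>t. integral {0..1} (\<lambda>x. integral {0..1} (\<lambda>y. integral {0..1} (\<lambda>z. F (pt (t, x, y, z))))))" (is ?P4)
    "kt_integral F = integral {0..1} (\<lambda>t. integral {0..1} (\<lambda>x. integral {0..1} (\<lambda>z. integral {0..1} (\<lambda>y. F (pt (t, x, y, z))))))" (is ?P5)
proof -
  note c = continuous_on_pt_compose[OF assms]
  show 1: ?P1
    unfolding kt_integral_def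
    by (subst integral_prod_continuous[OF c[where h = "\<lambda>p. p"]]) (auto intro: continuous_intros)
  show ?P2
    unfolding 1
    using integral_swap_continuous[of "0 :: real" "(0, 0, 0)" 1 "(1, 1, 1) :: real \<times> real \<times> real" "\<lambda>t w. F (pt (t, w))"]
      c[of _ "\<lambda>p. p"] by (simp add: split_def continuous_on_id)
  have 2: "integral (cbox (0, 0, 0) (1, 1, 1)) (\<lambda>w. F (pt (t, w))) =
      integral {0..1} (\<lambda>x. integral (cbox (0, 0) (1, 1)) (\<lambda>w. F (pt (t, x, w))))" for t
    by (subst integral_prod_continuous[OF c[where h = "\<lambda>p. (t, p)"]]) (auto intro: continuous_intros)
  have "integral (cbox (0, 0, 0) (1, 1, 1)) (\<lambda>w. F (pt (t, w))) =
      integral (cbox (0, 0) (1, 1)) (\<lambda>w. integral {0..1} (\<lambda>x. F (pt (t, x, w))))" for t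
    unfolding 2
    using integral_swap_continuous[of "0 :: real" "(0, 0)" 1 "(1, 1) :: real \<times> real" "\<lambda>x w. F (pt (t, x, w))"]
      c[of _ "\<lambda>p. (t, p)"] by (simp add: split_def continuous_on_Pair continuous_on_id)
  then show ?P3
    unfolding 1 by simp
  have 3: "integral (cbox (0, 0) (1, 1)) (\<lambda>w. F (pt (t, x, w))) =
      integral {0..1} (\<lambda>y. integral {0..1} (\<lambda>z. F (pt (t, x, y, z))))" for t x
    by (subst integral_prod_continuous[OF c[where h = "\<lambda>p. (t, x, p)"]]) (auto intro!: continuous_on_Pair continuous_on_const continuous_on_id)
  show ?P4
    unfolding 1 2 3 ..
  have "integral {0..1} (\<lambda>y. integral {0..1} (\<lambda>z. F (pt (t, x, y, z)))) =
      integral {0..1} (\<lambda>z. integral {0..1} (\<lambda>y. F (pt (t, x, y, z))))" for t x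
    by (rule integral_swap) (simp add: split_def c continuous_on_Pair continuous_on_fst continuous_on_snd continuous_on_id)
  then show ?P5
    unfolding 1 2 3 by simp
qed

text \<open>Only t, y and z are genuine periods. The generator in x is the translation that shears z
  by y.\<close>

lemma kt_fun_periodic:
  assumes "kt_fun F"
  shows "F (pt (t + 1, x, y, z)) = F (pt (t, x, y, z))"
    "F (pt (t, x + 1, y, z + y)) = F (pt (t, x, y, z))"
    "F (pt (t, x, y + 1, z)) = F (pt (t, x, y, z))"
    "F (pt (t, x, y, z + 1)) = F (pt (t, x, y, z))"
proof -
  have *: "F (kt_mult (axis i 1) p) = F p" for i p
    using assms by (auto simp: kt_fun_def kt_lattice_def axis_def)
  have eq: "kt_mult (axis 1 1) (pt (t, x, y, z)) = pt (t + 1, x, y, z)"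
    "kt_mult (axis 2 1) (pt (t, x, y, z)) = pt (t, x + 1, y, z + y)"
    "kt_mult (axis 3 1) (pt (t, x, y, z)) = pt (t, x, y + 1, z)"
    "kt_mult (axis 4 1) (pt (t, x, y, z)) = pt (t, x, y, z + 1)"
    by (simp_all add: vec_eq_iff forall_4 kt_mult_nth axis_def)
  show "F (pt (t + 1, x, y, z)) = F (pt (t, x, y, z))"
    "F (pt (t, x + 1, y, z + y)) = F (pt (t, x, y, z))"
    "F (pt (t, x, y + 1, z)) = F (pt (t, x, y, z))"
    "F (pt (t, x, y, z + 1)) = F (pt (t, x, y, z))"
    unfolding eq[symmetric] by (rule *)+
qed

lemma integral_periodic_shift:
  fixes p :: "real \<Rightarrow> 'b::banach"
  assumes cont: "continuous_on UNIV p" and per: "\<And>z. p (z + 1) = p z" and y: "0 \<le> y" "y \<le> 1"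
  shows "integral {0..1} (\<lambda>z. p (z - y)) = integral {0..1} p"
proof -
  have int: "p integrable_on {a..b}" for a b
    by (intro integrable_continuous_real continuous_on_subset[OF cont]) simp
  have "integral {0..1} (\<lambda>z. p (z - y)) = integral {0 + - y..1 + - y} p"
    using integral_shift_Icc_real[of 0 1 p "- y"] by (simp add: o_def)
  also have "\<dots> = integral {- y..0} p + integral {0..1 - y} p"
    using y by (simp add: Henstock_Kurzweil_Integration.integral_combine int)
  also have "integral {- y..0} p = integral {1 - y..1} p"
    using integral_shift_Icc_real[of "- y" 0 p 1] by (simp add: o_def per add.commute)
  also have "integral {1 - y..1} p + integral {0..1 - y} p = integral {0..1} p"
    using y by (subst add.commute) (simp add: Henstock_Kurzweil_Integration.integral_combine int)
  finally show ?thesis .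
qed

lemma pt_shift:
  "pt (t, x, y, z) = pt (0, x, y, z) + t *\<^sub>R axis 1 1" "pt (t, x, y, z) = pt (t, 0, y, z) + x *\<^sub>R axis 2 1"
  "pt (t, x, y, z) = pt (t, x, 0, z) + y *\<^sub>R axis 3 1" "pt (t, x, y, z) = pt (t, x, y, 0) + z *\<^sub>R axis 4 1"
  by (simp_all add: pt_def)

lemma integral_derivative_pt:
  fixes F :: "vec4 \<Rightarrow> complex"
  assumes "smooth F"
  shows "integral {0..1} (\<lambda>t. frechet_derivative F (at (pt (t, x, y, z))) (axis 1 1)) = F (pt (1, x, y, z)) - F (pt (0, x, y, z))"
    "integral {0..1} (\<lambda>x. frechet_derivative F (at (pt (t, x, y, z))) (axis 2 1)) = F (pt (t, 1, y, z)) - F (pt (t, 0, y, z))"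
    "integral {0..1} (\<lambda>y. frechet_derivative F (at (pt (t, x, y, z))) (axis 3 1)) = F (pt (t, x, 1, z)) - F (pt (t, x, 0, z))"
    "integral {0..1} (\<lambda>z. frechet_derivative F (at (pt (t, x, y, z))) (axis 4 1)) = F (pt (t, x, y, 1)) - F (pt (t, x, y, 0))"
  using integral_directional_derivative[OF assms, of 1 "pt (0, x, y, z)" "axis 1 1"]
    integral_directional_derivative[OF assms, of 1 "pt (t, 0, y, z)" "axis 2 1"]
    integral_directional_derivative[OF assms, of 1 "pt (t, x, 0, z)" "axis 3 1"]
    integral_directional_derivative[OF assms, of 1 "pt (t, x, y, 0)" "axis 4 1"]
  unfolding pt_shift(1)[of _ x y z, symmetric] pt_shift(2)[of t _ y z, symmetric]
    pt_shift(3)[of t x _ z, symmetric] pt_shift(4)[of t x y, symmetric]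
  by simp_all

text \<open>The left-invariant fields are divergence free, so integrating along a field leaves
  boundary terms which cancel by invariance under the lattice. This is the source of all
  integrations by parts.\<close>

lemma kt_integral_fld:
  assumes F: "kt_fun F"
  shows "kt_integral (fld i F) = 0"
proof -
  note sF = kt_fun_smooth[OF F]
  note per = kt_fun_periodic[OF F]
  have cd: "continuous_on S (\<lambda>x. frechet_derivative F (at x) v)" for v S
    by (rule smooth_continuous[OF smooth_derivative[OF sF]])
  have cF: "continuous_on S F" for S
    by (rule smooth_continuous[OF sF])
  have fld: "fld j F = (\<lambda>x. frechet_derivative F (at x) (axis j 1))" if "j \<noteq> 3" for j
    using that by (simp add: fld_def kt_frame_def fun_eq_iff)
  note int = integral_derivative_pt[OF sF]
  consider "i = 1" | "i = 2" | "i = 3" | "i = 4"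
    using exhaust_4 by blast
  then show ?thesis
  proof cases
    case 1
    have "integral {0..1} (\<lambda>t. frechet_derivative F (at (pt (t, w))) (axis 1 1)) = 0" for w
      using per(1)[of 0] int(1) by (cases w) auto
    then show ?thesis
      by (simp add: 1 fld kt_integral_prod(2)[OF cd])
  next
    \<comment> \<open>The values at x = 1 and x = 0 differ by the shear of z. Their difference
      vanishes only after integration over a full period of z, so x is innermost and z comes
      next.\<close>
    case 2
    have c0: "continuous_on S (\<lambda>z. F (pt (t, 0, y, h z)))" if "continuous_on S h" for S :: "real set" and t y h
      by (rule continuous_on_pt_compose[OF cF]) (intro continuous_intros that)
    have eq: "integral {0..1} (\<lambda>x. frechet_derivative F (at (pt (t, x, y, z))) (axis 2 1)) =
        F (pt (t, 0, y, z - y)) - F (pt (t, 0, y, z))" for t y z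
      using per(2)[of t 0 y "z - y"] int(2) by simp
    have z0: "integral {0..1} (\<lambda>z. F (pt (t, 0, y, z - y)) - F (pt (t, 0, y, z))) = 0" if "y \<in> {0..1}" for t y
    proof -
      have "integral {0..1} (\<lambda>z. F (pt (t, 0, y, z - y)) - F (pt (t, 0, y, z))) =
          integral {0..1} (\<lambda>z. F (pt (t, 0, y, z - y))) - integral {0..1} (\<lambda>z. F (pt (t, 0, y, z)))"
        by (intro integral_diff integrable_continuous_real c0 continuous_intros)
      also have "integral {0..1} (\<lambda>z. F (pt (t, 0, y, z - y))) = integral {0..1} (\<lambda>z. F (pt (t, 0, y, z)))"
        by (rule integral_periodic_shift[of "\<lambda>z. F (pt (t, 0, y, z))"])
          (use that per(4) in \<open>auto intro!: c0 continuous_intros\<close>)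
      finally show ?thesis by simp
    qed
    have "integral (cbox (0, 0) (1, 1)) (\<lambda>w. integral {0..1} (\<lambda>x. frechet_derivative F (at (pt (t, x, w))) (axis 2 1))) = 0" for t
    proof -
      have "integral (cbox (0, 0) (1, 1)) (\<lambda>w. integral {0..1} (\<lambda>x. frechet_derivative F (at (pt (t, x, w))) (axis 2 1)))
        = integral (cbox (0, 0) (1, 1)) (\<lambda>w. F (pt (t, 0, fst w, snd w - fst w)) - F (pt (t, 0, fst w, snd w)))"
        by (rule Henstock_Kurzweil_Integration.integral_cong) (use eq in auto)
      also have "\<dots> = integral {0..1} (\<lambda>y. integral {0..1} (\<lambda>z. F (pt (t, 0, y, z - y)) - F (pt (t, 0, y, z))))"
        by (subst integral_prod_continuous)
          (auto intro!: continuous_intros continuous_on_pt_compose[OF cF])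
      also have "\<dots> = integral {0..1::real} (\<lambda>y. 0)"
        by (rule Henstock_Kurzweil_Integration.integral_cong) (rule z0)
      finally show ?thesis by simp
    qed
    then show ?thesis
      by (simp add: 2 fld kt_integral_prod(3)[OF cd])
  next
    case 3
    \<comment> \<open>The coefficient x of the z-derivative is constant along z and comes out of the
      innermost integral.\<close>
    have 4: "kt_integral (\<lambda>p. complex_of_real (p $ 2) * frechet_derivative F (at p) (axis 4 1)) = 0"
      using per(4)[of _ _ _ 0]
      by (subst kt_integral_prod(4)) (auto intro!: continuous_intros cd simp: int(4))
    have "kt_integral (\<lambda>p. frechet_derivative F (at p) (axis 3 1)) = 0"
      using per(3)[of _ _ 0] by (simp add: kt_integral_prod(5)[OF cd] int(3))
    then show ?thesis
      unfolding 3 fld_eq[OF sF] using 4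
      by (simp, subst kt_integral_add) (auto intro!: continuous_intros cd)
  next
    case 4
    then show ?thesis
      using per(4)[of _ _ _ 0] by (simp add: fld kt_integral_prod(4)[OF cd] int(4))
  qed
qed


section \<open>Energy estimates\<close>

definition ip :: "(vec4 \<Rightarrow> complex) \<Rightarrow> (vec4 \<Rightarrow> complex) \<Rightarrow> complex" where
  "ip F G = kt_integral (\<lambda>x. F x * cnj (G x))"

text \<open>This is the squared L2 norm, as a real number, so that the energy identities can be
  compared by order.\<close>

definition nrm :: "(vec4 \<Rightarrow> complex) \<Rightarrow> real" where
  "nrm F = kt_integral (\<lambda>x. (cmod (F x))\<^sup>2)"

lemma kt_fun_continuous: "kt_fun F \<Longrightarrow> continuous_on S F"
  by (rule smooth_continuous[OF kt_fun_smooth])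

lemma kt_fun_cmult: "kt_fun F \<Longrightarrow> kt_fun (\<lambda>x. c * F x)"
  by (rule kt_fun_mult[OF kt_fun_const])

lemma kt_fun_diff: "kt_fun F \<Longrightarrow> kt_fun G \<Longrightarrow> kt_fun (\<lambda>x. F x - G x)"
  using kt_fun_add[OF _ kt_fun_cmult[of G "-1"]] by simp

lemma kt_fun_uminus: "kt_fun F \<Longrightarrow> kt_fun (\<lambda>x. - F x)"
  using kt_fun_cmult[of F "-1"] by simp

lemmas kt_fun_intros = kt_fun_add kt_fun_diff kt_fun_uminus kt_fun_cmult kt_fun_fld kt_fun_const

lemma kt_fld_add: "kt_fun F \<Longrightarrow> kt_fun G \<Longrightarrow> fld i (\<lambda>x. F x + G x) = (\<lambda>x. fld i F x + fld i G x)"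
  by (simp add: fld_add kt_fun_smooth)

lemma kt_fld_cmult: "kt_fun F \<Longrightarrow> fld i (\<lambda>x. c * F x) = (\<lambda>x. c * fld i F x)"
  by (simp add: fld_cmult kt_fun_smooth)

lemma kt_fld_uminus: "kt_fun F \<Longrightarrow> fld i (\<lambda>x. - F x) = (\<lambda>x. - fld i F x)"
  using kt_fld_cmult[of F i "-1"] by simp

lemma kt_fld_diff: "kt_fun F \<Longrightarrow> kt_fun G \<Longrightarrow> fld i (\<lambda>x. F x - G x) = (\<lambda>x. fld i F x - fld i G x)"
  using kt_fld_add[OF _ kt_fun_uminus[of G], of F i] by (simp add: kt_fld_uminus)

lemmas fld_simps = kt_fld_add kt_fld_diff kt_fld_uminus kt_fld_cmult

lemma ip_continuous: "kt_fun F \<Longrightarrow> kt_fun G \<Longrightarrow> continuous_on S (\<lambda>x. F x * cnj (G x))"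
  by (intro kt_fun_continuous kt_fun_mult kt_fun_cnj)

lemma ip_add_left: "kt_fun F \<Longrightarrow> kt_fun G \<Longrightarrow> kt_fun K \<Longrightarrow> ip (\<lambda>x. F x + G x) K = ip F K + ip G K"
  unfolding ip_def by (simp add: distrib_right kt_integral_add ip_continuous)

lemma ip_cmult_left: "kt_fun F \<Longrightarrow> kt_fun K \<Longrightarrow> ip (\<lambda>x. c * F x) K = c * ip F K"
  unfolding ip_def
  using kt_integral_linear[OF bounded_linear_mult_right ip_continuous, of F K c] by (simp add: mult.assoc)

lemma ip_commute: "kt_fun F \<Longrightarrow> kt_fun G \<Longrightarrow> ip G F = cnj (ip F G)"
  unfolding ip_def
  using kt_integral_linear[OF bounded_linear_cnj ip_continuous, of F G] by (simp add: mult.commute)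

lemma ip_uminus_left: "kt_fun F \<Longrightarrow> kt_fun K \<Longrightarrow> ip (\<lambda>x. - F x) K = - ip F K"
  using ip_cmult_left[of F K "-1"] by simp

lemma ip_diff_left: "kt_fun F \<Longrightarrow> kt_fun G \<Longrightarrow> kt_fun K \<Longrightarrow> ip (\<lambda>x. F x - G x) K = ip F K - ip G K"
  using ip_add_left[of F "\<lambda>x. - G x" K] by (simp add: ip_uminus_left kt_fun_uminus)

lemma ip_add_right: "kt_fun F \<Longrightarrow> kt_fun G \<Longrightarrow> kt_fun K \<Longrightarrow> ip K (\<lambda>x. F x + G x) = ip K F + ip K G"
  by (simp add: ip_commute[of _ K] ip_add_left kt_fun_add)

lemma ip_diff_right: "kt_fun F \<Longrightarrow> kt_fun G \<Longrightarrow> kt_fun K \<Longrightarrow> ip K (\<lambda>x. F x - G x) = ip K F - ip K G"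
  by (simp add: ip_commute[of _ K] ip_diff_left kt_fun_diff)

lemma ip_cmult_right: "kt_fun F \<Longrightarrow> kt_fun K \<Longrightarrow> ip K (\<lambda>x. c * F x) = cnj c * ip K F"
  by (simp add: ip_commute[of _ K] ip_cmult_left kt_fun_cmult)

lemmas ip_simps = ip_add_left ip_diff_left ip_uminus_left ip_cmult_left ip_add_right ip_diff_right ip_cmult_right

lemma ip_fld: "kt_fun F \<Longrightarrow> kt_fun G \<Longrightarrow> ip (fld i F) G = - ip F (fld i G)"
proof -
  assume F: "kt_fun F" and G: "kt_fun G"
  have "0 = kt_integral (fld i (\<lambda>x. F x * cnj (G x)))"
    by (rule kt_integral_fld[OF kt_fun_mult[OF F kt_fun_cnj[OF G]], symmetric])
  also have "fld i (\<lambda>x. F x * cnj (G x)) = (\<lambda>x. F x * cnj (fld i G x) + fld i F x * cnj (G x))"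
    using F G by (simp add: fld_mult fld_cnj kt_fun_smooth kt_fun_cnj)
  also have "kt_integral \<dots> = ip F (fld i G) + ip (fld i F) G"
    unfolding ip_def by (intro kt_integral_add ip_continuous F G kt_fun_fld)
  finally show ?thesis
    by (simp add: add_eq_0_iff)
qed

lemma nrm_continuous: "kt_fun F \<Longrightarrow> continuous_on S (\<lambda>x. (cmod (F x))\<^sup>2)"
  by (intro continuous_intros kt_fun_continuous)

lemma ip_self: "kt_fun F \<Longrightarrow> ip F F = complex_of_real (nrm F)"
  unfolding ip_def nrm_def
  using kt_integral_linear[OF bounded_linear_of_real[where 'a = complex] nrm_continuous, of F]
  by (simp flip: complex_norm_square)

lemma nrm_nonneg: "kt_fun F \<Longrightarrow> 0 \<le> nrm F"
  unfolding nrm_def kt_integral_def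
  by (intro integral_nonneg kt_integrable nrm_continuous) auto

lemma nrm_eq_0:
  assumes F: "kt_fun F" and 0: "nrm F = 0"
  shows "F = (\<lambda>x. 0)"
proof
  fix p :: vec4
  let ?B = "cbox (0, 0, 0, 0) (1, 1, 1, 1) :: (real \<times> real \<times> real \<times> real) set"
  have "(0, 0, 0, 0) + (1 / 2, 1 / 2, 1 / 2, 1 / 2) \<in> box (0, 0, 0, 0) (1 :: real, 1 :: real, 1 :: real, 1 :: real)"
    by (simp add: mem_box Basis_prod_def inner_prod_def ball_Un)
  then have ne: "box (0, 0, 0, 0) (1 :: real, 1 :: real, 1 :: real, 1 :: real) \<noteq> {}"
    by blast
  have "integral ?B (\<lambda>p. (cmod (F (pt p)))\<^sup>2) = 0 \<longleftrightarrow> (\<forall>p\<in>?B. (cmod (F (pt p)))\<^sup>2 = 0)"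
    by (intro integral_cbox_eq_0_iff continuous_on_pt_compose[OF nrm_continuous[OF F]] ne) (auto intro: continuous_intros)
  then have cube: "F (pt q) = 0" if "q \<in> ?B" for q
    using 0 that by (simp add: nrm_def kt_integral_def)
  \<comment> \<open>The lattice element moving p into the cube. Its action adds
    \<open>a $ 2 * p $ 3\<close> to the last coordinate, so that contribution has to be included
    before the last floor is taken.\<close>
  define a where "a = pt (- of_int \<lfloor>p $ 1\<rfloor>, - of_int \<lfloor>p $ 2\<rfloor>, - of_int \<lfloor>p $ 3\<rfloor>,
    - of_int \<lfloor>p $ 4 - of_int \<lfloor>p $ 2\<rfloor> * p $ 3\<rfloor>)"
  have a: "a $ 1 = - of_int \<lfloor>p $ 1\<rfloor>" "a $ 2 = - of_int \<lfloor>p $ 2\<rfloor>" "a $ 3 = - of_int \<lfloor>p $ 3\<rfloor>"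
    "a $ 4 = - of_int \<lfloor>p $ 4 - of_int \<lfloor>p $ 2\<rfloor> * p $ 3\<rfloor>"
    by (simp_all add: a_def)
  then have "a \<in> kt_lattice"
    by (simp add: kt_lattice_def forall_4)
  then have "F p = F (kt_mult a p)"
    using F by (simp add: kt_fun_def)
  also have "\<dots> = F (pt (kt_mult a p $ 1, kt_mult a p $ 2, kt_mult a p $ 3, kt_mult a p $ 4))"
    using pt_surj[of "kt_mult a p"] by simp
  also have "\<dots> = 0"
    by (rule cube) (simp add: kt_mult_nth a, linarith)
  finally show "F p = 0" .
qed

section \<open>Poincare inequalities along circles\<close>

text \<open>As p has mean zero, \<open>p a\<close> is the mean of \<open>p a - p b\<close> over b,
  hence bounded by the L1 norm of the derivative, which is at most its L2 norm. The resulting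
  constant 1 is crude, but it is compensated by taking r small.\<close>

lemma poincare_interval:
  fixes p :: "real \<Rightarrow> complex"
  assumes der: "\<And>s. (p has_vector_derivative p' s) (at s)" and cont: "continuous_on UNIV p'"
    and mean: "integral {0..1} p = 0"
  shows "integral {0..1} (\<lambda>s. (cmod (p s))\<^sup>2) \<le> integral {0..1} (\<lambda>s. (cmod (p' s))\<^sup>2)"
proof -
  define M where "M = integral {0..1} (\<lambda>s. cmod (p' s))"
  have cp: "continuous_on S p" for S
    using der by (meson continuous_at_imp_continuous_on has_vector_derivative_continuous)
  have cp': "continuous_on S p'" for S
    using cont continuous_on_subset by blast
  have diff: "cmod (p b - p a) \<le> M" if "0 \<le> a" "a \<le> b" "b \<le> 1" for a b
  proof -
    have "(p' has_integral (p b - p a)) {a..b}"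
      by (rule fundamental_theorem_of_calculus[OF that(2)]) (rule has_vector_derivative_at_within[OF der])
    then have "cmod (p b - p a) = cmod (integral {a..b} p')"
      by (simp add: integral_unique)
    also have "\<dots> \<le> integral {a..b} (\<lambda>s. cmod (p' s))"
      by (intro integral_norm_bound_integral integrable_continuous_real continuous_intros cp') auto
    also have "\<dots> \<le> M"
      unfolding M_def using that
      by (intro integral_subset_le integrable_continuous_real continuous_intros cp') auto
    finally show ?thesis .
  qed
  have bound: "cmod (p a) \<le> M" if "a \<in> {0..1}" for a
  proof -
    have "integral {0..1} (\<lambda>b. p a - p b) = p a"
      by (subst integral_diff) (auto intro!: integrable_continuous_real cp simp: mean)
    then have "cmod (p a) = cmod (integral {0..1} (\<lambda>b. p a - p b))"
      by simp
    also have "\<dots> \<le> integral {0..1::real} (\<lambda>b. M)"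
    proof (intro integral_norm_bound_integral integrable_continuous_real continuous_intros cp)
      fix b :: real assume "b \<in> {0..1}"
      then show "cmod (p a - p b) \<le> M"
        using diff[of a b] diff[of b a] that by (cases "a \<le> b") (auto simp: norm_minus_commute)
    qed
    finally show ?thesis by simp
  qed
  have "integral {0..1} (\<lambda>s. (cmod (p s))\<^sup>2) \<le> integral {0..1::real} (\<lambda>s. M\<^sup>2)"
    by (intro integral_le integrable_continuous_real continuous_intros cp power_mono bound) auto
  also have "\<dots> = M\<^sup>2"
    by simp
  also have "M\<^sup>2 \<le> integral {0..1} (\<lambda>s. (cmod (p' s))\<^sup>2)"
  proof -
    \<comment> \<open>The Cauchy-Schwarz inequality against the constant 1, obtained by expanding a
      variance.\<close>
    have "0 \<le> integral {0..1} (\<lambda>s. (cmod (p' s) - M)\<^sup>2)"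
      by (intro integral_nonneg integrable_continuous_real continuous_intros cp') auto
    also have "\<dots> = integral {0..1} (\<lambda>s. ((cmod (p' s))\<^sup>2 + M\<^sup>2) - 2 * M * cmod (p' s))"
      by (simp add: power2_diff algebra_simps)
    also have "\<dots> = integral {0..1} (\<lambda>s. (cmod (p' s))\<^sup>2 + M\<^sup>2) - integral {0..1} (\<lambda>s. 2 * M * cmod (p' s))"
      by (intro integral_diff integrable_continuous_real continuous_intros cp')
    also have "integral {0..1} (\<lambda>s. (cmod (p' s))\<^sup>2 + M\<^sup>2) = integral {0..1} (\<lambda>s. (cmod (p' s))\<^sup>2) + integral {0..1::real} (\<lambda>s. M\<^sup>2)"
      by (intro integral_add integrable_continuous_real continuous_intros cp')
    also have "integral {0..1} (\<lambda>s. 2 * M * cmod (p' s)) = 2 * M * M"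
      by (simp add: M_def)
    finally show ?thesis
      by (simp add: power2_eq_square)
  qed
  finally show ?thesis .
qed

text \<open>The parameters are nested as pairs to the left so that
  \<open>continuous_param_integral\<close> can integrate out the last variable at each stage and
  return a continuous function of the others.\<close>

lemma iterated_integral_mono:
  fixes A B :: "real \<Rightarrow> real \<Rightarrow> real \<Rightarrow> real \<Rightarrow> real"
  assumes A: "continuous_on UNIV (\<lambda>(((t, x), y), z). A t x y z)" and B: "continuous_on UNIV (\<lambda>(((t, x), y), z). B t x y z)"
    and le: "\<And>t x y. integral {0..1} (A t x y) \<le> integral {0..1} (B t x y)"
  shows "integral {0..1} (\<lambda>t. integral {0..1} (\<lambda>x. integral {0..1} (\<lambda>y. integral {0..1} (A t x y)))) \<le>
    integral {0..1} (\<lambda>t. integral {0..1} (\<lambda>x. integral {0..1} (\<lambda>y. integral {0..1} (B t x y))))"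
proof -
  have c3: "continuous_on UNIV (\<lambda>((t, x), y). integral {0..1} (G t x y))"
    if "continuous_on UNIV (\<lambda>(((t, x), y), z). G t x y z)" for G :: "real \<Rightarrow> real \<Rightarrow> real \<Rightarrow> real \<Rightarrow> real"
    using continuous_param_integral[of "\<lambda>((t, x), y). G t x y"] that by (simp add: split_def)
  have c2: "continuous_on UNIV (\<lambda>(t, x). integral {0..1} (G t x))"
    if "continuous_on UNIV (\<lambda>((t, x), y). G t x y)" for G :: "real \<Rightarrow> real \<Rightarrow> real \<Rightarrow> real"
    using continuous_param_integral[of "\<lambda>(t, x). G t x"] that by (simp add: split_def)
  have s1: "continuous_on S (G t)" if "continuous_on UNIV (\<lambda>(t, x). G t x)" for G :: "real \<Rightarrow> real \<Rightarrow> real" and t S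
    using continuous_on_compose2[OF that, of S "\<lambda>x. (t, x)"]
      continuous_on_Pair[OF continuous_on_const continuous_on_id, of S t] by auto
  have s2: "continuous_on UNIV (\<lambda>(x, y). G t x y)" if "continuous_on UNIV (\<lambda>((t, x), y). G t x y)" for G :: "real \<Rightarrow> real \<Rightarrow> real \<Rightarrow> real" and t
  proof -
    have "continuous_on UNIV (\<lambda>x :: real \<times> real. ((t, fst x), snd x))"
      by (intro continuous_on_Pair continuous_on_const continuous_on_fst continuous_on_snd continuous_on_id)
    from continuous_on_compose2[OF that this] show ?thesis
      by (simp add: split_def)
  qed
  note i3 = c3[OF A] c3[OF B]
  note i2 = c2[OF i3(1)] c2[OF i3(2)]
  note i1 = continuous_param_integral[OF i2(1)] continuous_param_integral[OF i2(2)]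
  show ?thesis
    by (intro integral_le integrable_continuous_real s1[OF s2[OF i3(1)]] s1[OF s2[OF i3(2)]]
        s1[OF i2(1)] s1[OF i2(2)] continuous_on_subset[OF i1(1)] continuous_on_subset[OF i1(2)] le) auto
qed

text \<open>The inequality is for a derivative and not for F itself: along each z-circle the
  derivative of a periodic function has mean zero.\<close>

lemma poincare_4:
  assumes F: "kt_fun F"
  shows "nrm (fld 4 F) \<le> nrm (fld 4 (fld 4 F))"
proof -
  have fld: "fld 4 G = (\<lambda>x. frechet_derivative G (at x) (axis 4 1))" for G
    by (simp add: fld_def kt_frame_def fun_eq_iff)
  let ?u = "fld 4 F"
  note u = kt_fun_fld[OF F, of 4] and uu = kt_fun_fld[OF kt_fun_fld[OF F, of 4], of 4]
  have le: "integral {0..1} (\<lambda>z. (cmod (?u (pt (t, x, y, z))))\<^sup>2) \<le> integral {0..1} (\<lambda>z. (cmod (fld 4 ?u (pt (t, x, y, z))))\<^sup>2)" for t x y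
  proof (rule poincare_interval)
    show "((\<lambda>z. ?u (pt (t, x, y, z))) has_vector_derivative fld 4 ?u (pt (t, x, y, z))) (at z)" for z
      using smooth_has_vector_derivative_line[OF kt_fun_smooth[OF u], of "pt (t, x, y, 0)" "axis 4 1" z]
      unfolding pt_shift(4)[of t x y, symmetric] by (simp add: fld)
    show "continuous_on UNIV (\<lambda>z. fld 4 ?u (pt (t, x, y, z)))"
      by (rule continuous_on_pt_compose[OF kt_fun_continuous[OF uu]]) (auto intro!: continuous_on_Pair continuous_on_const continuous_on_id)
    show "integral {0..1} (\<lambda>z. ?u (pt (t, x, y, z))) = 0"
      using integral_derivative_pt(4)[OF kt_fun_smooth[OF F]] kt_fun_periodic(4)[OF F, of t x y 0] by (simp add: fld)
  qed
  show ?thesis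
    unfolding nrm_def kt_integral_prod(4)[OF nrm_continuous[OF u]] kt_integral_prod(4)[OF nrm_continuous[OF uu]]
    by (intro iterated_integral_mono le)
      (auto simp: split_def intro!: continuous_intros continuous_on_pt_compose[OF nrm_continuous[OF u]]
        continuous_on_pt_compose[OF nrm_continuous[OF uu]])
qed

text \<open>Without dependence on z the third frame field is the plain y-derivative, along which F
  is periodic.\<close>

lemma poincare_3:
  assumes F: "kt_fun F" and F4: "fld 4 F = (\<lambda>x. 0)"
  shows "nrm (fld 3 F) \<le> nrm (fld 3 (fld 3 F))"
proof -
  have fld: "fld 3 G = (\<lambda>x. frechet_derivative G (at x) (axis 3 1))" if "fld 4 G = (\<lambda>x. 0)" "kt_fun G" for G
    using that(1) fld_eq[OF kt_fun_smooth[OF that(2)], of 3] fld_eq[OF kt_fun_smooth[OF that(2)], of 4]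
    by (simp add: fun_eq_iff)
  let ?u = "fld 3 F"
  note u = kt_fun_fld[OF F, of 3] and uu = kt_fun_fld[OF kt_fun_fld[OF F, of 3], of 3]
  have u4: "fld 4 ?u = (\<lambda>x. 0)"
    using fld_commute[OF kt_fun_smooth[OF F], of 4 3] F4 by (simp add: fld_const)
  have le: "integral {0..1} (\<lambda>y. (cmod (?u (pt (t, x, y, z))))\<^sup>2) \<le> integral {0..1} (\<lambda>y. (cmod (fld 3 ?u (pt (t, x, y, z))))\<^sup>2)" for t x z
  proof (rule poincare_interval)
    show "((\<lambda>y. ?u (pt (t, x, y, z))) has_vector_derivative fld 3 ?u (pt (t, x, y, z))) (at y)" for y
      using smooth_has_vector_derivative_line[OF kt_fun_smooth[OF u], of "pt (t, x, 0, z)" "axis 3 1" y]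
      unfolding pt_shift(3)[of t x _ z, symmetric] by (simp add: fld[OF u4 u])
    show "continuous_on UNIV (\<lambda>y. fld 3 ?u (pt (t, x, y, z)))"
      by (rule continuous_on_pt_compose[OF kt_fun_continuous[OF uu]]) (auto intro!: continuous_on_Pair continuous_on_const continuous_on_id)
    show "integral {0..1} (\<lambda>y. ?u (pt (t, x, y, z))) = 0"
      using integral_derivative_pt(3)[OF kt_fun_smooth[OF F]] kt_fun_periodic(3)[OF F, of t x 0 z]
      by (simp add: fld[OF F4 F])
  qed
  show ?thesis
    unfolding nrm_def kt_integral_prod(5)[OF nrm_continuous[OF u]] kt_integral_prod(5)[OF nrm_continuous[OF uu]]
    by (intro iterated_integral_mono le)
      (auto simp: split_def intro!: continuous_intros continuous_on_pt_compose[OF nrm_continuous[OF u]]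
        continuous_on_pt_compose[OF nrm_continuous[OF uu]])
qed

section \<open>The first order system for harmonic (0,1)-forms\<close>

text \<open>The shape of the complex vector fields dual to the coframe of J. In
  \<open>kt_system\<close> below, \<open>V1\<close>, \<open>V2\<close> are dual to
  \<open>dt + \<i> dx\<close>, \<open>dy + \<i> \<beta> (dz - x dy)\<close>, and \<open>V1b\<close>,
  \<open>V2b\<close> to their conjugates.\<close>

definition cfld :: "4 \<Rightarrow> 4 \<Rightarrow> complex \<Rightarrow> (vec4 \<Rightarrow> complex) \<Rightarrow> vec4 \<Rightarrow> complex" where
  "cfld i j a F = (\<lambda>x. 1 / 2 * (fld i F x + a * fld j F x))"

lemma kt_fun_cfld: "kt_fun F \<Longrightarrow> kt_fun (cfld i j a F)"
  unfolding cfld_def by (intro kt_fun_intros)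

lemma ip_cfld: "kt_fun F \<Longrightarrow> kt_fun G \<Longrightarrow> ip (cfld i j a F) G = - ip F (cfld i j (cnj a) G)"
  unfolding cfld_def by (simp only: ip_simps ip_fld kt_fun_intros; simp add: algebra_simps)

text \<open>
  The pair \<open>f, h\<close> stands for the (0,1)-form \<open>f \<phi>\<^sub>1 + h \<phi>\<^sub>2\<close> where \<open>\<phi>\<^sub>1, \<phi>\<^sub>2\<close> are the conjugates of
  \<open>dt + \<i> dx\<close> and \<open>dy + \<i> \<beta> (dz - x dy)\<close>.
\<close>

locale kt_system =
  fixes \<beta> r :: real
  assumes \<beta>: "\<beta> > 0" and r: "r > 0"
begin

abbreviation V1 where "V1 \<equiv> cfld 1 2 (- \<i>)"
abbreviation V1b where "V1b \<equiv> cfld 1 2 \<i>"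
abbreviation V2 where "V2 \<equiv> cfld 3 4 (- (\<i> / \<beta>))"
abbreviation V2b where "V2b \<equiv> cfld 3 4 (\<i> / \<beta>)"

text \<open>Up to the factor -2 this is \<open>delbar_star\<close> on (0,1)-forms, as
  \<open>delbar_star_form01\<close> shows. The weight is the ratio of the squared lengths of the two
  basic (0,1)-covectors, and is the only place where r enters the system.\<close>

definition codiff :: "(vec4 \<Rightarrow> complex) \<Rightarrow> (vec4 \<Rightarrow> complex) \<Rightarrow> vec4 \<Rightarrow> complex" where
  "codiff f h = (\<lambda>x. V1 f x + complex_of_real (1 / r\<^sup>2) * V2 h x)"

text \<open>The coefficient of the (0,2)-form \<open>delbar\<close> of the pair, see
  \<open>delbar_form01\<close>. Its zeroth order term is the (0,2) part of the differential of the
  second basic covector.\<close>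

definition curl :: "(vec4 \<Rightarrow> complex) \<Rightarrow> (vec4 \<Rightarrow> complex) \<Rightarrow> vec4 \<Rightarrow> complex" where
  "curl f h = (\<lambda>x. V1b h x - V2b f x - complex_of_real (\<beta> / 4) * h x)"

lemma kt_fun_codiff: "kt_fun f \<Longrightarrow> kt_fun h \<Longrightarrow> kt_fun (codiff f h)"
  unfolding codiff_def by (intro kt_fun_intros kt_fun_cfld)

lemma kt_fun_curl: "kt_fun f \<Longrightarrow> kt_fun h \<Longrightarrow> kt_fun (curl f h)"
  unfolding curl_def by (intro kt_fun_intros kt_fun_cfld)

text \<open>The usual argument that a harmonic form is annihilated by \<open>delbar\<close> and its
  adjoint, written in coefficients: pairing the two equations with f and h gives the sum of the
  squared norms of \<open>codiff f h\<close> and, with weight \<open>1 / r\<^sup>2\<close>, of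
  \<open>curl f h\<close>.\<close>

lemma laplace_imp_first_order:
  assumes f: "kt_fun f" and h: "kt_fun h"
    and 1: "\<And>x. V1b (codiff f h) x = complex_of_real (1 / r\<^sup>2) * V2 (curl f h) x"
    and 2: "\<And>x. V2b (codiff f h) x + V1 (curl f h) x + complex_of_real (\<beta> / 4) * curl f h x = 0"
  shows "codiff f h = (\<lambda>x. 0)" "curl f h = (\<lambda>x. 0)"
proof -
  define A where "A = codiff f h"
  define b where "b = curl f h"
  have A: "kt_fun A" and b: "kt_fun b"
    unfolding A_def b_def by (intro kt_fun_codiff kt_fun_curl f h)+
  note kt = A b f h kt_fun_intros kt_fun_cfld
  have e1: "V1b A = (\<lambda>x. complex_of_real (1 / r\<^sup>2) * V2 b x)"
    unfolding A_def b_def by (rule ext) (rule 1)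
  have e2: "V2b A = (\<lambda>x. - V1 b x - complex_of_real (\<beta> / 4) * b x)"
    using 2 by (simp add: A_def b_def fun_eq_iff add_eq_0_iff algebra_simps)
  have "ip A A = ip A (\<lambda>x. V1 f x + complex_of_real (1 / r\<^sup>2) * V2 h x)"
    by (simp add: A_def codiff_def)
  also have "\<dots> = ip A (V1 f) + complex_of_real (1 / r\<^sup>2) * ip A (V2 h)"
    by (simp only: ip_simps kt; simp)
  also have "ip A (V1 f) = - ip (V1b A) f"
    using ip_cfld[OF A f, of 1 2 "\<i>"] by simp
  also have "ip A (V2 h) = - ip (V2b A) h"
    using ip_cfld[OF A h, of 3 4 "\<i> / \<beta>"] by simp
  finally have AA: "ip A A = - complex_of_real (1 / r\<^sup>2) * ip (V2 b) f
      + complex_of_real (1 / r\<^sup>2) * (ip (V1 b) h + complex_of_real (\<beta> / 4) * ip b h)"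
    unfolding e1 e2 by (simp only: ip_simps kt; simp add: algebra_simps)
  have "ip b b = ip b (\<lambda>x. V1b h x - V2b f x - complex_of_real (\<beta> / 4) * h x)"
    by (simp add: b_def curl_def)
  also have "\<dots> = ip b (V1b h) - ip b (V2b f) - complex_of_real (\<beta> / 4) * ip b h"
    by (simp only: ip_simps kt; simp)
  also have "ip b (V1b h) = - ip (V1 b) h"
    using ip_cfld[OF b h, of 1 2 "- \<i>"] by simp
  also have "ip b (V2b f) = - ip (V2 b) f"
    using ip_cfld[OF b f, of 3 4 "- (\<i> / \<beta>)"] by simp
  finally have bb: "ip b b = - ip (V1 b) h + ip (V2 b) f - complex_of_real (\<beta> / 4) * ip b h"
    by simp
  have "ip A A + complex_of_real (1 / r\<^sup>2) * ip b b = 0"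
    unfolding AA bb by (simp add: algebra_simps)
  then have "complex_of_real (nrm A + 1 / r\<^sup>2 * nrm b) = 0"
    by (simp add: ip_self A b)
  then have "nrm A + 1 / r\<^sup>2 * nrm b = 0"
    by (simp only: of_real_eq_0_iff)
  moreover have "0 \<le> nrm A" "0 \<le> 1 / r\<^sup>2 * nrm b"
    using nrm_nonneg[OF A] nrm_nonneg[OF b] by simp_all
  ultimately have "nrm A = 0" "1 / r\<^sup>2 * nrm b = 0"
    by linarith+
  then have "A = (\<lambda>x. 0)" "b = (\<lambda>x. 0)"
    using r nrm_eq_0[OF A] nrm_eq_0[OF b] by simp_all
  then show "codiff f h = (\<lambda>x. 0)" "curl f h = (\<lambda>x. 0)"
    by (simp_all add: A_def b_def)
qed

text \<open>The t-field and the z-field are central in the Lie algebra of the frame, so they commute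
  with every operator in the system.\<close>

lemma first_order_fld:
  assumes f: "kt_fun f" and h: "kt_fun h" and i: "i = 1 \<or> i = 4"
    and 1: "codiff f h = (\<lambda>x. 0)" and 2: "curl f h = (\<lambda>x. 0)"
  shows "codiff (fld i f) (fld i h) = (\<lambda>x. 0)" "curl (fld i f) (fld i h) = (\<lambda>x. 0)"
proof -
  note kt = f h kt_fun_intros kt_fun_cfld
  have comm: "cfld k l a (fld i F) = fld i (cfld k l a F)" if "kt_fun F" for k l a F
  proof -
    have c: "fld k (fld i F) = fld i (fld k F)" "fld l (fld i F) = fld i (fld l F)"
      using fld_commute[OF kt_fun_smooth[OF that], of k i] fld_commute[OF kt_fun_smooth[OF that], of l i] i
      by auto
    show ?thesis
      unfolding cfld_def using that by (simp only: c fld_simps kt_fun_intros)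
  qed
  have "codiff (fld i f) (fld i h) = fld i (codiff f h)"
    unfolding codiff_def by (simp only: comm fld_simps kt)
  then show "codiff (fld i f) (fld i h) = (\<lambda>x. 0)"
    by (simp add: 1 fld_const)
  have "curl (fld i f) (fld i h) = fld i (curl f h)"
    unfolding curl_def by (simp only: comm fld_simps kt)
  then show "curl (fld i f) (fld i h) = (\<lambda>x. 0)"
    by (simp add: 2 fld_const)
qed

text \<open>
  The \<open>x\<close>-derivative of \<open>f cnj f' - h cnj h' / r\<^sup>2\<close> has integral zero; expressing it by the two equations
  leaves only the \<open>t\<close>-derivatives.
\<close>

lemma first_order_ip:
  assumes f: "kt_fun f" and h: "kt_fun h" and f': "kt_fun f'" and h': "kt_fun h'"
    and 1: "codiff f h = (\<lambda>x. 0)" and 2: "curl f h = (\<lambda>x. 0)"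
    and 3: "codiff f' h' = (\<lambda>x. 0)" and 4: "curl f' h' = (\<lambda>x. 0)"
  shows "ip (fld 1 f) f' + complex_of_real (1 / r\<^sup>2) * ip (fld 1 h) h' = 0"
proof -
  note kt = f h f' h' kt_fun_intros kt_fun_cfld
  have V1: "V1 f = (\<lambda>x. complex_of_real (- (1 / r\<^sup>2)) * V2 h x)" if "codiff f h = (\<lambda>x. 0)" for f h
    using that by (simp add: codiff_def fun_eq_iff add_eq_0_iff)
  have V1b: "V1b h = (\<lambda>x. V2b f x + complex_of_real (\<beta> / 4) * h x)" if "curl f h = (\<lambda>x. 0)" for f h
    using that by (simp add: curl_def fun_eq_iff algebra_simps)
  have split: "fld 1 F = (\<lambda>x. V1 F x + V1b F x)" for F
    by (simp add: cfld_def fun_eq_iff field_simps)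
  have a1: "ip (V1b F) G = - ip F (V1 G)" "ip (V1 F) G = - ip F (V1b G)"
    "ip (V2b F) G = - ip F (V2 G)" if "kt_fun F" "kt_fun G" for F G
    using ip_cfld[OF that] by simp_all
  have "ip (fld 1 f) f' = ip (V1 f) f' - ip f (V1 f')"
    unfolding split[of f] by (simp only: ip_simps kt a1(1); simp)
  also have "\<dots> = complex_of_real (1 / r\<^sup>2) * (ip f (V2 h') - ip (V2 h) f')"
    unfolding V1[OF 1] V1[OF 3] by (simp only: ip_simps kt; simp add: algebra_simps)
  finally have ff: "ip (fld 1 f) f' = complex_of_real (1 / r\<^sup>2) * (ip f (V2 h') - ip (V2 h) f')" .
  have "ip (fld 1 h) h' = ip (V1b h) h' - ip h (V1b h')"
    unfolding split[of h] by (simp only: ip_simps kt a1(2); simp)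
  also have "\<dots> = ip (V2b f) h' - ip h (V2b f')"
    unfolding V1b[OF 2] V1b[OF 4] by (simp only: ip_simps kt; simp add: algebra_simps)
  also have "ip h (V2b f') = - ip (V2 h) f'"
    using ip_cfld[OF h f', of 3 4 "- (\<i> / \<beta>)"] by simp
  finally have hh: "ip (fld 1 h) h' = ip (V2 h) f' - ip f (V2 h')"
    by (simp add: a1 kt)
  show ?thesis
    unfolding ff hh by (simp add: algebra_simps)
qed

text \<open>The t-derivatives solve the system again, so they may serve as the second pair in
  \<open>first_order_ip\<close>, which then becomes a vanishing sum of squared norms.\<close>

lemma first_order_fld_1:
  assumes f: "kt_fun f" and h: "kt_fun h"
    and 1: "codiff f h = (\<lambda>x. 0)" and 2: "curl f h = (\<lambda>x. 0)"
  shows "fld 1 f = (\<lambda>x. 0)" "fld 1 h = (\<lambda>x. 0)"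
proof -
  note kt = f h kt_fun_intros
  have "ip (fld 1 f) (fld 1 f) + complex_of_real (1 / r\<^sup>2) * ip (fld 1 h) (fld 1 h) = 0"
    by (intro first_order_ip first_order_fld 1 2 kt) auto
  then have "complex_of_real (nrm (fld 1 f) + 1 / r\<^sup>2 * nrm (fld 1 h)) = 0"
    by (simp add: ip_self kt)
  then have "nrm (fld 1 f) + 1 / r\<^sup>2 * nrm (fld 1 h) = 0"
    by (simp only: of_real_eq_0_iff)
  moreover have "0 \<le> nrm (fld 1 f)" "0 \<le> 1 / r\<^sup>2 * nrm (fld 1 h)"
    using nrm_nonneg[of "fld 1 f"] nrm_nonneg[of "fld 1 h"] by (simp_all add: kt)
  ultimately have "nrm (fld 1 f) = 0" "1 / r\<^sup>2 * nrm (fld 1 h) = 0"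
    by linarith+
  then show "fld 1 f = (\<lambda>x. 0)" "fld 1 h = (\<lambda>x. 0)"
    using r nrm_eq_0[of "fld 1 f"] nrm_eq_0[of "fld 1 h"] by (simp_all add: kt)
qed

end

text \<open>
  The operators \<open>fld 2 + \<i> \<beta>/4 \<plusminus> (\<i>/r) fld 3\<close> are, up to sign, adjoint to each other; so \<open>s\<close> satisfies
  a second order equation whose right-hand side is negative as soon as \<open>fld 4 s\<close> is large against \<open>s\<close>.
\<close>

lemma dirac_energy:
  fixes \<beta> r q :: real
  assumes s: "kt_fun s" and d: "kt_fun d"
    and 1: "\<And>x. fld 2 s x + \<i> * complex_of_real (\<beta> / 4) * s x + \<i> * complex_of_real (1 / r) * fld 3 s x =
      complex_of_real q * fld 4 d x + \<i> * complex_of_real (\<beta> / 4) * d x"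
    and 2: "\<And>x. fld 2 d x + \<i> * complex_of_real (\<beta> / 4) * d x - \<i> * complex_of_real (1 / r) * fld 3 d x =
      - complex_of_real q * fld 4 s x + \<i> * complex_of_real (\<beta> / 4) * s x"
  shows "q\<^sup>2 * nrm (fld 4 s) \<le> \<beta>\<^sup>2 / 16 * nrm s"
    and "fld 4 s = (\<lambda>x. 0) \<Longrightarrow> fld 4 d = (\<lambda>x. 0) \<Longrightarrow> (1 / r)\<^sup>2 * nrm (fld 3 s) \<le> \<beta>\<^sup>2 / 16 * nrm s"
proof -
  define b where "b = \<i> * complex_of_real (\<beta> / 4)"
  define k where "k = \<i> * complex_of_real (1 / r)"
  define Q where "Q = complex_of_real q"
  have cn: "cnj b = - b" "cnj k = - k" "cnj Q = Q"
    by (simp_all add: b_def k_def Q_def)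
  have sq: "b * b = - complex_of_real (\<beta>\<^sup>2 / 16)" "k * k = - complex_of_real ((1 / r)\<^sup>2)" "Q * Q = complex_of_real (q\<^sup>2)"
    by (simp_all add: b_def k_def Q_def power2_eq_square complex_eq_iff)
  note kt = s d kt_fun_intros
  define D where "D F = (\<lambda>x. fld 2 F x + b * F x + k * fld 3 F x)" for F
  define D' where "D' F = (\<lambda>x. fld 2 F x + b * F x - k * fld 3 F x)" for F
  define Z where "Z F = (\<lambda>x. Q * fld 4 F x + b * F x)" for F
  define Z' where "Z' F = (\<lambda>x. b * F x - Q * fld 4 F x)" for F
  have e1: "D s = Z d" and e2: "D' d = Z' s"
    using 1 2 by (simp_all only: D_def D'_def Z_def Z'_def b_def k_def Q_def fun_eq_iff) (simp_all add: algebra_simps)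
  have kD: "kt_fun (D F)" "kt_fun (D' F)" "kt_fun (Z F)" "kt_fun (Z' F)" if "kt_fun F" for F
    unfolding D_def D'_def Z_def Z'_def by (intro that kt_fun_intros)+
  have adj: "ip (D' F) G = - ip F (D G)" if "kt_fun F" "kt_fun G" for F G
    using that unfolding D_def D'_def by (simp only: ip_simps ip_fld kt cn; simp add: algebra_simps)
  have comm: "D' (Z F) = Z (D' F)" if "kt_fun F" for F
  proof -
    have c: "fld 2 (fld 4 F) = fld 4 (fld 2 F)" "fld 3 (fld 4 F) = fld 4 (fld 3 F)"
      using fld_commute[OF kt_fun_smooth[OF that]] by simp_all
    show ?thesis
      unfolding D'_def Z_def using that
      by (simp only: fld_simps kt_fun_intros c) (simp add: fun_eq_iff algebra_simps)
  qed
  have ZZ: "Z (Z' s) = (\<lambda>x. b * b * s x - Q * Q * fld 4 (fld 4 s) x)"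
    unfolding Z_def Z'_def by (simp only: fld_simps kt) (simp add: fun_eq_iff algebra_simps)
  \<comment> \<open>This eliminates d: applying \<open>D'\<close> to \<open>D s = Z d\<close> and
    commuting it past \<open>Z\<close> gives \<open>Z (D' d) = Z (Z' s)\<close>.\<close>
  have DD: "D' (D s) = (\<lambda>x. b * b * s x - Q * Q * fld 4 (fld 4 s) x)"
    by (simp only: e1 comm[OF d] e2 ZZ)
  have pos: "ip (D' (D s)) s = - complex_of_real (nrm (D s))"
    by (simp add: adj kD s ip_self)
  have "ip (D' (D s)) s = b * b * ip s s - Q * Q * ip (fld 4 (fld 4 s)) s"
    unfolding DD by (simp only: ip_simps kt)
  also have "ip (fld 4 (fld 4 s)) s = - complex_of_real (nrm (fld 4 s))"
    by (simp only: ip_fld kt ip_self)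
  finally have "complex_of_real (nrm (D s)) = complex_of_real (\<beta>\<^sup>2 / 16 * nrm s - q\<^sup>2 * nrm (fld 4 s))"
    unfolding pos by (simp only: ip_self[OF s] sq) (simp add: algebra_simps)
  then have "nrm (D s) = \<beta>\<^sup>2 / 16 * nrm s - q\<^sup>2 * nrm (fld 4 s)"
    by (simp only: of_real_eq_iff)
  with nrm_nonneg[OF kD(1)[OF s]] show "q\<^sup>2 * nrm (fld 4 s) \<le> \<beta>\<^sup>2 / 16 * nrm s"
    by simp
  assume s4: "fld 4 s = (\<lambda>x. 0)" and d4: "fld 4 d = (\<lambda>x. 0)"
  \<comment> \<open>Once the z-derivatives vanish, the second and third fields commute on s, so
    \<open>D' (D s)\<close> splits into the square of the skew-adjoint operator \<open>W\<close> and
    a pure y-part. Both contribute with the same sign to the energy.\<close>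
  define W where "W F = (\<lambda>x. fld 2 F x + b * F x)" for F
  have kW: "kt_fun (W F)" if "kt_fun F" for F
    unfolding W_def by (intro that kt_fun_intros)
  have adjW: "ip (W F) G = - ip F (W G)" if "kt_fun F" "kt_fun G" for F G
    using that unfolding W_def by (simp only: ip_simps ip_fld kt cn; simp add: algebra_simps)
  have c23: "fld 2 (fld 3 s) = fld 3 (fld 2 s)"
    using fld_2_3[OF kt_fun_smooth[OF s]] s4 by (simp add: fun_eq_iff)
  have "D' (D s) = (\<lambda>x. W (W s) x - k * k * fld 3 (fld 3 s) x)"
    unfolding D_def D'_def W_def
    by (simp only: fld_simps kt c23) (simp add: fun_eq_iff algebra_simps)
  then have "ip (D' (D s)) s = ip (W (W s)) s - k * k * ip (fld 3 (fld 3 s)) s"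
    by (simp only: ip_simps kt kW)
  also have "ip (W (W s)) s = - complex_of_real (nrm (W s))"
    by (simp only: adjW kW s ip_self)
  also have "ip (fld 3 (fld 3 s)) s = - complex_of_real (nrm (fld 3 s))"
    by (simp only: ip_fld kt ip_self)
  finally have "ip (D' (D s)) s = - complex_of_real (nrm (W s) + (1 / r)\<^sup>2 * nrm (fld 3 s))"
    by (simp only: sq) (simp add: algebra_simps)
  moreover have "ip (D' (D s)) s = - complex_of_real (\<beta>\<^sup>2 / 16 * nrm s)"
    unfolding DD s4 fld_const
    by (simp only: mult_zero_right diff_zero ip_simps kt ip_self sq) simp
  ultimately have "complex_of_real (nrm (W s) + (1 / r)\<^sup>2 * nrm (fld 3 s)) = complex_of_real (\<beta>\<^sup>2 / 16 * nrm s)"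
    by (metis neg_equal_iff_equal)
  then have "nrm (W s) + (1 / r)\<^sup>2 * nrm (fld 3 s) = \<beta>\<^sup>2 / 16 * nrm s"
    by (simp only: of_real_eq_iff)
  with nrm_nonneg[OF kW[OF s]] show "(1 / r)\<^sup>2 * nrm (fld 3 s) \<le> \<beta>\<^sup>2 / 16 * nrm s"
    by linarith
qed

lemma nonpos_if_mult_le: "a < b \<Longrightarrow> b * n \<le> a * n \<Longrightarrow> n \<le> 0" for a b n :: real
  by (auto simp: mult_le_cancel_right)

text \<open>The energy estimate is applied to derivatives of s and d because the Poincare inequality
  needs mean zero along circles, which s and d themselves need not have.\<close>

lemma dirac_zero:
  fixes \<beta> r q :: real
  assumes s: "kt_fun s" and d: "kt_fun d"
    and 1: "\<And>x. fld 2 s x + \<i> * complex_of_real (\<beta> / 4) * s x + \<i> * complex_of_real (1 / r) * fld 3 s x =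
      complex_of_real q * fld 4 d x + \<i> * complex_of_real (\<beta> / 4) * d x"
    and 2: "\<And>x. fld 2 d x + \<i> * complex_of_real (\<beta> / 4) * d x - \<i> * complex_of_real (1 / r) * fld 3 d x =
      - complex_of_real q * fld 4 s x + \<i> * complex_of_real (\<beta> / 4) * s x"
  shows "q\<^sup>2 > \<beta>\<^sup>2 / 16 \<Longrightarrow> fld 4 s = (\<lambda>x. 0)"
    and "fld 4 s = (\<lambda>x. 0) \<Longrightarrow> fld 4 d = (\<lambda>x. 0) \<Longrightarrow> (1 / r)\<^sup>2 > \<beta>\<^sup>2 / 16 \<Longrightarrow> fld 3 s = (\<lambda>x. 0)"
proof -
  define b where "b = \<i> * complex_of_real (\<beta> / 4)"
  define k where "k = \<i> * complex_of_real (1 / r)"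
  define Q where "Q = complex_of_real q"
  note kt = s d kt_fun_intros
  have e1: "(\<lambda>x. fld 2 s x + b * s x + k * fld 3 s x) = (\<lambda>x. Q * fld 4 d x + b * d x)"
    and e2: "(\<lambda>x. fld 2 d x + b * d x - k * fld 3 d x) = (\<lambda>x. - Q * fld 4 s x + b * s x)"
    using 1 2 by (simp_all only: b_def k_def Q_def fun_eq_iff) (simp_all add: algebra_simps)
  have fld1: "fld 2 (fld i s) x + b * fld i s x + k * fld 3 (fld i s) x = Q * fld 4 (fld i d) x + b * fld i d x"
    and fld2: "fld 2 (fld i d) x + b * fld i d x - k * fld 3 (fld i d) x = - Q * fld 4 (fld i s) x + b * fld i s x"
    if i: "i = 4 \<or> i = 3 \<and> fld 4 s = (\<lambda>x. 0) \<and> fld 4 d = (\<lambda>x. 0)" for i x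
  proof -
    \<comment> \<open>Differentiating the system in the third direction is allowed only after the
      z-derivative has vanished, since that is the commutator with the second field.\<close>
    have "fld 2 (fld i F) = fld i (fld 2 F)" if "kt_fun F" "i = 4 \<or> i = 3 \<and> fld 4 F = (\<lambda>x. 0)" for F
      using that(2)
    proof (elim disjE conjE)
      assume "i = 4"
      then show ?thesis
        using fld_commute[OF kt_fun_smooth[OF that(1)], of 2 4] by simp
    next
      assume "i = 3" "fld 4 F = (\<lambda>x. 0)"
      then show ?thesis
        using fld_2_3[OF kt_fun_smooth[OF that(1)]] by auto
    qed
    moreover have "fld 3 (fld i F) = fld i (fld 3 F)" "fld 4 (fld i F) = fld i (fld 4 F)" if "kt_fun F" for F
      using fld_commute[OF kt_fun_smooth[OF that]] i by auto
    ultimately have c: "fld 2 (fld i s) = fld i (fld 2 s)" "fld 3 (fld i s) = fld i (fld 3 s)" "fld 4 (fld i s) = fld i (fld 4 s)"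
      "fld 2 (fld i d) = fld i (fld 2 d)" "fld 3 (fld i d) = fld i (fld 3 d)" "fld 4 (fld i d) = fld i (fld 4 d)"
      using s d i by auto
    show "fld 2 (fld i s) x + b * fld i s x + k * fld 3 (fld i s) x = Q * fld 4 (fld i d) x + b * fld i d x"
      unfolding c using arg_cong[OF e1, of "fld i"] by (simp only: fld_simps kt fun_eq_iff)
    show "fld 2 (fld i d) x + b * fld i d x - k * fld 3 (fld i d) x = - Q * fld 4 (fld i s) x + b * fld i s x"
      unfolding c using arg_cong[OF e2, of "fld i"] by (simp only: fld_simps kt fun_eq_iff)
  qed
  {
    assume q: "q\<^sup>2 > \<beta>\<^sup>2 / 16"
    have "q\<^sup>2 * nrm (fld 4 (fld 4 s)) \<le> \<beta>\<^sup>2 / 16 * nrm (fld 4 s)"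
      by (rule dirac_energy(1)[OF kt_fun_fld[OF s] kt_fun_fld[OF d]
            fld1[OF disjI1[OF refl], unfolded b_def k_def Q_def] fld2[OF disjI1[OF refl], unfolded b_def k_def Q_def]])
    also have "\<dots> \<le> \<beta>\<^sup>2 / 16 * nrm (fld 4 (fld 4 s))"
      by (intro mult_left_mono poincare_4 s) simp
    finally have "nrm (fld 4 (fld 4 s)) \<le> 0"
      by (rule nonpos_if_mult_le[OF q])
    then have "nrm (fld 4 s) = 0"
      using poincare_4[OF s] nrm_nonneg[OF kt_fun_fld[OF s, of 4]] by linarith
    then show "fld 4 s = (\<lambda>x. 0)"
      by (rule nrm_eq_0[OF kt_fun_fld[OF s]])
  }
  assume s4: "fld 4 s = (\<lambda>x. 0)" and d4: "fld 4 d = (\<lambda>x. 0)" and q: "(1 / r)\<^sup>2 > \<beta>\<^sup>2 / 16"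
  have p3: "(3 :: 4) = 4 \<or> (3 :: 4) = 3 \<and> fld 4 s = (\<lambda>x. 0) \<and> fld 4 d = (\<lambda>x. 0)"
    using s4 d4 by simp
  have "fld 4 (fld 3 s) = (\<lambda>x. 0)" "fld 4 (fld 3 d) = (\<lambda>x. 0)"
    using fld_commute[OF kt_fun_smooth, of _ 4 3] s d s4 d4 by (simp_all add: fld_const)
  then have "(1 / r)\<^sup>2 * nrm (fld 3 (fld 3 s)) \<le> \<beta>\<^sup>2 / 16 * nrm (fld 3 s)"
    by (rule dirac_energy(2)[OF kt_fun_fld[OF s] kt_fun_fld[OF d]
          fld1[OF p3, unfolded b_def k_def Q_def] fld2[OF p3, unfolded b_def k_def Q_def]])
  also have "\<dots> \<le> \<beta>\<^sup>2 / 16 * nrm (fld 3 (fld 3 s))"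
    by (intro mult_left_mono poincare_3 s s4) simp
  finally have "nrm (fld 3 (fld 3 s)) \<le> 0"
    by (rule nonpos_if_mult_le[OF q])
  then have "nrm (fld 3 s) = 0"
    using poincare_3[OF s s4] nrm_nonneg[OF kt_fun_fld[OF s, of 3]] by linarith
  then show "fld 3 s = (\<lambda>x. 0)"
    by (rule nrm_eq_0[OF kt_fun_fld[OF s]])
qed

lemma smooth_eq_const:
  assumes f: "smooth f" and 0: "\<And>i. fld i f = (\<lambda>x. 0)"
  shows "f x = f y"
proof -
  have "(f has_derivative (\<lambda>v. 0)) (at x)" for x
  proof -
    have "frechet_derivative f (at x) = (\<lambda>v. 0)"
      by (rule ext) (simp only: derivative_eq_fld[OF f] 0, simp)
    then show ?thesis
      using smooth_has_derivative[OF f, of x] by simp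
  qed
  then show ?thesis
    by (intro has_derivative_zero_unique[of UNIV f]) auto
qed

lemma (in kt_system) first_order_solution:
  assumes f: "kt_fun f" and h: "kt_fun h" and 1: "codiff f h = (\<lambda>x. 0)" and 2: "curl f h = (\<lambda>x. 0)"
    and small: "r * \<beta>\<^sup>2 < 4" "r * \<beta> < 4"
  shows "\<exists>c d. f = (\<lambda>x. c) \<and> h = (\<lambda>x. d * exp (- \<i> * complex_of_real (\<beta> / 2) * complex_of_real (x $ 2)))"
proof -
  define a where "a = complex_of_real (1 / r)"
  define c where "c = complex_of_real (1 / \<beta>)"
  define B where "B = complex_of_real \<beta>"
  note kt = f h kt_fun_intros
  have ii: "\<i> * \<i> = -1"
    by simp
  have f1: "fld 1 f = (\<lambda>x. 0)" and h1: "fld 1 h = (\<lambda>x. 0)"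
    using first_order_fld_1[OF f h 1 2] by auto
  have a2: "complex_of_real (1 / r\<^sup>2) = a * a" and c2: "\<i> / complex_of_real \<beta> = \<i> * c"
    by (simp_all add: a_def c_def power2_eq_square)
  have Xf: "fld 2 f x = - \<i> * a * a * (fld 3 h x - \<i> * c * fld 4 h x)" for x
  proof -
    have "1 / 2 * (- \<i> * fld 2 f x) + a * a * (1 / 2 * (fld 3 h x - \<i> * c * fld 4 h x)) = 0"
      using fun_cong[OF 1, of x] unfolding codiff_def cfld_def a2 c2 f1 by simp
    then have "- \<i> * fld 2 f x + a * a * (fld 3 h x - \<i> * c * fld 4 h x) = 0"
      by simp
    then show ?thesis
      using ii by algebra
  qed
  have Xh: "fld 2 h x = - \<i> * (fld 3 f x + \<i> * c * fld 4 f x) - \<i> * (B / 2) * h x" for x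
  proof -
    have "1 / 2 * (\<i> * fld 2 h x) - 1 / 2 * (fld 3 f x + \<i> * c * fld 4 f x) - B / 4 * h x = 0"
      using fun_cong[OF 2, of x] unfolding curl_def cfld_def c2 h1 B_def by simp
    then have "\<i> * fld 2 h x - (fld 3 f x + \<i> * c * fld 4 f x) - B / 2 * h x = 0"
      by algebra
    then show ?thesis
      using ii by algebra
  qed
  \<comment> \<open>With the t-derivatives gone, the y-derivatives couple f and h with coefficients
    proportional to \<open>a * a\<close> and 1. The combinations \<open>f + a h\<close> and
    \<open>f - a h\<close> diagonalise this coupling and leave only the z-derivatives and zeroth
    order terms mixed.\<close>
  define s where "s = (\<lambda>x. f x + a * h x)"
  define d where "d = (\<lambda>x. f x - a * h x)"
  have s: "kt_fun s" and d: "kt_fun d"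
    unfolding s_def d_def by (intro kt)+
  have fs: "fld i s = (\<lambda>x. fld i f x + a * fld i h x)" and fd: "fld i d = (\<lambda>x. fld i f x - a * fld i h x)" for i
    unfolding s_def d_def by (simp_all only: fld_simps kt)
  define q where "q = 1 / r * (1 / \<beta>)"
  define b where "b = B / 4"
  have q: "complex_of_real q = a * c" and B4: "complex_of_real (\<beta> / 4) = b"
    by (simp_all add: q_def a_def c_def B_def b_def)
  have Xh': "fld 2 h x = - \<i> * (fld 3 f x + \<i> * c * fld 4 f x) - \<i> * (b + b) * h x" for x
    by (simp add: Xh b_def)
  have ii': "\<i> * (\<i> * z) = - z" for z
    by (simp flip: mult.assoc)
  have e1: "fld 2 s x + \<i> * complex_of_real (\<beta> / 4) * s x + \<i> * complex_of_real (1 / r) * fld 3 s x =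
      complex_of_real q * fld 4 d x + \<i> * complex_of_real (\<beta> / 4) * d x" for x
    unfolding fs fd q B4 a_def[symmetric] Xf Xh' unfolding s_def d_def
    by (simp add: algebra_simps ii')
  have e2: "fld 2 d x + \<i> * complex_of_real (\<beta> / 4) * d x - \<i> * complex_of_real (1 / r) * fld 3 d x =
      - complex_of_real q * fld 4 s x + \<i> * complex_of_real (\<beta> / 4) * s x" for x
    unfolding fs fd q B4 a_def[symmetric] Xf Xh' unfolding s_def d_def
    by (simp add: algebra_simps ii')
  \<comment> \<open>The system is symmetric under exchanging s and d and changing the signs of r and
    q, so \<open>dirac_zero\<close>, in which these signs are arbitrary, also applies to d.\<close>
  have e1': "fld 2 d x + \<i> * complex_of_real (\<beta> / 4) * d x + \<i> * complex_of_real (1 / (- r)) * fld 3 d x =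
      complex_of_real (- q) * fld 4 s x + \<i> * complex_of_real (\<beta> / 4) * s x" for x
    using e2[of x] by simp
  have e2': "fld 2 s x + \<i> * complex_of_real (\<beta> / 4) * s x - \<i> * complex_of_real (1 / (- r)) * fld 3 s x =
      - complex_of_real (- q) * fld 4 d x + \<i> * complex_of_real (\<beta> / 4) * d x" for x
    using e1[of x] by simp
  \<comment> \<open>The two smallness conditions on r are exactly \<open>\<beta> / 4 < q\<close> and
    \<open>\<beta> / 4 < 1 / r\<close>: the first removes z, the second removes y.\<close>
  have "\<beta> / 4 < q"
    using small(1) r \<beta> by (simp add: q_def field_simps power2_eq_square)
  then have qq: "q\<^sup>2 > \<beta>\<^sup>2 / 16"
    using power_strict_mono[of "\<beta> / 4" q 2] \<beta> by (simp add: power_divide)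
  have "\<beta> / 4 < 1 / r"
    using small(2) r by (simp add: field_simps)
  then have rr: "(1 / r)\<^sup>2 > \<beta>\<^sup>2 / 16"
    using power_strict_mono[of "\<beta> / 4" "1 / r" 2] \<beta> by (simp add: power_divide)
  have s4: "fld 4 s = (\<lambda>x. 0)"
    by (rule dirac_zero(1)[OF s d e1 e2 qq])
  have d4: "fld 4 d = (\<lambda>x. 0)"
    by (rule dirac_zero(1)[OF d s e1' e2']) (use qq in simp)
  have s3: "fld 3 s = (\<lambda>x. 0)"
    by (rule dirac_zero(2)[OF s d e1 e2 s4 d4 rr])
  have d3: "fld 3 d = (\<lambda>x. 0)"
    by (rule dirac_zero(2)[OF d s e1' e2' d4 s4]) (use rr in simp)
  have a0: "a \<noteq> 0"
    using r by (simp add: a_def)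
  have z: "fld i f x = 0 \<and> fld i h x = 0" if "i = 3 \<or> i = 4" for i x
  proof -
    have "fld i f x + a * fld i h x = 0" "fld i f x - a * fld i h x = 0"
      using that s3 s4 d3 d4 unfolding fs fd by (auto dest: fun_cong[of _ _ x])
    then have "fld i f x = 0" "a * fld i h x = 0"
      by algebra+
    then show ?thesis
      using a0 by simp
  qed
  have f2: "fld 2 f x = 0" for x
    unfolding Xf by (simp add: z)
  have h2: "fld 2 h x = - \<i> * (B / 2) * h x" for x
    unfolding Xh by (simp add: z)
  have fi: "fld i f = (\<lambda>x. 0)" for i
    using exhaust_4[of i] f1 f2 z[of i] by auto
  \<comment> \<open>An integrating factor for the equation that remains for h. With
    \<open>\<beta> = 8 \<pi>\<close> its inverse is the Fourier mode of frequency (-2, 0), the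
    second root of l (l + 2) at m = 0.\<close>
  define w where "w = (\<lambda>x :: vec4. exp (\<i> * (B / 2) * complex_of_real (x $ 2)))"
  have bl: "bounded_linear (\<lambda>x :: vec4. \<i> * (B / 2) * complex_of_real (x $ 2))"
    by (intro bounded_linear_const_mult bounded_linear_compose[OF bounded_linear_of_real bounded_linear_vec_nth])
  have w: "smooth w"
    unfolding w_def by (rule smooth_exp_linear[OF bl])
  have wd: "(w has_derivative (\<lambda>v. \<i> * (B / 2) * complex_of_real (v $ 2) * w x)) (at x)" for x
    using has_derivative_compose[OF bounded_linear_imp_has_derivative[OF bl] DERIV_exp[unfolded has_field_derivative_def]]
    unfolding w_def by (simp add: mult_ac)
  have fw: "fld i w x = \<i> * (B / 2) * complex_of_real (kt_frame x i $ 2) * w x" for i x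
    by (rule fld_has_derivative[OF wd])
  have "fld i (\<lambda>x. w x * h x) = (\<lambda>x. 0)" for i
  proof
    fix x
    have "fld i (\<lambda>x. w x * h x) x = w x * fld i h x + fld i w x * h x"
      by (simp add: fld_mult[OF w kt_fun_smooth[OF h]])
    also have "\<dots> = 0"
      using exhaust_4[of i] h1 h2 z[of i x] by (auto simp: fw kt_frame_simps axis_def)
    finally show "fld i (\<lambda>x. w x * h x) x = 0" .
  qed
  then have wh: "w x * h x = w 0 * h 0" for x
    by (rule smooth_eq_const[OF smooth_mult[OF w kt_fun_smooth[OF h]]])
  have "h x = h 0 * exp (- \<i> * complex_of_real (\<beta> / 2) * complex_of_real (x $ 2))" for x
  proof -
    have "exp (- \<i> * complex_of_real (\<beta> / 2) * complex_of_real (x $ 2)) * w x = 1"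
      by (simp add: w_def B_def flip: exp_add)
    moreover have "w 0 = 1"
      by (simp add: w_def)
    ultimately show ?thesis
      using wh[of x] by (metis mult.assoc mult.commute mult_1)
  qed
  moreover have "f x = f 0" for x
    by (rule smooth_eq_const[OF kt_fun_smooth[OF f] fi])
  ultimately show ?thesis
    by blast
qed


section \<open>The almost complex structure and the metrics\<close>

text \<open>In the left-invariant frame, J sends the t-field to the x-field and the third field to
  the z-field divided by \<beta>.\<close>

definition kt_J :: "real \<Rightarrow> endo_field" where
  "kt_J \<beta> x v = pt (- v $ 2, v $ 1, - \<beta> * (v $ 4 - x $ 2 * v $ 3),
     v $ 3 / \<beta> - x $ 2 * (\<beta> * (v $ 4 - x $ 2 * v $ 3)))"

definition kt_g :: "real \<Rightarrow> real \<Rightarrow> bilin_field" where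
  "kt_g \<beta> r x v w = v $ 1 * w $ 1 + v $ 2 * w $ 2 +
     r\<^sup>2 * (v $ 3 * w $ 3 + \<beta>\<^sup>2 * ((v $ 4 - x $ 2 * v $ 3) * (w $ 4 - x $ 2 * w $ 3)))"

lemma kt_push_nth:
  "kt_push a x v $ 1 = v $ 1" "kt_push a x v $ 2 = v $ 2" "kt_push a x v $ 3 = v $ 3"
  "kt_push a x v $ 4 = v $ 4 + a $ 2 * v $ 3"
  by (simp_all add: kt_push_eq axis_def)

lemma kt_J_nth:
  "kt_J \<beta> x v $ 1 = - v $ 2" "kt_J \<beta> x v $ 2 = v $ 1" "kt_J \<beta> x v $ 3 = - \<beta> * (v $ 4 - x $ 2 * v $ 3)"
  "kt_J \<beta> x v $ 4 = v $ 3 / \<beta> - x $ 2 * (\<beta> * (v $ 4 - x $ 2 * v $ 3))"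
  by (simp_all add: kt_J_def)

lemma smooth_uminus: "smooth f \<Longrightarrow> smooth (\<lambda>x. - f x)"
  using smooth_bounded_linear[OF bounded_linear_minus[OF bounded_linear_ident]] .

lemma smooth_diff: "smooth f \<Longrightarrow> smooth g \<Longrightarrow> smooth (\<lambda>x. f x - g x)"
  using smooth_add[OF _ smooth_uminus[of g], of f] by simp

lemma almost_complex_structure_kt_J:
  assumes "\<beta> \<noteq> 0"
  shows "almost_complex_structure (kt_J \<beta>)"
  unfolding almost_complex_structure_def
proof (intro conjI allI ballI)
  show "linear (kt_J \<beta> x)" for x
    by (rule linearI) (simp_all add: vec_eq_iff forall_4 kt_J_nth algebra_simps add_divide_distrib)
  show "kt_J \<beta> x (kt_J \<beta> x v) = - v" for x v
    using assms by (simp add: vec_eq_iff forall_4 kt_J_nth)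
  show "smooth (\<lambda>x. kt_J \<beta> x v)" for v
    unfolding kt_J_def pt_def split_conv
    by (intro smooth_add smooth_diff smooth_scaleR smooth_mult smooth_const smooth_nth)
  show "kt_J \<beta> (kt_mult a x) (kt_push a x v) = kt_push a x (kt_J \<beta> x v)" for a x v
    by (simp add: vec_eq_iff forall_4 kt_J_nth kt_push_nth kt_mult_nth algebra_simps)
qed

lemma ext_d_const: "ext_d (\<lambda>x. \<phi>) = 0"
  by (simp add: ext_d_def fun_eq_iff)

lemma almost_kaehler_kt_g:
  assumes \<beta>: "\<beta> > 0" and r: "r > 0"
  shows "almost_kaehler (kt_J \<beta>) (kt_g \<beta> r)"
proof -
  have "riemannian_metric (kt_g \<beta> r)"
    unfolding riemannian_metric_def
  proof (intro conjI allI ballI impI)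
    show "bilinear (kt_g \<beta> r x)" for x
      unfolding bilinear_def
      by (intro conjI allI linearI) (simp_all add: kt_g_def algebra_simps)
    show "kt_g \<beta> r x v w = kt_g \<beta> r x w v" for x v w
      by (simp add: kt_g_def algebra_simps)
    show "kt_g \<beta> r x v v > 0" if "v \<noteq> 0" for x v
    proof -
      let ?z = "v $ 4 - x $ 2 * v $ 3"
      have eq: "kt_g \<beta> r x v v = (v $ 1)\<^sup>2 + (v $ 2)\<^sup>2 + (r * v $ 3)\<^sup>2 + (r * \<beta> * ?z)\<^sup>2"
        by (simp add: kt_g_def power2_eq_square algebra_simps)
      have "v $ 1 \<noteq> 0 \<or> v $ 2 \<noteq> 0 \<or> r * v $ 3 \<noteq> 0 \<or> r * \<beta> * ?z \<noteq> 0"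
        using that \<beta> r by (auto simp: vec_eq_iff forall_4)
      then have "0 < (v $ 1)\<^sup>2 \<or> 0 < (v $ 2)\<^sup>2 \<or> 0 < (r * v $ 3)\<^sup>2 \<or> 0 < (r * \<beta> * ?z)\<^sup>2"
        by (simp only: zero_less_power2)
      moreover have "0 \<le> (v $ 1)\<^sup>2" "0 \<le> (v $ 2)\<^sup>2" "0 \<le> (r * v $ 3)\<^sup>2" "0 \<le> (r * \<beta> * ?z)\<^sup>2"
        by simp_all
      ultimately show ?thesis
        unfolding eq by linarith
    qed
    show "smooth (\<lambda>x. kt_g \<beta> r x v w)" for v w
      unfolding kt_g_def
      by (intro smooth_add smooth_diff smooth_mult smooth_const smooth_nth)
    show "kt_g \<beta> r (kt_mult a x) (kt_push a x v) (kt_push a x w) = kt_g \<beta> r x v w" for a x v w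
      by (simp add: kt_g_def kt_push_nth kt_mult_nth algebra_simps)
  qed
  moreover have "kt_g \<beta> r x (kt_J \<beta> x v) (kt_J \<beta> x w) = kt_g \<beta> r x v w" for x v w
  proof -
    have z: "kt_J \<beta> x v $ 4 - x $ 2 * kt_J \<beta> x v $ 3 = v $ 3 / \<beta>" for v
      by (simp add: kt_J_nth)
    show ?thesis
      unfolding kt_g_def z using \<beta> by (simp add: kt_J_nth power2_eq_square field_simps)
  qed
  \<comment> \<open>The coordinate x cancels because \<open>dz - x dy\<close> enters only in its
    wedge product with \<open>dy\<close>.\<close>
  moreover have "fundamental_form (kt_J \<beta>) (kt_g \<beta> r) = (\<lambda>x. fundamental_form (kt_J \<beta>) (kt_g \<beta> r) 0)"
  proof -
    have z: "kt_J \<beta> x v $ 4 - x $ 2 * kt_J \<beta> x v $ 3 = v $ 3 / \<beta>" for x v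
      by (simp add: kt_J_nth)
    have "kt_g \<beta> r x (kt_J \<beta> x v) w = - v $ 2 * w $ 1 + v $ 1 * w $ 2 + r\<^sup>2 * \<beta> * (v $ 3 * w $ 4 - v $ 4 * w $ 3)" for x v w
      unfolding kt_g_def z using \<beta> by (simp add: kt_J_nth power2_eq_square field_simps)
    then show ?thesis
      by (simp add: fundamental_form_def fun_eq_iff)
  qed
  ultimately show ?thesis
    unfolding almost_kaehler_def hermitian_metric_def using ext_d_const by metis
qed

lemma det_4:
  "det (A::'a::comm_ring_1^4^4) =
    A$1$1 * (A$2$2 * (A$3$3 * A$4$4 - A$3$4 * A$4$3) - A$2$3 * (A$3$2 * A$4$4 - A$3$4 * A$4$2) + A$2$4 * (A$3$2 * A$4$3 - A$3$3 * A$4$2))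
  - A$1$2 * (A$2$1 * (A$3$3 * A$4$4 - A$3$4 * A$4$3) - A$2$3 * (A$3$1 * A$4$4 - A$3$4 * A$4$1) + A$2$4 * (A$3$1 * A$4$3 - A$3$3 * A$4$1))
  + A$1$3 * (A$2$1 * (A$3$2 * A$4$4 - A$3$4 * A$4$2) - A$2$2 * (A$3$1 * A$4$4 - A$3$4 * A$4$1) + A$2$4 * (A$3$1 * A$4$2 - A$3$2 * A$4$1))
  - A$1$4 * (A$2$1 * (A$3$2 * A$4$3 - A$3$3 * A$4$2) - A$2$2 * (A$3$1 * A$4$3 - A$3$3 * A$4$1) + A$2$3 * (A$3$1 * A$4$2 - A$3$2 * A$4$1))"
proof -
  have f1234: "finite {2::4, 3, 4}" "1 \<notin> {2::4, 3, 4}"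
    by auto
  have f234: "finite {3::4, 4}" "2 \<notin> {3::4, 4}"
    by auto
  have f34: "finite {4::4}" "3 \<notin> {4::4}"
    by auto
  show ?thesis
    unfolding det_def UNIV_4
    unfolding sum_over_permutations_insert[OF f1234]
    unfolding sum_over_permutations_insert[OF f234]
    unfolding sum_over_permutations_insert[OF f34]
    unfolding permutes_sing
    by (simp add: sign_swap_id permutation_swap_id permutation_compose sign_compose sign_id swap_id_eq algebra_simps)
qed

lemma vector_4:
  "(vector [u, v, w, x] :: 'a::zero ^ 4) $ 1 = u" "(vector [u, v, w, x] :: 'a ^ 4) $ 2 = v"
  "(vector [u, v, w, x] :: 'a ^ 4) $ 3 = w" "(vector [u, v, w, x] :: 'a ^ 4) $ 4 = x"
  by (simp_all add: vector_def)

lemma matrix_inv_unique: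
  fixes A B :: "real ^ 'n ^ 'n"
  assumes "A ** B = mat 1" "B ** A = mat 1"
  shows "matrix_inv A = B"
proof -
  have "A ** matrix_inv A = mat 1"
    unfolding matrix_inv_def by (rule someI2[of _ B]) (use assms in auto)
  then have "B ** (A ** matrix_inv A) = B"
    by simp
  then show ?thesis
    by (simp add: matrix_mul_assoc assms(2))
qed

abbreviation coord :: "4 \<Rightarrow> covec" where
  "coord i \<equiv> functional (\<lambda>v. complex_of_real (v $ i))"

lemma alternating_coord: "alternating 1 (coord i)"
  by (intro alternating_real_functional) (simp add: linear_iff)

text \<open>The determinant is the wedge product of the coordinate covectors, so alternation is
  inherited from the wedge product.\<close>

lemma alternating_det: "alternating 4 (\<lambda>vs. if length vs = 4 then complex_of_real (det (vector vs :: real ^ 4 ^ 4)) else 0)"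
proof -
  have alt: "alternating 4 (wedge_list [coord 1, coord 2, coord 3, coord 4])"
    using alternating_wedge_list[of "[coord 1, coord 2, coord 3, coord 4]"] alternating_coord
    by (simp add: numeral_eq_Suc)
  have "(\<lambda>vs. if length vs = 4 then complex_of_real (det (vector vs :: real ^ 4 ^ 4)) else 0) =
      wedge_list [coord 1, coord 2, coord 3, coord 4]"
  proof
    fix vs :: "vec4 list"
    show "(if length vs = 4 then complex_of_real (det (vector vs :: real ^ 4 ^ 4)) else 0) =
      wedge_list [coord 1, coord 2, coord 3, coord 4] vs"
    proof (cases "length vs = 4")
      case True
      then obtain u v w x where "vs = [u, v, w, x]"
        by (auto simp: length_Suc_conv numeral_eq_Suc)
      then show ?thesis
        by (simp add: det_4 vector_4 wedge_Cons wedge_Nil unit_covec_def) (simp add: algebra_simps)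
    qed (use alternating_eq_0[OF alt] in simp)
  qed
  then show ?thesis
    using alt by simp
qed

context kt_system
begin

definition cof :: "vec4 \<Rightarrow> 4 \<Rightarrow> vec4 \<Rightarrow> real" where
  "cof x i v = (if i = 1 then v $ 1 else if i = 2 then v $ 2 else if i = 3 then r * v $ 3
     else r * \<beta> * (v $ 4 - x $ 2 * v $ 3))"

definition fr :: "vec4 \<Rightarrow> 4 \<Rightarrow> vec4" where
  "fr x i = (if i = 1 then pt (1, 0, 0, 0) else if i = 2 then pt (0, 1, 0, 0)
     else if i = 3 then pt (0, 0, 1 / r, x $ 2 / r) else pt (0, 0, 0, 1 / (r * \<beta>)))"

lemma fr_simps:
  "fr x 1 = pt (1, 0, 0, 0)" "fr x 2 = pt (0, 1, 0, 0)" "fr x 3 = pt (0, 0, 1 / r, x $ 2 / r)"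
  "fr x 4 = pt (0, 0, 0, 1 / (r * \<beta>))"
  by (simp_all add: fr_def)

lemma frame: "orthonormal_frame (kt_g \<beta> r x) (kt_J \<beta> x) (cof x) (fr x)"
proof (rule orthonormal_frame.intro)
  fix i j :: 4 and v :: vec4
  show "linear (cof x i)"
    using exhaust_4[of i] by (auto simp: cof_def linear_iff algebra_simps)
  show "cof x i (fr x j) = (if i = j then 1 else 0)"
    using exhaust_4[of i] exhaust_4[of j] \<beta> r by (auto simp: cof_def fr_simps)
  show "v = (\<Sum>i\<in>UNIV. cof x i v *\<^sub>R fr x i)"
    using \<beta> r by (simp add: vec_eq_iff forall_4 sum_4 cof_def fr_simps)
  have gram: "gram (kt_g \<beta> r x) $ k $ l =
      (if k = l then (if k = 1 \<or> k = 2 then 1 else if k = 3 then r\<^sup>2 * (1 + \<beta>\<^sup>2 * (x $ 2)\<^sup>2) else r\<^sup>2 * \<beta>\<^sup>2)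
       else if k = 3 \<and> l = 4 \<or> k = 4 \<and> l = 3 then - r\<^sup>2 * \<beta>\<^sup>2 * x $ 2 else 0)" for k l
    using exhaust_4[of k] exhaust_4[of l]
    by (auto simp: gram_def kt_g_def axis_def power2_eq_square)
  define B :: "real ^ 4 ^ 4" where "B = (\<chi> i j. \<Sum>a\<in>UNIV. fr x a $ i * fr x a $ j)"
  have Bij: "B $ k $ l =
      (if k = l then (if k = 1 \<or> k = 2 then 1 else if k = 3 then 1 / r\<^sup>2 else (x $ 2)\<^sup>2 / r\<^sup>2 + 1 / (r\<^sup>2 * \<beta>\<^sup>2))
       else if k = 3 \<and> l = 4 \<or> k = 4 \<and> l = 3 then x $ 2 / r\<^sup>2 else 0)" for k l
    using exhaust_4[of k] exhaust_4[of l]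
    by (auto simp: B_def sum_4 fr_simps power2_eq_square)
  have "gram (kt_g \<beta> r x) ** B = mat 1" "B ** gram (kt_g \<beta> r x) = mat 1"
    using \<beta> r
    by (simp_all add: vec_eq_iff forall_4 matrix_matrix_mult_def sum_4 mat_def gram Bij field_simps power2_eq_square)
  then have "matrix_inv (gram (kt_g \<beta> r x)) = B"
    by (rule matrix_inv_unique)
  then show "matrix_inv (gram (kt_g \<beta> r x)) $ i $ j = (\<Sum>a\<in>UNIV. fr x a $ i * fr x a $ j)"
    by (simp add: B_def)
  \<comment> \<open>The orientation sign is decided by a single positive basis; the t-field and the
    third frame field serve as the vectors u and w.\<close>
  have "det (vector [pt (1, 0, 0, 0), kt_J \<beta> x (pt (1, 0, 0, 0)), pt (0, 0, 1, x $ 2), kt_J \<beta> x (pt (0, 0, 1, x $ 2))] :: real ^ 4 ^ 4) > 0"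
    using \<beta> by (simp add: det_4 vector_4 kt_J_nth)
  then have "orientation_sign (kt_J \<beta> x) = 1"
    unfolding orientation_sign_def by auto
  moreover have "det (gram (kt_g \<beta> r x)) = (r\<^sup>2 * \<beta>)\<^sup>2"
    by (simp add: det_4 gram power2_eq_square algebra_simps)
  then have "sqrt (det (gram (kt_g \<beta> r x))) = r\<^sup>2 * \<beta>"
    using \<beta> by simp
  ultimately have vol: "vol (kt_J \<beta> x) (kt_g \<beta> r x) =
      scale_covec (complex_of_real (r\<^sup>2 * \<beta>)) (\<lambda>vs. if length vs = 4 then complex_of_real (det (vector vs :: real ^ 4 ^ 4)) else 0)"
    by (auto simp: vol_def scale_covec_def)
  show "alternating 4 (vol (kt_J \<beta> x) (kt_g \<beta> r x))"
    unfolding vol by (rule alternating_scale[OF alternating_det])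
  show "vol (kt_J \<beta> x) (kt_g \<beta> r x) [fr x 1, fr x 2, fr x 3, fr x 4] = 1"
    using \<beta> r unfolding vol by (simp add: scale_covec_def det_4 vector_4 fr_simps power2_eq_square)
qed

end


section \<open>The Laplacian on (0,1)-forms\<close>

lemma wedge_unit_covec: "wedge \<phi> unit_covec = \<phi>"
proof
  fix vs
  show "wedge \<phi> unit_covec vs = \<phi> vs"
  proof (induction vs arbitrary: \<phi>)
    case Nil
    then show ?case by (simp add: wedge_Nil unit_covec_def)
  next
    case (Cons v vs)
    have "(\<lambda>us. unit_covec (v # us)) = (\<lambda>us. 0)"
      by (simp add: unit_covec_def)
    with Cons show ?case by (simp add: wedge_Cons)
  qed
qed

lemma ext_d_1: "ext_d \<alpha> x [u] = frechet_derivative (\<lambda>y. \<alpha> y []) (at x) u"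
  by (simp add: ext_d_def)

lemma ext_d_2: "ext_d \<alpha> x [u, v] =
    frechet_derivative (\<lambda>y. \<alpha> y [v]) (at x) u - frechet_derivative (\<lambda>y. \<alpha> y [u]) (at x) v"
  by (simp add: ext_d_def)

lemma ext_d_3: "ext_d \<alpha> x [u, v, w] =
    frechet_derivative (\<lambda>y. \<alpha> y [v, w]) (at x) u - frechet_derivative (\<lambda>y. \<alpha> y [u, w]) (at x) v
    + frechet_derivative (\<lambda>y. \<alpha> y [u, v]) (at x) w"
  by (simp add: ext_d_def)

lemma ext_d_4: "ext_d \<alpha> x [u, v, w, z] =
    frechet_derivative (\<lambda>y. \<alpha> y [v, w, z]) (at x) u - frechet_derivative (\<lambda>y. \<alpha> y [u, w, z]) (at x) v
    + frechet_derivative (\<lambda>y. \<alpha> y [u, v, z]) (at x) w - frechet_derivative (\<lambda>y. \<alpha> y [u, v, w]) (at x) z"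
  by (simp add: ext_d_def)

lemma ext_d_eq_0:
  assumes "\<And>y us. length us \<noteq> k \<Longrightarrow> \<alpha> y us = 0" "length vs \<noteq> Suc k"
  shows "ext_d \<alpha> x vs = 0"
proof -
  have "\<alpha> y (take i vs @ drop (Suc i) vs) = 0" if "i < length vs" for y i
    using that assms by (intro assms(1)) auto
  then show ?thesis
    by (simp add: ext_d_def)
qed

lemma ext_d_0: "ext_d (\<lambda>y. 0) = 0"
  by (rule ext_d_const)

context kt_system
begin

abbreviation J where "J \<equiv> kt_J \<beta>"
abbreviation g where "g \<equiv> kt_g \<beta> r"

text \<open>The letter F marks the (1,0)-covectors and G their conjugates. Only the second pair
  varies with the point.\<close>

definition lF1 :: "vec4 \<Rightarrow> complex" where "lF1 v = complex_of_real (v $ 1) + \<i> * complex_of_real (v $ 2)"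
definition lG1 :: "vec4 \<Rightarrow> complex" where "lG1 v = complex_of_real (v $ 1) - \<i> * complex_of_real (v $ 2)"
definition lF2 :: "vec4 \<Rightarrow> vec4 \<Rightarrow> complex" where
  "lF2 x v = complex_of_real (v $ 3) + \<i> * complex_of_real (\<beta> * (v $ 4 - x $ 2 * v $ 3))"
definition lG2 :: "vec4 \<Rightarrow> vec4 \<Rightarrow> complex" where
  "lG2 x v = complex_of_real (v $ 3) - \<i> * complex_of_real (\<beta> * (v $ 4 - x $ 2 * v $ 3))"

abbreviation F1 where "F1 \<equiv> functional lF1"
abbreviation G1 where "G1 \<equiv> functional lG1"
abbreviation F2 where "F2 x \<equiv> functional (lF2 x)"
abbreviation G2 where "G2 x \<equiv> functional (lG2 x)"

lemma covec10_F: "F1 \<in> covec10 (J x)" "F2 x \<in> covec10 (J x)"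
  and covec01_G: "G1 \<in> covec01 (J x)" "G2 x \<in> covec01 (J x)"
proof -
  have "linear lF1" "linear lG1" "linear (lF2 x)" "linear (lG2 x)"
    by (simp_all add: linear_iff lF1_def lG1_def lF2_def lG2_def complex_eq_iff algebra_simps)
  then have alt: "alternating 1 F1" "alternating 1 G1" "alternating 1 (F2 x)" "alternating 1 (G2 x)"
    by (auto intro: alternating_functional[unfolded One_nat_def])
  then show "F1 \<in> covec10 (J x)" "F2 x \<in> covec10 (J x)" "G1 \<in> covec01 (J x)" "G2 x \<in> covec01 (J x)"
    using \<beta>
    by (simp_all add: covec10_def covec01_def lF1_def lG1_def lF2_def lG2_def kt_J_nth complex_eq_iff)
qed

lemmas types = covec10_F covec01_G

lemma alternating_FG: "alternating 1 F1" "alternating 1 G1" "alternating 1 (F2 x)" "alternating 1 (G2 x)"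
  using covec10_F covec01_G[of x] by (auto simp: covec10_def covec01_def)

lemma alternating_wedge_FG:
  "set \<phi>s \<subseteq> {F1, G1, F2 x, G2 x} \<Longrightarrow> alternating (length \<phi>s) (wedge_list \<phi>s)"
  using alternating_FG by (intro alternating_wedge_list) auto

lemma pq_wedge:
  "set \<alpha>s \<subseteq> {F1, F2 x} \<Longrightarrow> set \<beta>s \<subseteq> {G1, G2 x} \<Longrightarrow>
    wedge_list (\<alpha>s @ \<beta>s) \<in> covec_pq (J x) (length \<alpha>s) (length \<beta>s)"
  using types[of x] by (intro covec_pq_wedge_list) auto

lemma derivative_eq_V:
  assumes "smooth f"
  shows "frechet_derivative f (at x) v = V1 f x * lF1 v + V1b f x * lG1 v + V2 f x * lF2 x v + V2b f x * lG2 x v"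
  unfolding derivative_eq_fld[OF assms] cfld_def lF1_def lG1_def lF2_def lG2_def
  using \<beta> by (simp add: field_simps)

text \<open>The differential of \<open>dy - \<i> \<beta> (dz - x dy)\<close> is \<open>\<i> \<beta> dx \<and> dy\<close>, here in terms of the complex coframe.\<close>

definition twist :: "vec4 \<Rightarrow> vec4 \<Rightarrow> vec4 \<Rightarrow> complex" where
  "twist x w v = complex_of_real (\<beta> / 4) * (lF1 w - lG1 w) * (lF2 x v + lG2 x v)"

lemma has_derivative_lG2: "((\<lambda>y. lG2 y v) has_derivative (\<lambda>w. twist x w v)) (at x)"
  and has_derivative_lF2: "((\<lambda>y. lF2 y v) has_derivative (\<lambda>w. - twist x w v)) (at x)"
proof -
  have tw: "twist x w v = \<i> * complex_of_real \<beta> * complex_of_real (w $ 2) * complex_of_real (v $ 3)" for w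
    by (simp add: twist_def lF1_def lG1_def lF2_def lG2_def)
  have nth: "((\<lambda>y :: vec4. complex_of_real (y $ 2)) has_derivative (\<lambda>v. complex_of_real (v $ 2))) (at x)"
    by (intro bounded_linear_imp_has_derivative bounded_linear_compose[OF bounded_linear_of_real bounded_linear_vec_nth])
  note m = has_derivative_mult_left[OF has_derivative_mult_right[OF nth], of "\<i> * complex_of_real \<beta>" "complex_of_real (v $ 3)"]
  have eq: "lG2 y v = (complex_of_real (v $ 3) - \<i> * complex_of_real (\<beta> * v $ 4)) + \<i> * complex_of_real \<beta> * complex_of_real (y $ 2) * complex_of_real (v $ 3)"
    "lF2 y v = (complex_of_real (v $ 3) + \<i> * complex_of_real (\<beta> * v $ 4)) - \<i> * complex_of_real \<beta> * complex_of_real (y $ 2) * complex_of_real (v $ 3)" for y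
    by (simp_all add: lG2_def lF2_def algebra_simps)
  show "((\<lambda>y. lG2 y v) has_derivative (\<lambda>w. twist x w v)) (at x)"
    unfolding eq tw using has_derivative_add[OF has_derivative_const m] by simp
  show "((\<lambda>y. lF2 y v) has_derivative (\<lambda>w. - twist x w v)) (at x)"
    unfolding eq tw using has_derivative_diff[OF has_derivative_const m] by simp
qed

definition form01 :: "(vec4 \<Rightarrow> complex) \<Rightarrow> (vec4 \<Rightarrow> complex) \<Rightarrow> form" where
  "form01 f h = (\<lambda>x. scale_covec (f x) G1 + scale_covec (h x) (G2 x))"

lemma form01_simps: "form01 f h x [v] = f x * lG1 v + h x * lG2 x v"
  by (simp add: form01_def scale_covec_def)

lemma alternating_form01: "alternating 1 (form01 f h x)"
  unfolding form01_def by (intro alternating_add alternating_scale alternating_FG)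

lemma form01_type: "form01 f h x \<in> covec_pq (J x) 0 1"
proof -
  have "G1 \<in> covec_pq (J x) 0 1" "G2 x \<in> covec_pq (J x) 0 1"
    using pq_wedge[of "[]" x "[G1]"] pq_wedge[of "[]" x "[G2 x]"] by (simp_all add: wedge_unit_covec)
  then show ?thesis
    unfolding form01_def by (intro covec_pq_add covec_pq_scale)
qed

text \<open>\<open>T1\<close> and \<open>T2\<close> span the type (1,2), in which the star of a
  (0,1)-covector lies; \<open>G12\<close> and \<open>Top\<close> span the types (0,2) and
  (2,2).\<close>

definition T1 :: "vec4 \<Rightarrow> covec" where "T1 x = wedge_list [F1, G1, G2 x]"
definition T2 :: "vec4 \<Rightarrow> covec" where "T2 x = wedge_list [F2 x, G1, G2 x]"
definition G12 :: "vec4 \<Rightarrow> covec" where "G12 x = wedge_list [G1, G2 x]"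
definition Top :: "vec4 \<Rightarrow> covec" where "Top x = wedge_list [F1, F2 x, G1, G2 x]"

lemmas wedge_eval = wedge_Cons wedge_Nil unit_covec_def

lemma alternating_T: "alternating 3 (T1 x)" "alternating 3 (T2 x)" "alternating 2 (G12 x)" "alternating 4 (Top x)"
  using alternating_wedge_FG[of "[F1, G1, G2 x]" x] alternating_wedge_FG[of "[F2 x, G1, G2 x]" x]
    alternating_wedge_FG[of "[G1, G2 x]" x] alternating_wedge_FG[of "[F1, F2 x, G1, G2 x]" x]
  by (simp_all add: T1_def T2_def G12_def Top_def numeral_eq_Suc)

lemma type_T: "T1 x \<in> covec_pq (J x) 1 2" "T2 x \<in> covec_pq (J x) 1 2" "G12 x \<in> covec_pq (J x) 0 2" "Top x \<in> covec_pq (J x) 2 2"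
  using pq_wedge[of "[F1]" x "[G1, G2 x]"] pq_wedge[of "[F2 x]" x "[G1, G2 x]"] pq_wedge[of "[]" x "[G1, G2 x]"]
    pq_wedge[of "[F1, F2 x]" x "[G1, G2 x]"]
  by (simp_all add: T1_def T2_def G12_def Top_def numeral_2_eq_2)

lemma l_frame:
  "lF1 (fr x 1) = 1" "lF1 (fr x 2) = \<i>" "lF1 (fr x 3) = 0" "lF1 (fr x 4) = 0"
  "lG1 (fr x 1) = 1" "lG1 (fr x 2) = - \<i>" "lG1 (fr x 3) = 0" "lG1 (fr x 4) = 0"
  "lF2 x (fr x 1) = 0" "lF2 x (fr x 2) = 0" "lF2 x (fr x 3) = 1 / complex_of_real r" "lF2 x (fr x 4) = \<i> / complex_of_real r"
  "lG2 x (fr x 1) = 0" "lG2 x (fr x 2) = 0" "lG2 x (fr x 3) = 1 / complex_of_real r" "lG2 x (fr x 4) = - \<i> / complex_of_real r"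
  using \<beta> r by (simp_all add: lF1_def lG1_def lF2_def lG2_def fr_simps)

text \<open>In the orthonormal frame \<open>F2\<close> and \<open>G2\<close> carry a factor
  \<open>1 / r\<close> each. Thus \<open>T2\<close> has two such factors, which accounts for
  \<open>r\<^sup>2\<close>, while \<open>T1\<close> has the same single one as
  \<open>G2\<close>.\<close>

lemma hodge_form01:
  "hodge J g 1 (form01 f h) =
    (\<lambda>x. scale_covec (complex_of_real (r\<^sup>2) / 2 * f x) (T2 x) + scale_covec (- (1 / 2) * h x) (T1 x))"
proof
  fix x
  interpret orthonormal_frame "g x" "J x" "cof x" "fr x"
    by (rule frame)
  show "hodge J g 1 (form01 f h) x =
      scale_covec (complex_of_real (r\<^sup>2) / 2 * f x) (T2 x) + scale_covec (- (1 / 2) * h x) (T1 x)"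
    unfolding hodge_def
    by (rule hodge_covec_1, rule alternating_form01, intro alternating_add alternating_scale alternating_T)
      (use r in \<open>simp_all add: form01_simps scale_covec_def T1_def T2_def wedge_eval l_frame power2_eq_square field_simps\<close>)
qed

text \<open>In complex dimension two, (0,2)-forms are self-dual for every Hermitian metric.\<close>

lemma hodge_G12: "hodge J g 2 (\<lambda>x. scale_covec (b x) (G12 x)) = (\<lambda>x. scale_covec (b x) (G12 x))"
proof
  fix x
  interpret orthonormal_frame "g x" "J x" "cof x" "fr x"
    by (rule frame)
  show "hodge J g 2 (\<lambda>x. scale_covec (b x) (G12 x)) x = scale_covec (b x) (G12 x)"
    unfolding hodge_def
    by (rule hodge_covec_2, (intro alternating_scale alternating_T)+)
      (simp_all add: scale_covec_def G12_def wedge_eval l_frame)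
qed

lemma hodge_T:
  "hodge J g 3 (\<lambda>x. scale_covec (p x) (T1 x) + scale_covec (q x) (T2 x)) =
    form01 (\<lambda>x. - 2 / complex_of_real (r\<^sup>2) * q x) (\<lambda>x. 2 * p x)"
proof
  fix x
  interpret orthonormal_frame "g x" "J x" "cof x" "fr x"
    by (rule frame)
  show "hodge J g 3 (\<lambda>x. scale_covec (p x) (T1 x) + scale_covec (q x) (T2 x)) x =
      form01 (\<lambda>x. - 2 / complex_of_real (r\<^sup>2) * q x) (\<lambda>x. 2 * p x) x"
    unfolding hodge_def
    by (rule hodge_covec_3, intro alternating_add alternating_scale alternating_T, rule alternating_form01)
      (use r in \<open>simp_all add: form01_simps scale_covec_def T1_def T2_def wedge_eval l_frame power2_eq_square field_simps\<close>)
qed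

lemma hodge_Top:
  "hodge J g 4 (\<lambda>x. scale_covec (p x) (Top x)) = (\<lambda>x. scale_covec (4 / complex_of_real (r\<^sup>2) * p x) unit_covec)"
proof
  fix x
  interpret orthonormal_frame "g x" "J x" "cof x" "fr x"
    by (rule frame)
  have "Top x [fr x 1, fr x 2, fr x 3, fr x 4] = 4 / complex_of_real (r\<^sup>2)"
    using r by (simp add: Top_def wedge_eval l_frame power2_eq_square field_simps)
  then show "hodge J g 4 (\<lambda>x. scale_covec (p x) (Top x)) x = scale_covec (4 / complex_of_real (r\<^sup>2) * p x) unit_covec"
    unfolding hodge_def
    by (subst hodge_covec_4, intro alternating_scale alternating_T) (simp add: scale_covec_def mult_ac)
qed

lemma smooth_mult_has_derivative:
  fixes f k :: "vec4 \<Rightarrow> complex"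
  assumes "smooth f" "(k has_derivative k') (at x)"
  shows "((\<lambda>y. f y * k y) has_derivative (\<lambda>w. f x * k' w + frechet_derivative f (at x) w * k x)) (at x)"
  by (rule has_derivative_mult[OF smooth_has_derivative[OF assms(1)] assms(2)])

text \<open>The terms are grouped by type (0,2), (1,1), (2,0), ready for \<open>pq_part_sum\<close>.
  The (2,0) term comes from the torsion of J, which is not integrable.\<close>

lemma ext_d_form01:
  assumes f: "smooth f" and h: "smooth h"
  shows "ext_d (form01 f h) x =
    scale_covec (curl f h x) (G12 x) +
    (scale_covec (V1 f x) (wedge_list [F1, G1]) +
     scale_covec (V2 f x + complex_of_real (\<beta> / 4) * h x) (wedge_list [F2 x, G1]) +
     scale_covec (V1 h x + complex_of_real (\<beta> / 4) * h x) (wedge_list [F1, G2 x]) +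
     scale_covec (V2 h x) (wedge_list [F2 x, G2 x])) +
    scale_covec (complex_of_real (\<beta> / 4) * h x) (wedge_list [F1, F2 x])" (is "_ = ?R")
proof
  fix vs
  have alt: "alternating 2 ?R"
    using alternating_wedge_FG[of "[F1, G1]" x] alternating_wedge_FG[of "[F2 x, G1]" x]
      alternating_wedge_FG[of "[F1, G2 x]" x] alternating_wedge_FG[of "[F2 x, G2 x]" x]
      alternating_wedge_FG[of "[F1, F2 x]" x]
    by (intro alternating_add alternating_scale alternating_T) (simp_all add: numeral_2_eq_2)
  show "ext_d (form01 f h) x vs = ?R vs"
  proof (cases "length vs = 2")
    case False
    then show ?thesis
      using ext_d_eq_0[of 1 "form01 f h" vs x] alternating_eq_0[OF alternating_form01] alternating_eq_0[OF alt]
      by simp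
  next
    case True
    then obtain u v where vs: "vs = [u, v]"
      by (auto simp: length_Suc_conv numeral_2_eq_2)
    have D: "frechet_derivative (\<lambda>y. form01 f h y [v]) (at x) u =
        frechet_derivative f (at x) u * lG1 v + (h x * twist x u v + frechet_derivative h (at x) u * lG2 x v)" for u v
    proof -
      have "((\<lambda>y. form01 f h y [v]) has_derivative (\<lambda>u. frechet_derivative f (at x) u * lG1 v +
          (h x * twist x u v + frechet_derivative h (at x) u * lG2 x v))) (at x)"
        unfolding form01_simps
        by (intro has_derivative_add has_derivative_mult_left smooth_has_derivative[OF f]
            smooth_mult_has_derivative[OF h] has_derivative_lG2)
      from fun_cong[OF frechet_derivative_at[OF this]] show ?thesis
        by (rule sym)
    qed
    show ?thesis
      unfolding vs ext_d_2 D derivative_eq_V[OF f] derivative_eq_V[OF h] twist_def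
      by (simp add: scale_covec_def G12_def wedge_eval curl_def) (simp add: algebra_simps add_divide_distrib diff_divide_distrib)
  qed
qed

lemma delbar_form01:
  assumes f: "smooth f" and h: "smooth h"
  shows "delbar J 1 (form01 f h) = (\<lambda>x. scale_covec (curl f h x) (G12 x))"
proof
  fix x
  have p: "pq_part (J y) p (1 - p) (form01 f h y) = (if p = 0 then form01 f h y else 0)" if "p \<le> 1" for p y
    using pq_part_of_type[OF form01_type, of p "1 - p"] that by auto
  define c where "c p = (if p = 0 then scale_covec (curl f h x) (G12 x) else if p = (1::nat) then
     scale_covec (V1 f x) (wedge_list [F1, G1]) +
     scale_covec (V2 f x + complex_of_real (\<beta> / 4) * h x) (wedge_list [F2 x, G1]) +
     scale_covec (V1 h x + complex_of_real (\<beta> / 4) * h x) (wedge_list [F1, G2 x]) +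
     scale_covec (V2 h x) (wedge_list [F2 x, G2 x])
     else scale_covec (complex_of_real (\<beta> / 4) * h x) (wedge_list [F1, F2 x]))" for p
  have ext: "ext_d (form01 f h) x = (\<Sum>p\<le>0 + 2. c p)"
    unfolding ext_d_form01[OF f h] by (simp add: c_def numeral_2_eq_2)
  have "wedge_list [F1, G1] \<in> covec_pq (J x) 1 1" "wedge_list [F2 x, G1] \<in> covec_pq (J x) 1 1"
    "wedge_list [F1, G2 x] \<in> covec_pq (J x) 1 1" "wedge_list [F2 x, G2 x] \<in> covec_pq (J x) 1 1"
    "wedge_list [F1, F2 x] \<in> covec_pq (J x) 2 0"
    using pq_wedge[of "[F1]" x "[G1]"] pq_wedge[of "[F2 x]" x "[G1]"] pq_wedge[of "[F1]" x "[G2 x]"]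
      pq_wedge[of "[F2 x]" x "[G2 x]"] pq_wedge[of "[F1, F2 x]" x "[]"]
    by (simp_all add: numeral_2_eq_2)
  then have ty: "c 1 \<in> covec_pq (J x) 1 1" "c 2 \<in> covec_pq (J x) 2 0" "c 0 \<in> covec_pq (J x) 0 2"
    unfolding c_def by (auto intro!: covec_pq_add covec_pq_scale type_T)
  have "c p \<in> covec_pq (J x) p (0 + 2 - p)" if "p \<le> 0 + 2" for p
  proof -
    have "p = 0 \<or> p = 1 \<or> p = 2"
      using that by auto
    then show ?thesis
      using ty by (elim disjE) (simp_all add: numeral_2_eq_2)
  qed
  from pq_part_sum[of 0 2 c, OF this] have "pq_part (J x) 0 2 (ext_d (form01 f h) x) = c 0"
    unfolding ext .
  \<comment> \<open>The second summand starts from the (1,0) component of a (0,1)-form, which is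
    zero.\<close>
  moreover have "delbar J 1 (form01 f h) x = pq_part (J x) 0 2 (ext_d (\<lambda>y. pq_part (J y) 0 1 (form01 f h y)) x)
      + pq_part (J x) 1 1 (ext_d (\<lambda>y. pq_part (J y) 1 0 (form01 f h y)) x)"
    by (simp add: delbar_def numeral_2_eq_2)
  ultimately show "delbar J 1 (form01 f h) x = scale_covec (curl f h x) (G12 x)"
    using p[of 0] p[of 1] by (simp add: ext_d_0 c_def)
qed

lemma delbar_function:
  assumes u: "smooth u"
  shows "delbar J 0 (\<lambda>x. scale_covec (u x) unit_covec) = form01 (V1b u) (V2b u)"
proof
  fix x
  have unit: "scale_covec (u y) unit_covec \<in> covec_pq (J y) 0 0" for y
    using pq_wedge[of "[]" y "[]"] by (auto intro: covec_pq_scale)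
  define c where "c p = (if p = 0 then form01 (V1b u) (V2b u) x else scale_covec (V1 u x) F1 + scale_covec (V2 u x) (F2 x))" for p :: nat
  have alt: "alternating 1 (c 0 + c 1)"
    unfolding c_def by (auto intro!: alternating_add alternating_scale alternating_FG[unfolded One_nat_def] alternating_form01[unfolded One_nat_def])
  have ext: "ext_d (\<lambda>x. scale_covec (u x) unit_covec) x = c 0 + c 1"
  proof
    fix vs
    show "ext_d (\<lambda>x. scale_covec (u x) unit_covec) x vs = (c 0 + c 1) vs"
    proof (cases "length vs = 1")
      case False
      then show ?thesis
        using ext_d_eq_0[of 0 "\<lambda>x. scale_covec (u x) unit_covec" vs x] alternating_eq_0[OF alt]
        by (simp add: scale_covec_def unit_covec_def)
    next
      case True
      then obtain v where vs: "vs = [v]"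
        by (auto simp: length_Suc_conv)
      show ?thesis
        using derivative_eq_V[OF u, of x v]
        by (simp add: vs ext_d_1 c_def form01_simps scale_covec_def unit_covec_def)
    qed
  qed
  have "F1 \<in> covec_pq (J x) 1 0" "F2 x \<in> covec_pq (J x) 1 0"
    using pq_wedge[of "[F1]" x "[]"] pq_wedge[of "[F2 x]" x "[]"] by (simp_all add: wedge_unit_covec)
  then have ty: "c 0 \<in> covec_pq (J x) 0 1" "c 1 \<in> covec_pq (J x) 1 0"
    unfolding c_def by (auto intro!: covec_pq_add covec_pq_scale form01_type[unfolded One_nat_def])
  have "c p \<in> covec_pq (J x) p (0 + 1 - p)" if "p \<le> 0 + 1" for p
  proof -
    have "p = 0 \<or> p = 1"
      using that by auto
    then show ?thesis
      using ty by (elim disjE) (simp_all add: numeral_2_eq_2)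
  qed
  from pq_part_sum[of 0 1 c, OF this] have "pq_part (J x) 0 1 (ext_d (\<lambda>x. scale_covec (u x) unit_covec) x) = c 0"
    unfolding ext by simp
  then show "delbar J 0 (\<lambda>x. scale_covec (u x) unit_covec) x = form01 (V1b u) (V2b u) x"
    using pq_part_of_type[OF unit, of 0 0] by (simp add: delbar_def c_def)
qed

lemma ext_d_G12:
  assumes b: "smooth b"
  shows "ext_d (\<lambda>x. scale_covec (b x) (G12 x)) x =
    (scale_covec (V1 b x + complex_of_real (\<beta> / 4) * b x) (T1 x) + scale_covec (V2 b x) (T2 x)) +
    scale_covec (- complex_of_real (\<beta> / 4) * b x) (wedge_list [F1, F2 x, G1])" (is "_ = ?R")
proof
  fix vs
  have alt: "alternating 3 ?R"
    using alternating_wedge_FG[of "[F1, F2 x, G1]" x]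
    by (intro alternating_add alternating_scale alternating_T) (simp_all add: numeral_3_eq_3)
  show "ext_d (\<lambda>x. scale_covec (b x) (G12 x)) x vs = ?R vs"
  proof (cases "length vs = 3")
    case False
    then show ?thesis
      using ext_d_eq_0[of 2 "\<lambda>x. scale_covec (b x) (G12 x)" vs x]
        alternating_eq_0[OF alternating_scale[OF alternating_T(3)]] alternating_eq_0[OF alt]
      by simp
  next
    case True
    then obtain u v w where vs: "vs = [u, v, w]"
      by (auto simp: length_Suc_conv numeral_3_eq_3)
    have D: "frechet_derivative (\<lambda>y. scale_covec (b y) (G12 y) [v, w]) (at x) u =
        b x * (lG1 v * twist x u w - lG1 w * twist x u v) + frechet_derivative b (at x) u * (lG1 v * lG2 x w - lG1 w * lG2 x v)" for u v w
    proof -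
      have eq: "scale_covec (b y) (G12 y) [v, w] = b y * (lG1 v * lG2 y w - lG1 w * lG2 y v)" for y
        by (simp add: scale_covec_def G12_def wedge_eval)
      have "((\<lambda>y. scale_covec (b y) (G12 y) [v, w]) has_derivative (\<lambda>u. b x * (lG1 v * twist x u w - lG1 w * twist x u v)
          + frechet_derivative b (at x) u * (lG1 v * lG2 x w - lG1 w * lG2 x v))) (at x)"
        unfolding eq
        by (intro smooth_mult_has_derivative[OF b] has_derivative_diff has_derivative_mult_right has_derivative_lG2)
      from fun_cong[OF frechet_derivative_at[OF this]] show ?thesis
        by (rule sym)
    qed
    show ?thesis
      unfolding vs ext_d_3 D derivative_eq_V[OF b] twist_def
      by (simp add: scale_covec_def T1_def T2_def wedge_eval) (simp add: algebra_simps add_divide_distrib diff_divide_distrib)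
  qed
qed

lemma del_G12:
  assumes b: "smooth b"
  shows "del J 2 (\<lambda>x. scale_covec (b x) (G12 x)) =
    (\<lambda>x. scale_covec (V1 b x + complex_of_real (\<beta> / 4) * b x) (T1 x) + scale_covec (V2 b x) (T2 x))"
proof
  fix x
  let ?\<omega> = "\<lambda>x. scale_covec (b x) (G12 x)"
  have p: "pq_part (J y) p (2 - p) (?\<omega> y) = (if p = 0 then ?\<omega> y else 0)" if "p \<le> 2" for p y
    using pq_part_of_type[OF covec_pq_scale[OF type_T(3)], of p "2 - p"] that by auto
  \<comment> \<open>The components of type (0,3) and (3,0) are zero because the complex dimension is
    two.\<close>
  define c where "c p = (if p = 1 then scale_covec (V1 b x + complex_of_real (\<beta> / 4) * b x) (T1 x) + scale_covec (V2 b x) (T2 x)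
     else if p = 2 then scale_covec (- complex_of_real (\<beta> / 4) * b x) (wedge_list [F1, F2 x, G1]) else 0)" for p :: nat
  have ext: "ext_d ?\<omega> x = (\<Sum>p\<le>1 + 2. c p)"
    unfolding ext_d_G12[OF b] by (simp add: c_def numeral_eq_Suc)
  have "wedge_list [F1, F2 x, G1] \<in> covec_pq (J x) 2 1"
    using pq_wedge[of "[F1, F2 x]" x "[G1]"] by (simp add: numeral_2_eq_2)
  then have ty: "c 1 \<in> covec_pq (J x) 1 2" "c 2 \<in> covec_pq (J x) 2 1"
    unfolding c_def by (auto intro!: covec_pq_add covec_pq_scale covec_pq_uminus type_T[unfolded One_nat_def])
  have "c p \<in> covec_pq (J x) p (1 + 2 - p)" if "p \<le> 1 + 2" for p
  proof -
    have "p = 0 \<or> p = 1 \<or> p = 2 \<or> p = 3"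
      using that by auto
    then show ?thesis
      using ty by (elim disjE) (simp_all add: c_def covec_pq_0 numeral_2_eq_2)
  qed
  from pq_part_sum[of 1 2 c, OF this] have "pq_part (J x) 1 2 (ext_d ?\<omega> x) = c 1"
    unfolding ext .
  moreover have "del J 2 ?\<omega> x = pq_part (J x) 1 2 (ext_d (\<lambda>y. pq_part (J y) 0 2 (?\<omega> y)) x)
      + pq_part (J x) 2 1 (ext_d (\<lambda>y. pq_part (J y) 1 1 (?\<omega> y)) x)
      + pq_part (J x) 3 0 (ext_d (\<lambda>y. pq_part (J y) 2 0 (?\<omega> y)) x)"
    by (simp add: del_def numeral_eq_Suc)
  ultimately show "del J 2 ?\<omega> x =
      scale_covec (V1 b x + complex_of_real (\<beta> / 4) * b x) (T1 x) + scale_covec (V2 b x) (T2 x)"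
    using p[of 0] p[of 1] p[of 2] by (simp add: ext_d_0 c_def)
qed

text \<open>The group is unimodular, so left-invariant 3-forms are closed: all contributions of
  \<open>twist\<close> cancel and only derivatives of the coefficients survive.\<close>

lemma ext_d_T:
  assumes p: "smooth p" and q: "smooth q"
  shows "ext_d (\<lambda>x. scale_covec (p x) (T2 x) + scale_covec (q x) (T1 x)) x = scale_covec (V1 p x - V2 q x) (Top x)"
proof
  fix vs
  let ?\<omega> = "\<lambda>x. scale_covec (p x) (T2 x) + scale_covec (q x) (T1 x)"
  have alt: "alternating 4 (scale_covec (V1 p x - V2 q x) (Top x))"
    by (intro alternating_scale alternating_T)
  have alt3: "alternating 3 (?\<omega> y)" for y
    by (intro alternating_add alternating_scale alternating_T)
  show "ext_d ?\<omega> x vs = scale_covec (V1 p x - V2 q x) (Top x) vs"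
  proof (cases "length vs = 4")
    case False
    then show ?thesis
      using ext_d_eq_0[of 3 ?\<omega> vs x, OF alternating_eq_0[OF alt3]] alternating_eq_0[OF alt] by simp
  next
    case True
    then obtain u v w z where vs: "vs = [u, v, w, z]"
      by (auto simp: length_Suc_conv numeral_eq_Suc)
    let ?m = "\<lambda>u v. lG1 u * lG2 x v - lG1 v * lG2 x u"
    let ?n = "\<lambda>a u v. lG1 u * twist x a v - lG1 v * twist x a u"
    let ?D = "\<lambda>u v w a.
        (p x * ((lF2 x u * ?n a v w - twist x a u * ?m v w) - (lF2 x v * ?n a u w - twist x a v * ?m u w) + (lF2 x w * ?n a u v - twist x a w * ?m u v))
          + frechet_derivative p (at x) a * (lF2 x u * ?m v w - lF2 x v * ?m u w + lF2 x w * ?m u v)) +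
        (q x * (lF1 u * ?n a v w - lF1 v * ?n a u w + lF1 w * ?n a u v)
          + frechet_derivative q (at x) a * (lF1 u * ?m v w - lF1 v * ?m u w + lF1 w * ?m u v))"
    have D: "frechet_derivative (\<lambda>y. ?\<omega> y [u, v, w]) (at x) a = ?D u v w a" for a u v w
    proof -
      have eq: "?\<omega> y [u, v, w] =
        p y * (lF2 y u * (lG1 v * lG2 y w - lG1 w * lG2 y v) - lF2 y v * (lG1 u * lG2 y w - lG1 w * lG2 y u) + lF2 y w * (lG1 u * lG2 y v - lG1 v * lG2 y u)) +
        q y * (lF1 u * (lG1 v * lG2 y w - lG1 w * lG2 y v) - lF1 v * (lG1 u * lG2 y w - lG1 w * lG2 y u) + lF1 w * (lG1 u * lG2 y v - lG1 v * lG2 y u))" for y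
        by (simp add: scale_covec_def T1_def T2_def wedge_eval) (simp add: algebra_simps add_divide_distrib diff_divide_distrib)
      have m: "((\<lambda>y. lG1 u * lG2 y v - lG1 v * lG2 y u) has_derivative (\<lambda>a. ?n a u v)) (at x)" for u v
        by (intro has_derivative_diff has_derivative_mult_right has_derivative_lG2)
      have k: "((\<lambda>y. lF2 y z * (lG1 u * lG2 y v - lG1 v * lG2 y u)) has_derivative (\<lambda>a. lF2 x z * ?n a u v - twist x a z * ?m u v)) (at x)" for u v z
        using has_derivative_mult[OF has_derivative_lF2 m] by simp
      have "((\<lambda>y. ?\<omega> y [u, v, w]) has_derivative ?D u v w) (at x)"
        unfolding eq
        by (intro has_derivative_add smooth_mult_has_derivative[OF p] smooth_mult_has_derivative[OF q]
            has_derivative_diff[OF k k] has_derivative_diff[OF has_derivative_mult_right[OF m] has_derivative_mult_right[OF m]]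
            k has_derivative_mult_right[OF m])
      from fun_cong[OF frechet_derivative_at[OF this]] show ?thesis
        by (rule sym)
    qed
    show ?thesis
      unfolding vs ext_d_4 D derivative_eq_V[OF p] derivative_eq_V[OF q] twist_def
      by (simp add: scale_covec_def Top_def wedge_eval) (simp add: algebra_simps add_divide_distrib diff_divide_distrib)
  qed
qed

lemma del_T:
  assumes p: "smooth p" and q: "smooth q"
  shows "del J 3 (\<lambda>x. scale_covec (p x) (T2 x) + scale_covec (q x) (T1 x)) = (\<lambda>x. scale_covec (V1 p x - V2 q x) (Top x))"
proof
  fix x
  let ?\<omega> = "\<lambda>x. scale_covec (p x) (T2 x) + scale_covec (q x) (T1 x)"
  have "?\<omega> y \<in> covec_pq (J y) 1 2" for y
    by (intro covec_pq_add covec_pq_scale type_T)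
  then have p: "pq_part (J y) k (3 - k) (?\<omega> y) = (if k = 1 then ?\<omega> y else 0)" if "k \<le> 3" for k y
    using pq_part_of_type[of "?\<omega> y" "J y" 1 2 k "3 - k"] that by auto
  have "del J 3 ?\<omega> x = pq_part (J x) 1 3 (ext_d (\<lambda>y. pq_part (J y) 0 3 (?\<omega> y)) x)
      + pq_part (J x) 2 2 (ext_d (\<lambda>y. pq_part (J y) 1 2 (?\<omega> y)) x)
      + pq_part (J x) 3 1 (ext_d (\<lambda>y. pq_part (J y) 2 1 (?\<omega> y)) x)
      + pq_part (J x) 4 0 (ext_d (\<lambda>y. pq_part (J y) 3 0 (?\<omega> y)) x)"
    by (simp add: del_def numeral_eq_Suc)
  also have "\<dots> = pq_part (J x) 2 2 (ext_d ?\<omega> x)"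
    using p[of 0] p[of 1] p[of 2] p[of 3] by (simp add: ext_d_0)
  also have "\<dots> = scale_covec (V1 p x - V2 q x) (Top x)"
    unfolding ext_d_T[OF assms] using pq_part_of_type[OF covec_pq_scale[OF type_T(4)], of 2 2] by simp
  finally show "del J 3 ?\<omega> x = scale_covec (V1 p x - V2 q x) (Top x)" .
qed

end


lemma cfld_cmult: "smooth f \<Longrightarrow> cfld i j a (\<lambda>x. c * f x) = (\<lambda>x. c * cfld i j a f x)"
  by (simp add: cfld_def fld_cmult fun_eq_iff algebra_simps)

lemma cfld_zero: "cfld i j a (\<lambda>x. 0) = (\<lambda>x. 0)"
  by (simp add: cfld_def fld_const)

context kt_system
begin

lemma delbar_star_form01:
  assumes f: "smooth f" and h: "smooth h"
  shows "delbar_star J g 1 (form01 f h) = (\<lambda>x. scale_covec (- 2 * codiff f h x) unit_covec)"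
proof -
  let ?p = "\<lambda>x. complex_of_real (r\<^sup>2) / 2 * f x" and ?q = "\<lambda>x. - (1 / 2) * h x"
  have p: "smooth ?p" and q: "smooth ?q"
    by (intro smooth_mult smooth_const f h)+
  have "4 / complex_of_real (r\<^sup>2) * (V1 ?p x - V2 ?q x) = 2 * codiff f h x" for x
    unfolding cfld_cmult[OF f] cfld_cmult[OF h] codiff_def using r by (simp add: field_simps)
  then have "hodge J g 4 (del J 3 (hodge J g 1 (form01 f h))) = (\<lambda>x. scale_covec (2 * codiff f h x) unit_covec)"
    unfolding hodge_form01 del_T[OF p q] hodge_Top by simp
  then show ?thesis
    by (simp add: delbar_star_def fun_eq_iff scale_covec_def)
qed

lemma delbar_star_G12:
  assumes b: "smooth b"
  shows "delbar_star J g 2 (\<lambda>x. scale_covec (b x) (G12 x)) =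
    form01 (\<lambda>x. 2 / complex_of_real (r\<^sup>2) * V2 b x) (\<lambda>x. - 2 * (V1 b x + complex_of_real (\<beta> / 4) * b x))"
proof -
  have "delbar_star J g 2 (\<lambda>x. scale_covec (b x) (G12 x)) =
    - form01 (\<lambda>x. - 2 / complex_of_real (r\<^sup>2) * V2 b x) (\<lambda>x. 2 * (V1 b x + complex_of_real (\<beta> / 4) * b x))"
    by (simp only: delbar_star_def hodge_G12 del_G12[OF b] hodge_T diff_numeral_special diff_numeral_simps
        semiring_norm numeral_2_eq_2[symmetric] hodge_G12) (simp add: hodge_G12 del_G12[OF b] hodge_T)
  then show ?thesis
    by (simp add: form01_def fun_eq_iff scale_covec_def algebra_simps)
qed

lemma laplacian_form01:
  assumes f: "kt_fun f" and h: "kt_fun h"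
  shows "laplacian J g 1 (form01 f h) =
    form01 (\<lambda>x. - 2 * (V1b (codiff f h) x - complex_of_real (1 / r\<^sup>2) * V2 (curl f h) x))
      (\<lambda>x. - 2 * (V2b (codiff f h) x + V1 (curl f h) x + complex_of_real (\<beta> / 4) * curl f h x))"
proof -
  have sm: "smooth f" "smooth h" "smooth (codiff f h)" "smooth (curl f h)"
    by (intro kt_fun_smooth kt_fun_codiff kt_fun_curl f h)+
  have "delbar J 0 (delbar_star J g 1 (form01 f h)) =
      form01 (\<lambda>x. - 2 * V1b (codiff f h) x) (\<lambda>x. - 2 * V2b (codiff f h) x)"
    unfolding delbar_star_form01[OF sm(1,2)]
    using delbar_function[OF smooth_mult[OF smooth_const sm(3)], of "-2"]
    by (simp only: cfld_cmult[OF sm(3)])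
  moreover have "delbar_star J g 2 (delbar J 1 (form01 f h)) =
      form01 (\<lambda>x. 2 / complex_of_real (r\<^sup>2) * V2 (curl f h) x) (\<lambda>x. - 2 * (V1 (curl f h) x + complex_of_real (\<beta> / 4) * curl f h x))"
    unfolding delbar_form01[OF sm(1,2)] by (rule delbar_star_G12[OF sm(4)])
  ultimately have "laplacian J g 1 (form01 f h) =
      form01 (\<lambda>x. - 2 * V1b (codiff f h) x) (\<lambda>x. - 2 * V2b (codiff f h) x) +
      form01 (\<lambda>x. 2 / complex_of_real (r\<^sup>2) * V2 (curl f h) x) (\<lambda>x. - 2 * (V1 (curl f h) x + complex_of_real (\<beta> / 4) * curl f h x))"
    unfolding laplacian_def by (simp add: numeral_2_eq_2)
  then show ?thesis
    by (simp add: form01_def fun_eq_iff scale_covec_def algebra_simps)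
qed

lemma form01_eq_0_iff: "form01 f h = 0 \<longleftrightarrow> f = (\<lambda>x. 0) \<and> h = (\<lambda>x. 0)"
proof
  assume "form01 f h = 0"
  then have z: "form01 f h x [v] = 0" for x v
    by simp
  have "f x = 0 \<and> h x = 0" for x
    using z[of x "pt (1, 0, 0, 0)"] z[of x "pt (0, 0, 1, x $ 2)"]
    by (simp add: form01_simps lG1_def lG2_def)
  then show "f = (\<lambda>x. 0) \<and> h = (\<lambda>x. 0)"
    by auto
qed (simp add: form01_def fun_eq_iff scale_covec_def)

lemma kt_form_form01:
  assumes f: "kt_fun f" and h: "kt_fun h"
  shows "kt_form_pq J 0 1 (form01 f h)"
proof -
  have "smooth (\<lambda>x. form01 f h x vs)" for vs
  proof (cases "length vs = 1")
    case True
    then obtain v where vs: "vs = [v]"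
      by (auto simp: length_Suc_conv)
    have "smooth (\<lambda>x. lG2 x v)"
      unfolding lG2_def
      by (intro smooth_diff smooth_mult smooth_const smooth_bounded_linear[OF bounded_linear_of_real] smooth_nth)
    then show ?thesis
      unfolding vs form01_simps by (intro smooth_add smooth_mult smooth_const kt_fun_smooth[OF f] kt_fun_smooth[OF h])
  qed (simp add: alternating_eq_0[OF alternating_form01] smooth_const)
  moreover have "form01 f h (kt_mult a x) (map (kt_push a x) vs) = form01 f h x vs" if "a \<in> kt_lattice" for a x vs
  proof (cases "length vs = 1")
    case True
    then obtain v where vs: "vs = [v]"
      by (auto simp: length_Suc_conv)
    have "lG1 (kt_push a x v) = lG1 v" "lG2 (kt_mult a x) (kt_push a x v) = lG2 x v"
      by (simp_all add: lG1_def lG2_def kt_push_nth kt_mult_nth algebra_simps)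
    then show ?thesis
      using f h that by (simp add: vs form01_simps kt_fun_def)
  qed (simp add: alternating_eq_0[OF alternating_form01])
  ultimately show ?thesis
    using alternating_form01 form01_type by (simp add: kt_form_pq_def kt_form_def)
qed

text \<open>The coefficients are the values on the t-field and the third frame field, whose
  left-invariance makes them functions on the quotient. Type (0,1) then determines the values on the
  images of these fields under J.\<close>

lemma kt_form_pq_eq_form01:
  assumes "kt_form_pq J 0 1 \<alpha>"
  obtains f h where "kt_fun f" "kt_fun h" "\<alpha> = form01 f h"
proof
  let ?f = "\<lambda>x. \<alpha> x [pt (1, 0, 0, 0)]" and ?h = "\<lambda>x. \<alpha> x [pt (0, 0, 1, x $ 2)]"
  have alt: "alternating 1 (\<alpha> x)" and sm: "smooth (\<lambda>x. \<alpha> x vs)" and ty: "\<alpha> x \<in> covec_pq (J x) 0 1"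
    and inv: "a \<in> kt_lattice \<Longrightarrow> \<alpha> (kt_mult a x) (map (kt_push a x) vs) = \<alpha> x vs" for x vs a
    using assms by (auto simp: kt_form_pq_def kt_form_def)
  have push: "kt_push a x (pt (1, 0, 0, 0)) = pt (1, 0, 0, 0)"
    "kt_push a x (pt (0, 0, 1, x $ 2)) = pt (0, 0, 1, kt_mult a x $ 2)" for a x
    by (simp_all add: vec_eq_iff forall_4 kt_push_nth kt_mult_nth)
  show "kt_fun ?f"
    using sm inv[of _ _ "[pt (1, 0, 0, 0)]"] by (simp add: kt_fun_def push)
  \<comment> \<open>Smoothness of \<alpha> is given only for arguments independent of the point, so
    the moving vector is expanded in constant ones.\<close>
  have "?h = (\<lambda>x. \<alpha> x [axis 3 1] + complex_of_real (x $ 2) * \<alpha> x [axis 4 1])"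
  proof
    fix x
    interpret linear "\<lambda>v. \<alpha> x [v]"
      by (rule alternating_1_linear[OF alt])
    have "\<alpha> x [pt (0, 0, 1, x $ 2)] = \<alpha> x [axis 3 1 + x $ 2 *\<^sub>R axis 4 1]"
      by (simp add: pt_def)
    then show "?h x = \<alpha> x [axis 3 1] + complex_of_real (x $ 2) * \<alpha> x [axis 4 1]"
      unfolding add scale by (simp add: scaleR_conv_of_real)
  qed
  then have "smooth ?h"
    using sm by (auto intro!: smooth_add smooth_mult smooth_of_real_nth)
  then show "kt_fun ?h"
    using inv[of _ x "[pt (0, 0, 1, x $ 2)]" for x] by (simp add: kt_fun_def push)
  show "\<alpha> = form01 ?f ?h"
  proof
    fix x
    interpret orthonormal_frame "g x" "J x" "cof x" "fr x"
      by (rule frame)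
    define \<delta> where "\<delta> = \<alpha> x - form01 ?f ?h x"
    have \<delta>: "alternating 1 \<delta>"
      unfolding \<delta>_def by (intro alternating_diff alt alternating_form01)
    interpret L: linear "\<lambda>v. \<delta> [v]"
      by (rule alternating_1_linear[OF \<delta>])
    have "\<delta> \<in> covec_pq (J x) 0 1"
      unfolding \<delta>_def using ty form01_type by (simp add: covec_pq_def covec.span_diff)
    \<comment> \<open>For a = 0 and b = 1 the action on arguments is J itself.\<close>
    from covec_pq_map[OF this, of 0 1] have J: "\<delta> [J x v] = Complex 0 (- 1) * \<delta> [v]" for v
      by (metis (no_types, lifting) One_nat_def add_0 list.simps(8) list.simps(9) mult_1 power_0 power_one_right scaleR_one scaleR_zero_left)
    have 1: "\<delta> [fr x 1] = 0"
      by (simp add: \<delta>_def form01_simps fr_simps lG1_def lG2_def)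
    have "\<delta> [fr x 3] = \<delta> [(1 / r) *\<^sub>R pt (0, 0, 1, x $ 2)]"
      by (simp add: fr_simps pt_def algebra_simps)
    also have "\<dots> = 0"
      unfolding L.scale by (simp add: \<delta>_def form01_simps lG1_def lG2_def)
    finally have 3: "\<delta> [fr x 3] = 0" .
    have "fr x 2 = J x (fr x 1)" "fr x 4 = J x (fr x 3)"
      by (simp_all add: vec_eq_iff forall_4 fr_simps kt_J_nth)
    then have "\<delta> [fr x 2] = 0" "\<delta> [fr x 4] = 0"
      using 1 3 by (simp_all add: J)
    with 1 3 have "\<delta> = 0"
      by (intro alternating_1_eq_0 \<delta>)
    then show "\<alpha> x = form01 ?f ?h x"
      by (simp add: \<delta>_def)
  qed
qed

section \<open>Harmonic forms and the two Hodge numbers\<close>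

lemma harmonic_form01:
  assumes "\<alpha> \<in> harmonic_forms J g 0 1"
  obtains f h where "kt_fun f" "kt_fun h" "\<alpha> = form01 f h" "codiff f h = (\<lambda>x. 0)" "curl f h = (\<lambda>x. 0)"
proof -
  from assms have pq: "kt_form_pq J 0 1 \<alpha>" and lap: "laplacian J g 1 \<alpha> = 0"
    by (simp_all add: harmonic_forms_def)
  from pq obtain f h where fh: "kt_fun f" "kt_fun h" "\<alpha> = form01 f h"
    by (rule kt_form_pq_eq_form01)
  have "- 2 * (V1b (codiff f h) x - complex_of_real (1 / r\<^sup>2) * V2 (curl f h) x) = 0"
    "- 2 * (V2b (codiff f h) x + V1 (curl f h) x + complex_of_real (\<beta> / 4) * curl f h x) = 0" for x
    using lap unfolding fh(3) laplacian_form01[OF fh(1,2)] form01_eq_0_iff by (auto dest: fun_cong[of _ _ x])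
  then have "V1b (codiff f h) x = complex_of_real (1 / r\<^sup>2) * V2 (curl f h) x"
    "V2b (codiff f h) x + V1 (curl f h) x + complex_of_real (\<beta> / 4) * curl f h x = 0" for x
    by (metis eq_iff_diff_eq_0 mult_eq_0_iff neg_equal_0_iff_equal zero_neq_numeral)+
  from laplace_imp_first_order[OF fh(1,2) this] fh that show thesis
    by blast
qed

lemma form01_harmonic:
  assumes f: "kt_fun f" and h: "kt_fun h" and "codiff f h = (\<lambda>x. 0)" "curl f h = (\<lambda>x. 0)"
  shows "form01 f h \<in> harmonic_forms J g 0 1"
  using assms kt_form_form01[OF f h] laplacian_form01[OF f h]
  by (simp add: harmonic_forms_def cfld_zero form01_eq_0_iff)

lemma hodge_number_small:
  assumes "r * \<beta>\<^sup>2 < 4" "r * \<beta> < 4"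
  shows "hodge_number J g 0 1 \<le> 2"
proof -
  define w where "w = (\<lambda>x :: vec4. exp (- \<i> * complex_of_real (\<beta> / 2) * complex_of_real (x $ 2)))"
  let ?B = "{form01 (\<lambda>x. 1) (\<lambda>x. 0), form01 (\<lambda>x. 0) w}"
  have sub: "harmonic_forms J g 0 1 \<subseteq> form.span ?B"
  proof
    fix \<alpha> assume "\<alpha> \<in> harmonic_forms J g 0 1"
    then obtain f h where fh: "kt_fun f" "kt_fun h" "\<alpha> = form01 f h" "codiff f h = (\<lambda>x. 0)" "curl f h = (\<lambda>x. 0)"
      by (rule harmonic_form01)
    from first_order_solution[OF fh(1,2,4,5) assms] obtain c d where "f = (\<lambda>x. c)" "h = (\<lambda>x. d * w x)"
      unfolding w_def by blast
    then have "\<alpha> = scale_form c (form01 (\<lambda>x. 1) (\<lambda>x. 0)) + scale_form d (form01 (\<lambda>x. 0) w)"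
      by (simp add: fh(3) form01_def scale_form_def scale_covec_def fun_eq_iff)
    then show "\<alpha> \<in> form.span ?B"
      by (auto intro: form.span_add form.span_scale form.span_base)
  qed
  \<comment> \<open>The same spanning set bounds the dimension and rules out the value \<infinity>
    of \<open>hodge_number\<close>.\<close>
  then have "\<exists>B. finite B \<and> harmonic_forms J g 0 1 \<subseteq> form.span B"
    by (intro exI[of _ ?B]) simp
  moreover have "form.dim (harmonic_forms J g 0 1) \<le> card ?B"
    by (rule form.dim_le_card[OF sub]) simp
  moreover have "card ?B \<le> 2"
    by (simp add: card_insert_if)
  ultimately have "hodge_number J g 0 1 = enat (form.dim (harmonic_forms J g 0 1))"
    "form.dim (harmonic_forms J g 0 1) \<le> 2"
    by (simp_all add: hodge_number_def)
  then show ?thesis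
    by (metis enat_ord_simps(1) numeral_eq_enat)
qed

end

text \<open>Finite dimensionality need not be known: in the other case the value is \<infinity>.
  Hence the lower bound for r = 1 requires no elliptic theory.\<close>

lemma hodge_number_ge:
  assumes S: "S \<subseteq> harmonic_forms J g p q" "form.independent S"
  shows "enat (card S) \<le> hodge_number J g p q"
proof (cases "\<exists>B. finite B \<and> harmonic_forms J g p q \<subseteq> form.span B")
  case True
  then obtain B where B: "finite B" "harmonic_forms J g p q \<subseteq> form.span B"
    by blast
  obtain A where A: "S \<subseteq> A" "A \<subseteq> harmonic_forms J g p q" "form.independent A" "harmonic_forms J g p q \<subseteq> form.span A"
    using form.maximal_independent_subset_extend[OF S] by blast
  have "finite A"
    using form.independent_span_bound[OF B(1) A(3)] A(2) B(2) by blast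
  then have "card S \<le> form.dim (harmonic_forms J g p q)"
    using form.basis_card_eq_dim[OF A(2,4,3)] card_mono[OF _ A(1)] by simp
  then show ?thesis
    using True by (simp add: hodge_number_def)
qed (auto simp: hodge_number_def)

text \<open>
  The Fourier mode of frequency \<open>(-1, m)\<close> in \<open>(x, y)\<close>: with \<open>\<beta> = 8 \<pi>\<close> and \<open>r = 1\<close> a mode of frequency
  \<open>(l, m)\<close> contributes precisely if \<open>l\<^sup>2 + 2 l + m\<^sup>2 = 0\<close>.
\<close>

definition mode :: "int \<Rightarrow> vec4 \<Rightarrow> complex" where
  "mode m x = exp (2 * of_real pi * \<i> * (of_int m * complex_of_real (x $ 3) - complex_of_real (x $ 2)))"

lemma bounded_linear_mode:
  "bounded_linear (\<lambda>x :: vec4. 2 * of_real pi * \<i> * (of_int m * complex_of_real (x $ 3) - complex_of_real (x $ 2)))"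
  by (intro bounded_linear_const_mult bounded_linear_sub bounded_linear_compose[OF bounded_linear_of_real bounded_linear_vec_nth])

lemma kt_fun_mode: "kt_fun (mode m)"
proof -
  have "smooth (mode m)"
    unfolding mode_def[abs_def] by (rule smooth_exp_linear[OF bounded_linear_mode])
  moreover have "mode m (kt_mult a x) = mode m x" if "a \<in> kt_lattice" for a x
  proof -
    have "a $ 2 \<in> \<int>" "a $ 3 \<in> \<int>"
      using that by (simp_all add: kt_lattice_def)
    then obtain k l :: int where kl: "a $ 2 = of_int k" "a $ 3 = of_int l"
      by (elim Ints_cases)
    have "mode m (kt_mult a x) = mode m x * exp (2 * of_real pi * \<i> * of_int (m * l - k))"
      unfolding mode_def exp_add[symmetric] by (simp add: kt_mult_nth kl algebra_simps)
    also have "exp (2 * of_real pi * \<i> * of_int (m * l - k)) = 1"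
      using exp_integer_2pi[of "of_int (m * l - k)"] by (simp add: mult_ac)
    finally show ?thesis by simp
  qed
  ultimately show ?thesis
    by (simp add: kt_fun_def)
qed

lemma fld_mode:
  "fld i (mode m) x = 2 * of_real pi * \<i> * (of_int m * complex_of_real (kt_frame x i $ 3) - complex_of_real (kt_frame x i $ 2)) * mode m x"
proof -
  have "(mode m has_derivative (\<lambda>v. 2 * of_real pi * \<i> * (of_int m * complex_of_real (v $ 3) - complex_of_real (v $ 2)) * mode m x)) (at x)"
    using has_derivative_compose[OF bounded_linear_imp_has_derivative[OF bounded_linear_mode]
        DERIV_exp[unfolded has_field_derivative_def]]
    unfolding mode_def[abs_def] by (simp add: mult_ac)
  then show ?thesis
    by (rule fld_has_derivative)
qed

text \<open>At frequency (-1, m) the equations for multiples f, h of the mode reduce to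
  \<open>f = \<i> m h\<close> and \<open>h = - \<i> m f\<close>. They are equivalent exactly because
  \<open>m * m = 1\<close>, and the first dictates the factor \<open>\<i> m\<close>.\<close>

lemma (in kt_system) mode_first_order:
  assumes "\<beta> = 8 * pi" "r = 1" "m * m = 1"
  shows "codiff (\<lambda>x. \<i> * of_int m * mode m x) (mode m) = (\<lambda>x. 0)"
    "curl (\<lambda>x. \<i> * of_int m * mode m x) (mode m) = (\<lambda>x. 0)"
proof -
  have mm: "of_int m * (of_int m * z) = (z :: complex)" for z
    using assms(3) by (metis mult.assoc mult_1 of_int_1 of_int_mult)
  have ii: "\<i> * (\<i> * z) = - z" for z
    by (simp flip: mult.assoc)
  note s = kt_fun_smooth[OF kt_fun_mode]
  have F: "fld 1 (mode m) = (\<lambda>x. 0)" "fld 2 (mode m) = (\<lambda>x. - 2 * of_real pi * \<i> * mode m x)"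
    "fld 3 (mode m) = (\<lambda>x. 2 * of_real pi * \<i> * of_int m * mode m x)" "fld 4 (mode m) = (\<lambda>x. 0)"
    by (simp_all add: fld_mode kt_frame_simps axis_def fun_eq_iff)
  show "codiff (\<lambda>x. \<i> * of_int m * mode m x) (mode m) = (\<lambda>x. 0)"
    unfolding codiff_def cfld_cmult[OF s] unfolding cfld_def F assms(1,2)
    by (simp add: fun_eq_iff algebra_simps ii mm)
  show "curl (\<lambda>x. \<i> * of_int m * mode m x) (mode m) = (\<lambda>x. 0)"
    unfolding curl_def cfld_cmult[OF s] unfolding cfld_def F assms(1,2)
    by (simp add: fun_eq_iff algebra_simps ii mm)
qed

lemma (in kt_system) hodge_number_modes:
  assumes "\<beta> = 8 * pi" "r = 1"
  shows "3 \<le> hodge_number J g 0 1"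
proof -
  define \<alpha> where "\<alpha> m = form01 (\<lambda>x. \<i> * of_int m * mode m x) (mode m)" for m
  define \<alpha>0 where "\<alpha>0 = form01 (\<lambda>x. 1) (\<lambda>x. 0)"
  have "\<alpha>0 \<in> harmonic_forms J g 0 1"
    unfolding \<alpha>0_def
    by (intro form01_harmonic kt_fun_const) (simp_all add: codiff_def curl_def cfld_def fld_const)
  moreover have "\<alpha> m \<in> harmonic_forms J g 0 1" if "m * m = 1" for m
    unfolding \<alpha>_def by (intro form01_harmonic kt_fun_cmult kt_fun_mode mode_first_order assms that)
  ultimately have sub: "{\<alpha>0, \<alpha> 1, \<alpha> (-1)} \<subseteq> harmonic_forms J g 0 1"
    by simp
  have lin: "scale_form a \<alpha>0 + scale_form b (\<alpha> 1) + scale_form c (\<alpha> (-1)) = 0 \<Longrightarrow> a = 0 \<and> b = 0 \<and> c = 0" for a b c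
  proof -
    assume 0: "scale_form a \<alpha>0 + scale_form b (\<alpha> 1) + scale_form c (\<alpha> (-1)) = 0"
    have "form01 (\<lambda>x. a + b * \<i> * mode 1 x - c * \<i> * mode (-1) x) (\<lambda>x. b * mode 1 x + c * mode (-1) x) =
        scale_form a \<alpha>0 + scale_form b (\<alpha> 1) + scale_form c (\<alpha> (-1))"
      by (simp add: \<alpha>_def \<alpha>0_def form01_def scale_form_def scale_covec_def fun_eq_iff algebra_simps)
    then have z: "a + b * \<i> * mode 1 x - c * \<i> * mode (-1) x = 0" "b * mode 1 x + c * mode (-1) x = 0" for x
      unfolding 0 form01_eq_0_iff by (auto dest: fun_cong[of _ _ x])
    have m0: "mode m 0 = 1" for m
      by (simp add: mode_def)
    \<comment> \<open>At y = 1/4 the two modes take opposite values, whereas they agree at the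
      origin. The two evaluations separate b from c.\<close>
    have "mode 1 (pt (0, 0, 1 / 4, 0)) = \<i>" "mode (-1) (pt (0, 0, 1 / 4, 0)) = - \<i>"
      by (simp_all add: mode_def exp_eq_polar cis_conv_exp[symmetric] complex_eq_iff Re_exp Im_exp)
    then have "b = 0 \<and> c = 0"
      using z(2)[of 0] z(2)[of "pt (0, 0, 1 / 4, 0)"] by (simp add: m0 complex_eq_iff)
    with z(1)[of 0] show ?thesis
      by simp
  qed
  have ne: "\<alpha>0 \<notin> form.span {\<alpha> 1, \<alpha> (-1)}"
  proof
    assume "\<alpha>0 \<in> form.span {\<alpha> 1, \<alpha> (-1)}"
    then obtain k l where "\<alpha>0 - scale_form k (\<alpha> 1) - scale_form l (\<alpha> (-1)) = 0"
      by (auto simp: form.span_breakdown_eq)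
    then show False
      using lin[of 1 "- k" "- l"] by simp
  qed
  have ne1: "\<alpha> 1 \<notin> form.span {\<alpha> (-1)}"
  proof
    assume "\<alpha> 1 \<in> form.span {\<alpha> (-1)}"
    then obtain l where "\<alpha> 1 - scale_form l (\<alpha> (-1)) = 0"
      by (auto simp: form.span_breakdown_eq)
    then show False
      using lin[of 0 1 "- l"] by simp
  qed
  have ne2: "\<alpha> (-1) \<noteq> 0"
    using lin[of 0 0 1] by auto
  have d: "\<alpha> 1 \<noteq> \<alpha> (-1)" "\<alpha>0 \<notin> {\<alpha> 1, \<alpha> (-1)}"
    using ne ne1 form.span_base[of "\<alpha> (-1)" "{\<alpha> (-1)}"] form.span_base[of \<alpha>0 "{\<alpha> 1, \<alpha> (-1)}"] by auto
  have "form.independent {\<alpha>0, \<alpha> 1, \<alpha> (-1)}"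
    using ne ne1 ne2 d by (simp add: form.independent_insert)
  from hodge_number_ge[OF sub this] d show ?thesis
    by (simp add: numeral_eq_enat card_insert_if numeral_3_eq_3)
qed

theorem theorem1p3:
  shows "\<exists>J. almost_complex_structure J \<and>
    (\<exists>g1 g2. almost_kaehler J g1 \<and> almost_kaehler J g2 \<and>
       hodge_number J g1 0 1 \<noteq> hodge_number J g2 0 1)"
proof (intro exI conjI)
  let ?\<beta> = "8 * pi"
  show "almost_complex_structure (kt_J ?\<beta>)"
    by (rule almost_complex_structure_kt_J) simp
  \<comment> \<open>With r = 1/256 the condition \<open>r * \<beta>\<^sup>2 < 4\<close> reads
    \<open>pi\<^sup>2 / 4 < 4\<close>, which needs no better bound than
    \<open>pi < 4\<close>.\<close>
  show "almost_kaehler (kt_J ?\<beta>) (kt_g ?\<beta> 1)" "almost_kaehler (kt_J ?\<beta>) (kt_g ?\<beta> (1 / 256))"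
    by (simp_all add: almost_kaehler_kt_g)
  interpret k1: kt_system ?\<beta> 1
    by standard simp_all
  interpret k2: kt_system ?\<beta> "1 / 256"
    by standard simp_all
  have "pi\<^sup>2 < 4\<^sup>2"
    using pi_less_4 pi_gt_zero by (intro power_strict_mono) auto
  then have "hodge_number (kt_J ?\<beta>) (kt_g ?\<beta> (1 / 256)) 0 1 \<le> 2"
    using pi_less_4 by (intro k2.hodge_number_small) (simp_all add: power_mult_distrib)
  moreover have "3 \<le> hodge_number (kt_J ?\<beta>) (kt_g ?\<beta> 1) 0 1"
    by (rule k1.hodge_number_modes) simp_all
  moreover have "(2 :: enat) < 3"
    by simp
  ultimately have "hodge_number (kt_J ?\<beta>) (kt_g ?\<beta> (1 / 256)) 0 1 < hodge_number (kt_J ?\<beta>) (kt_g ?\<beta> 1) 0 1"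
    by (meson le_less_trans less_le_trans)
  then show "hodge_number (kt_J ?\<beta>) (kt_g ?\<beta> 1) 0 1 \<noteq> hodge_number (kt_J ?\<beta>) (kt_g ?\<beta> (1 / 256)) 0 1"
    by auto
qed

end
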